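(* Let $(M,E)$ be a compact contact manifold with a choice of contact form $\theta$, let $\Omega=-d\theta|_{E\otimes E}$, and let $\pi:(\mathbb{L},h,\nabla)\to(M,E,\Omega)$ be a quantum bundle. Consider the map from $C^\infty(M)$ to the space of skew-Hermitian operators on $\mathcal{H}=\Gamma_{L^2}(M,\mathbb{L})$ given by $f\mapsto A_f=\nabla_{X_f}+i\pi^*f$. Then the restriction of this map to $C^\infty_b(M)=\{f\in C^\infty(M)\mid\xi\cdot f=0\}$ is a Lie algebra homomorphism, i.e. $[A_f,A_g]=A_{\{f,g\}}$ for all $f,g\in C^\infty_b(M)$, where $\{\cdot,\cdot\}$ is the Jacobi bracket and $[\cdot,\cdot]$ is the commutator bracket.
   Context: $M$ is a compact manifold of dimension $2n+1$ with cooriented contact distribution $E=\ker\theta\subset TM$, where $\theta$ is a global contact form ($\theta\wedge(d\theta)^n$ is nowhere zero). The 2-form $\Omega=-d\theta$ restricts to a symplectic structure on the fibres of $E$. The Reeb field $\xi$ is the unique vector field with $\theta(\xi)=1$ and $\iota(\xi)d\theta=0$. The map $\Lambda^\#:T^*M\to TM$ is determined by $\theta(\Lambda^\#\eta)=0$ and $\iota(\Lambda^\#\eta)d\theta=\eta(\xi)\theta-\eta$ for all $\eta\in T^*M$. The Hamiltonian vector field of $f\in C^\infty(M)$ is $X_f=\Lambda^\#(df)+f\xi$, and the Jacobi bracket on $C^\infty(M)$ is $\{f,g\}=X_f\cdot g-g(\xi\cdot f)$; it restricts to a Poisson bracket on $C^\infty_b(M)$, which is a Lie subalgebra of $(C^\infty(M),\{\cdot,\cdot\})$.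 Quantum bundle: a Hermitian line bundle $\pi:\mathbb{L}\to M$ equipped with metric $h$ and connection $\nabla$ is called a quantum bundle over $(M,E,\Omega)$ if the restriction of the curvature form of $\nabla$ to $E\otimes E$ is equal to $i\Omega$. $\mathcal{H}=\Gamma_{L^2}(M,\mathbb{L})$ is the $L^2$-completion of the space of smooth sections of $\mathbb{L}$ with respect to the inner product $\langle s_1,s_2\rangle=\int_M h(s_1,s_2)\,\mu_\theta$, where $\mu_\theta=\theta\wedge(d\theta)^n/n!$. In $A_f$, the term $i\pi^*f$ acts on sections as multiplication by $if$.
   Formalization: In dimension 3 (n=1) the curvature is also assumed to vanish on (ξ,·), as the claim fails otherwise (example on S^3); A_f is asserted skew-Hermitian only for f in C_b^∞(M), since it fails for other f; the connection is taken to be compatible with h. *)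

theory Defs
  imports "HOL-Analysis.Analysis"
begin

section \<open>Smooth manifolds\<close>

primrec Ck_on :: "nat \<Rightarrow> 'a::real_normed_vector set \<Rightarrow> ('a \<Rightarrow> 'b::real_normed_vector) \<Rightarrow> bool" where
  "Ck_on 0 S f \<longleftrightarrow> continuous_on S f"
| "Ck_on (Suc k) S f \<longleftrightarrow>
     (\<exists>f'. (\<forall>x\<in>S. (f has_derivative f' x) (at x)) \<and> (\<forall>v. Ck_on k S (\<lambda>x. f' x v)))"

text \<open>Only used for open sets \<open>S\<close>.\<close>

definition Cinf_on :: "'a::real_normed_vector set \<Rightarrow> ('a \<Rightarrow> 'b::real_normed_vector) \<Rightarrow> bool" where
  "Cinf_on S f \<longleftrightarrow> (\<forall>k. Ck_on k S f)"

type_synonym ('m, 'e) chart = "'m set \<times> ('m \<Rightarrow> 'e)"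

definition chart_inv :: "('m, 'e) chart \<Rightarrow> 'e \<Rightarrow> 'm" where
  "chart_inv c = inv_into (fst c) (snd c)"

text \<open>
  The manifold is the whole Hausdorff space \<open>'m\<close>, modelled on the Euclidean space \<open>'e\<close>.
  The atlas need not be maximal. Second countability is not listed because the
  manifold will be compact, which makes it automatic.
\<close>

definition smooth_atlas :: "('m::t2_space, 'e::euclidean_space) chart set \<Rightarrow> bool" where
  "smooth_atlas A \<longleftrightarrow>
     (\<Union>c\<in>A. fst c) = UNIV \<and>
     (\<forall>c\<in>A. open (fst c) \<and> open (snd c ` fst c) \<and>
        homeomorphism (fst c) (snd c ` fst c) (snd c) (chart_inv c)) \<and>
     (\<forall>c\<in>A. \<forall>d\<in>A. Cinf_on (snd c ` (fst c \<inter> fst d)) (snd d \<circ> chart_inv c))"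

definition smooth_on :: "('m, 'e::euclidean_space) chart set \<Rightarrow> 'm set \<Rightarrow>
    ('m \<Rightarrow> 'b::real_normed_vector) \<Rightarrow> bool" where
  "smooth_on A W f \<longleftrightarrow> (\<forall>c\<in>A. Cinf_on (snd c ` (fst c \<inter> W)) (f \<circ> chart_inv c))"

abbreviation smooth :: "('m, 'e::euclidean_space) chart set \<Rightarrow>
    ('m \<Rightarrow> 'b::real_normed_vector) \<Rightarrow> bool" where
  "smooth A \<equiv> smooth_on A UNIV"


section \<open>Vector fields and differential forms\<close>

text \<open>
  Tangent vectors at \<open>p\<close> are derivations at \<open>p\<close> of the algebra of smooth functions.
  They are set to \<open>0\<close> on non-smooth functions so that equality of tangent vectors
  is equality of derivations.
\<close>

type_synonym 'm tangent = "('m \<Rightarrow> real) \<Rightarrow> real"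
type_synonym 'm vector_field = "'m \<Rightarrow> 'm tangent"
type_synonym 'm one_form = "'m \<Rightarrow> 'm tangent \<Rightarrow> real"

definition tangent_space :: "('m, 'e::euclidean_space) chart set \<Rightarrow> 'm \<Rightarrow> 'm tangent set" where
  "tangent_space A p = {v.
     (\<forall>f g. smooth A f \<and> smooth A g \<longrightarrow> v (\<lambda>x. f x + g x) = v f + v g) \<and>
     (\<forall>c f. smooth A f \<longrightarrow> v (\<lambda>x. c * f x) = c * v f) \<and>
     (\<forall>f g. smooth A f \<and> smooth A g \<longrightarrow> v (\<lambda>x. f x * g x) = v f * g p + f p * v g) \<and>
     (\<forall>f. \<not> smooth A f \<longrightarrow> v f = 0)}"

definition vector_fields :: "('m, 'e::euclidean_space) chart set \<Rightarrow> 'm vector_field set" where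
  "vector_fields A = {X. (\<forall>p. X p \<in> tangent_space A p) \<and>
     (\<forall>f. smooth A f \<longrightarrow> smooth A (\<lambda>p. X p f))}"

definition vf_add :: "'m vector_field \<Rightarrow> 'm vector_field \<Rightarrow> 'm vector_field" where
  "vf_add X Y = (\<lambda>p u. X p u + Y p u)"

definition vf_scale :: "('m \<Rightarrow> real) \<Rightarrow> 'm vector_field \<Rightarrow> 'm vector_field" where
  "vf_scale f X = (\<lambda>p u. f p * X p u)"

definition lie_bracket :: "'m vector_field \<Rightarrow> 'm vector_field \<Rightarrow> 'm vector_field" where
  "lie_bracket X Y = (\<lambda>p u. X p (\<lambda>q. Y q u) - Y p (\<lambda>q. X q u))"

definition one_forms :: "('m, 'e::euclidean_space) chart set \<Rightarrow> 'm one_form set" where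
  "one_forms A = {\<eta>.
     (\<forall>p. \<forall>v\<in>tangent_space A p. \<forall>w\<in>tangent_space A p. \<eta> p (\<lambda>u. v u + w u) = \<eta> p v + \<eta> p w) \<and>
     (\<forall>p. \<forall>v\<in>tangent_space A p. \<forall>c. \<eta> p (\<lambda>u. c * v u) = c * \<eta> p v) \<and>
     (\<forall>X\<in>vector_fields A. smooth A (\<lambda>p. \<eta> p (X p)))}"

definition differential :: "('m \<Rightarrow> real) \<Rightarrow> 'm one_form" where
  "differential f = (\<lambda>p v. v f)"

definition extend_vector :: "('m, 'e::euclidean_space) chart set \<Rightarrow> 'm \<Rightarrow> 'm tangent \<Rightarrow> 'm vector_field" where
  "extend_vector A p v = (SOME X. X \<in> vector_fields A \<and> X p = v)"

text \<open>
  The exterior derivative of a 1-form at \<open>p\<close>, computed by the invariant formula from arbitrary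
  vector fields extending the two arguments; by tensoriality the choice is irrelevant.
\<close>

definition ext_deriv :: "('m, 'e::euclidean_space) chart set \<Rightarrow> 'm one_form \<Rightarrow>
    'm \<Rightarrow> 'm tangent \<Rightarrow> 'm tangent \<Rightarrow> real" where
  "ext_deriv A \<theta> p v w =
     (let X = extend_vector A p v; Y = extend_vector A p w in
        X p (\<lambda>q. \<theta> q (Y q)) - Y p (\<lambda>q. \<theta> q (X q)) - \<theta> p (lie_bracket X Y p))"


section \<open>Contact geometry\<close>

text \<open>
  The \<open>(2n+1)\<close>-form \<open>\<theta> \<and> (d\<theta>)\<^sup>n\<close> at \<open>p\<close>, evaluated on \<open>e 0, \<dots>, e (2n)\<close>. The wedge product
  of a 1-form and \<open>n\<close> 2-forms carries the factor \<open>1 / (1! (2!)\<^sup>n)\<close> in front of the full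
  antisymmetrisation.
\<close>

definition contact_top_form :: "('m, 'e::euclidean_space) chart set \<Rightarrow> nat \<Rightarrow> 'm one_form \<Rightarrow>
    'm \<Rightarrow> (nat \<Rightarrow> 'm tangent) \<Rightarrow> real" where
  "contact_top_form A n \<theta> p e =
     (1 / 2 ^ n) * (\<Sum>\<sigma> | \<sigma> permutes {..2 * n}.
        of_int (sign \<sigma>) * \<theta> p (e (\<sigma> 0)) *
        (\<Prod>k<n. ext_deriv A \<theta> p (e (\<sigma> (2 * k + 1))) (e (\<sigma> (2 * k + 2)))))"

definition contact_form :: "('m, 'e::euclidean_space) chart set \<Rightarrow> nat \<Rightarrow> 'm one_form \<Rightarrow> bool" where
  "contact_form A n \<theta> \<longleftrightarrow> \<theta> \<in> one_forms A \<and>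
     (\<forall>p. \<exists>e. (\<forall>i\<le>2 * n. e i \<in> tangent_space A p) \<and> contact_top_form A n \<theta> p e \<noteq> 0)"

definition compact_contact_manifold ::
    "('m::t2_space, 'e::euclidean_space) chart set \<Rightarrow> nat \<Rightarrow> 'm one_form \<Rightarrow> bool" where
  "compact_contact_manifold A n \<theta> \<longleftrightarrow>
     compact (UNIV :: 'm set) \<and> smooth_atlas A \<and> DIM('e) = 2 * n + 1 \<and> contact_form A n \<theta>"

definition contact_distribution :: "('m, 'e::euclidean_space) chart set \<Rightarrow> 'm one_form \<Rightarrow>
    'm \<Rightarrow> 'm tangent set" where
  "contact_distribution A \<theta> p = {v \<in> tangent_space A p. \<theta> p v = 0}"

definition reeb_field :: "('m, 'e::euclidean_space) chart set \<Rightarrow> 'm one_form \<Rightarrow>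
    'm vector_field \<Rightarrow> bool" where
  "reeb_field A \<theta> \<xi> \<longleftrightarrow> \<xi> \<in> vector_fields A \<and>
     (\<forall>p. \<theta> p (\<xi> p) = 1 \<and> (\<forall>w\<in>tangent_space A p. ext_deriv A \<theta> p (\<xi> p) w = 0))"

text \<open>\<open>\<Lambda>\<close> is the bundle map from \<open>T\<^sup>*M\<close> to \<open>TM\<close>, acting on 1-forms.\<close>

definition sharp_map :: "('m, 'e::euclidean_space) chart set \<Rightarrow> 'm one_form \<Rightarrow> 'm vector_field \<Rightarrow>
    ('m one_form \<Rightarrow> 'm vector_field) \<Rightarrow> bool" where
  "sharp_map A \<theta> \<xi> \<Lambda> \<longleftrightarrow> (\<forall>\<eta>\<in>one_forms A. \<Lambda> \<eta> \<in> vector_fields A \<and>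
     (\<forall>p. \<theta> p (\<Lambda> \<eta> p) = 0 \<and>
        (\<forall>w\<in>tangent_space A p. ext_deriv A \<theta> p (\<Lambda> \<eta> p) w = \<eta> p (\<xi> p) * \<theta> p w - \<eta> p w)))"

definition hamiltonian_field :: "('m one_form \<Rightarrow> 'm vector_field) \<Rightarrow> 'm vector_field \<Rightarrow>
    ('m \<Rightarrow> real) \<Rightarrow> 'm vector_field" where
  "hamiltonian_field \<Lambda> \<xi> f = vf_add (\<Lambda> (differential f)) (vf_scale f \<xi>)"

definition jacobi_bracket :: "('m one_form \<Rightarrow> 'm vector_field) \<Rightarrow> 'm vector_field \<Rightarrow>
    ('m \<Rightarrow> real) \<Rightarrow> ('m \<Rightarrow> real) \<Rightarrow> 'm \<Rightarrow> real" where
  "jacobi_bracket \<Lambda> \<xi> f g = (\<lambda>p. hamiltonian_field \<Lambda> \<xi> f p g - g p * \<xi> p f)"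

definition basic_functions :: "('m, 'e::euclidean_space) chart set \<Rightarrow> 'm vector_field \<Rightarrow>
    ('m \<Rightarrow> real) set" where
  "basic_functions A \<xi> = {f. smooth A f \<and> (\<forall>p. \<xi> p f = 0)}"

definition coord_vector :: "('m, 'e::euclidean_space) chart set \<Rightarrow> ('m, 'e) chart \<Rightarrow> 'm \<Rightarrow> 'e \<Rightarrow>
    'm tangent" where
  "coord_vector A c p b = (\<lambda>f. if smooth A f
     then frechet_derivative (f \<circ> chart_inv c) (at (snd c p)) b else 0)"

text \<open>
  The measure of \<open>\<mu>\<^sub>\<theta> = \<theta> \<and> (d\<theta>)\<^sup>n / n!\<close>. Since \<open>M\<close> is oriented by \<open>\<mu>\<^sub>\<theta>\<close> itself, the
  density in a chart is the absolute value of the coefficient of \<open>\<mu>\<^sub>\<theta>\<close>, whatever the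
  ordering \<open>b\<close> of the coordinates and the orientation of the chart. Such a measure is unique.
\<close>

definition contact_volume :: "('m::t2_space, 'e::euclidean_space) chart set \<Rightarrow> nat \<Rightarrow>
    'm one_form \<Rightarrow> 'm measure \<Rightarrow> bool" where
  "contact_volume A n \<theta> \<mu> \<longleftrightarrow> sets \<mu> = sets borel \<and>
     (\<forall>c\<in>A. \<forall>b. bij_betw b {..2 * n} (Basis :: 'e set) \<longrightarrow>
        (\<forall>B\<in>sets borel. B \<subseteq> fst c \<longrightarrow>
           emeasure \<mu> B = (\<integral>\<^sup>+ x\<in>snd c ` B. ennreal \<bar>contact_top_form A n \<theta> (chart_inv c x)
             (\<lambda>i. coord_vector A c (chart_inv c x) (b i)) / fact n\<bar> \<partial>lborel)))"


section \<open>Hermitian line bundles with connection\<close>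

text \<open>
  A complex line bundle with total space \<open>'l\<close> (all elements of the type), fibrewise vector space
  operations, and local trivialisations \<open>(U, \<tau>)\<close>, where \<open>\<tau>\<close> is the \<open>\<complex>\<close>-component of
  \<open>\<pi>\<^sup>-\<^sup>1(U) \<cong> U \<times> \<complex>\<close>. The topology and smooth structure of the total space are the ones determined
  by the trivialisations.
\<close>

record ('m, 'l) line_bundle =
  proj :: "'l \<Rightarrow> 'm"
  fadd :: "'l \<Rightarrow> 'l \<Rightarrow> 'l"
  fscale :: "complex \<Rightarrow> 'l \<Rightarrow> 'l"
  trivs :: "('m set \<times> ('l \<Rightarrow> complex)) set"

definition fibre :: "('m, 'l) line_bundle \<Rightarrow> 'm \<Rightarrow> 'l set" where
  "fibre L p = {l. proj L l = p}"

definition complex_line_bundle :: "('m::t2_space, 'e::euclidean_space) chart set \<Rightarrow>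
    ('m, 'l) line_bundle \<Rightarrow> bool" where
  "complex_line_bundle A L \<longleftrightarrow>
     (\<Union>(U, \<tau>)\<in>trivs L. U) = UNIV \<and>
     (\<forall>(U, \<tau>)\<in>trivs L. open U \<and> (\<forall>p\<in>U. bij_betw \<tau> (fibre L p) UNIV \<and>
        (\<forall>l\<in>fibre L p. \<forall>l'\<in>fibre L p. fadd L l l' \<in> fibre L p \<and> \<tau> (fadd L l l') = \<tau> l + \<tau> l') \<and>
        (\<forall>c. \<forall>l\<in>fibre L p. fscale L c l \<in> fibre L p \<and> \<tau> (fscale L c l) = c * \<tau> l))) \<and>
     (\<forall>(U, \<tau>)\<in>trivs L. \<forall>(V, \<rho>)\<in>trivs L.
        smooth_on A (U \<inter> V) (\<lambda>p. \<rho> (inv_into (fibre L p) \<tau> 1)))"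

type_synonym ('m, 'l) sect = "'m \<Rightarrow> 'l"

definition smooth_sections :: "('m, 'e::euclidean_space) chart set \<Rightarrow> ('m, 'l) line_bundle \<Rightarrow>
    ('m, 'l) sect set" where
  "smooth_sections A L = {s. (\<forall>p. s p \<in> fibre L p) \<and>
     (\<forall>(U, \<tau>)\<in>trivs L. smooth_on A U (\<tau> \<circ> s))}"

definition sec_add :: "('m, 'l) line_bundle \<Rightarrow> ('m, 'l) sect \<Rightarrow> ('m, 'l) sect \<Rightarrow> ('m, 'l) sect" where
  "sec_add L s t = (\<lambda>p. fadd L (s p) (t p))"

definition sec_scale :: "('m, 'l) line_bundle \<Rightarrow> ('m \<Rightarrow> complex) \<Rightarrow> ('m, 'l) sect \<Rightarrow> ('m, 'l) sect" where
  "sec_scale L f s = (\<lambda>p. fscale L (f p) (s p))"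

definition sec_diff :: "('m, 'l) line_bundle \<Rightarrow> ('m, 'l) sect \<Rightarrow> ('m, 'l) sect \<Rightarrow> ('m, 'l) sect" where
  "sec_diff L s t = sec_add L s (sec_scale L (\<lambda>_. -1) t)"

text \<open>Complex-linear in the first argument. The zero vector of the fibre of \<open>l\<close> is \<open>fscale L 0 l\<close>.\<close>

definition hermitian_metric :: "('m, 'e::euclidean_space) chart set \<Rightarrow> ('m, 'l) line_bundle \<Rightarrow>
    ('l \<Rightarrow> 'l \<Rightarrow> complex) \<Rightarrow> bool" where
  "hermitian_metric A L h \<longleftrightarrow>
     (\<forall>p. \<forall>l\<in>fibre L p. \<forall>l'\<in>fibre L p.
        (\<forall>l''\<in>fibre L p. h (fadd L l l') l'' = h l l'' + h l' l'') \<and>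
        (\<forall>c. h (fscale L c l) l' = c * h l l') \<and>
        h l' l = cnj (h l l') \<and>
        (l \<noteq> fscale L 0 l \<longrightarrow> 0 < Re (h l l))) \<and>
     (\<forall>s\<in>smooth_sections A L. \<forall>t\<in>smooth_sections A L. smooth A (\<lambda>p. h (s p) (t p)))"

definition vf_apply :: "'m vector_field \<Rightarrow> ('m \<Rightarrow> complex) \<Rightarrow> 'm \<Rightarrow> complex" where
  "vf_apply X f = (\<lambda>p. Complex (X p (\<lambda>q. Re (f q))) (X p (\<lambda>q. Im (f q))))"

type_synonym ('m, 'l) covariant_derivative =
  "'m vector_field \<Rightarrow> ('m, 'l) sect \<Rightarrow> ('m, 'l) sect"

definition connection :: "('m, 'e::euclidean_space) chart set \<Rightarrow> ('m, 'l) line_bundle \<Rightarrow>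
    ('m, 'l) covariant_derivative \<Rightarrow> bool" where
  "connection A L D \<longleftrightarrow>
     (\<forall>X\<in>vector_fields A. \<forall>s\<in>smooth_sections A L. D X s \<in> smooth_sections A L) \<and>
     (\<forall>X\<in>vector_fields A. \<forall>Y\<in>vector_fields A. \<forall>s\<in>smooth_sections A L.
        D (vf_add X Y) s = sec_add L (D X s) (D Y s)) \<and>
     (\<forall>f. \<forall>X\<in>vector_fields A. \<forall>s\<in>smooth_sections A L. smooth A f \<longrightarrow>
        D (vf_scale f X) s = sec_scale L (\<lambda>p. of_real (f p)) (D X s)) \<and>
     (\<forall>X\<in>vector_fields A. \<forall>s\<in>smooth_sections A L. \<forall>t\<in>smooth_sections A L.
        D X (sec_add L s t) = sec_add L (D X s) (D X t)) \<and>
     (\<forall>X\<in>vector_fields A. \<forall>f. \<forall>s\<in>smooth_sections A L. smooth A f \<longrightarrow>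
        D X (sec_scale L f s) = sec_add L (sec_scale L f (D X s)) (sec_scale L (vf_apply X f) s))"

definition metric_connection :: "('m, 'e::euclidean_space) chart set \<Rightarrow> ('m, 'l) line_bundle \<Rightarrow>
    ('l \<Rightarrow> 'l \<Rightarrow> complex) \<Rightarrow> ('m, 'l) covariant_derivative \<Rightarrow> bool" where
  "metric_connection A L h D \<longleftrightarrow> connection A L D \<and>
     (\<forall>X\<in>vector_fields A. \<forall>s\<in>smooth_sections A L. \<forall>t\<in>smooth_sections A L. \<forall>p.
        vf_apply X (\<lambda>q. h (s q) (t q)) p = h (D X s p) (t p) + h (s p) (D X t p))"

definition curvature :: "('m, 'l) line_bundle \<Rightarrow> ('m, 'l) covariant_derivative \<Rightarrow>
    'm vector_field \<Rightarrow> 'm vector_field \<Rightarrow> ('m, 'l) sect \<Rightarrow> ('m, 'l) sect" where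
  "curvature L D X Y s =
     sec_diff L (sec_diff L (D X (D Y s)) (D Y (D X s))) (D (lie_bracket X Y) s)"

text \<open>
  On a line bundle the curvature at \<open>p\<close> in the directions \<open>v\<close>, \<open>w\<close> is multiplication by a complex
  number, the value of the curvature 2-form; by tensoriality it does not depend on the extensions.
\<close>

definition curvature_form :: "('m, 'e::euclidean_space) chart set \<Rightarrow> ('m, 'l) line_bundle \<Rightarrow>
    ('m, 'l) covariant_derivative \<Rightarrow> 'm \<Rightarrow> 'm tangent \<Rightarrow> 'm tangent \<Rightarrow> complex" where
  "curvature_form A L D p v w = (THE z. \<forall>s\<in>smooth_sections A L.
     curvature L D (extend_vector A p v) (extend_vector A p w) s p = fscale L z (s p))"

definition quantum_bundle :: "('m::t2_space, 'e::euclidean_space) chart set \<Rightarrow> 'm one_form \<Rightarrow>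
    ('m, 'l) line_bundle \<Rightarrow> ('l \<Rightarrow> 'l \<Rightarrow> complex) \<Rightarrow> ('m, 'l) covariant_derivative \<Rightarrow> bool" where
  "quantum_bundle A \<theta> L h D \<longleftrightarrow>
     complex_line_bundle A L \<and> hermitian_metric A L h \<and> metric_connection A L h D \<and>
     (\<forall>p. \<forall>v\<in>contact_distribution A \<theta> p. \<forall>w\<in>contact_distribution A \<theta> p.
        curvature_form A L D p v w = \<i> * of_real (- ext_deriv A \<theta> p v w))"

definition quantum_operator :: "('m, 'l) line_bundle \<Rightarrow> ('m, 'l) covariant_derivative \<Rightarrow>
    ('m one_form \<Rightarrow> 'm vector_field) \<Rightarrow> 'm vector_field \<Rightarrow>
    ('m \<Rightarrow> real) \<Rightarrow> ('m, 'l) sect \<Rightarrow> ('m, 'l) sect" where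
  "quantum_operator L D \<Lambda> \<xi> f s =
     sec_add L (D (hamiltonian_field \<Lambda> \<xi> f) s) (sec_scale L (\<lambda>p. \<i> * of_real (f p)) s)"


section \<open>The Hilbert space of square-integrable sections\<close>

definition complex_hilbert_space :: "(complex \<Rightarrow> 'h \<Rightarrow> 'h::banach) \<Rightarrow> ('h \<Rightarrow> 'h \<Rightarrow> complex) \<Rightarrow> bool" where
  "complex_hilbert_space sc ip \<longleftrightarrow>
     (\<forall>a x y. sc a (x + y) = sc a x + sc a y) \<and>
     (\<forall>a b x. sc (a + b) x = sc a x + sc b x) \<and>
     (\<forall>a b x. sc a (sc b x) = sc (a * b) x) \<and>
     (\<forall>r x. sc (of_real r) x = r *\<^sub>R x) \<and>
     (\<forall>x y z. ip (x + y) z = ip x z + ip y z) \<and>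
     (\<forall>a x y. ip (sc a x) y = a * ip x y) \<and>
     (\<forall>x y. ip y x = cnj (ip x y)) \<and>
     (\<forall>x. ip x x = of_real ((norm x)\<^sup>2))"

text \<open>
  The completion of the smooth sections under \<open>\<langle>s, t\<rangle> = \<integral> h(s, t) \<mu>\<^sub>\<theta>\<close>, characterised up to unique
  unitary isomorphism as a Hilbert space with a dense linear isometric image \<open>\<iota>\<close> of
  the smooth sections.
\<close>

definition L2_completion :: "('m::t2_space, 'e::euclidean_space) chart set \<Rightarrow> ('m, 'l) line_bundle \<Rightarrow>
    ('l \<Rightarrow> 'l \<Rightarrow> complex) \<Rightarrow> 'm measure \<Rightarrow> (complex \<Rightarrow> 'h \<Rightarrow> 'h::banach) \<Rightarrow>
    ('h \<Rightarrow> 'h \<Rightarrow> complex) \<Rightarrow> (('m, 'l) sect \<Rightarrow> 'h) \<Rightarrow> bool" where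
  "L2_completion A L h \<mu> sc ip \<iota> \<longleftrightarrow>
     complex_hilbert_space sc ip \<and>
     (\<forall>s\<in>smooth_sections A L. \<forall>t\<in>smooth_sections A L. \<iota> (sec_add L s t) = \<iota> s + \<iota> t) \<and>
     (\<forall>a. \<forall>s\<in>smooth_sections A L. \<iota> (sec_scale L (\<lambda>_. a) s) = sc a (\<iota> s)) \<and>
     (\<forall>s\<in>smooth_sections A L. \<forall>t\<in>smooth_sections A L.
        ip (\<iota> s) (\<iota> t) = (LINT p|\<mu>. h (s p) (t p))) \<and>
     closure (\<iota> ` smooth_sections A L) = UNIV"

text \<open>
  The (in general unbounded) operator on the completion induced by an operator on smooth
  sections; only its values on the image of \<open>\<iota>\<close> are meaningful. There \<open>\<iota>\<close> is invertible,
  since the inner product of smooth sections is positive definite.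
\<close>

definition completion_operator :: "('m, 'e::euclidean_space) chart set \<Rightarrow> ('m, 'l) line_bundle \<Rightarrow>
    (('m, 'l) sect \<Rightarrow> 'h) \<Rightarrow> (('m, 'l) sect \<Rightarrow> ('m, 'l) sect) \<Rightarrow> 'h \<Rightarrow> 'h" where
  "completion_operator A L \<iota> T x = \<iota> (T (the_inv_into (smooth_sections A L) \<iota> x))"

text \<open>Skew-Hermitian operators \<open>T\<close> with dense domain \<open>\<D>\<close>.\<close>

definition skew_hermitian_operator :: "(complex \<Rightarrow> 'h \<Rightarrow> 'h::banach) \<Rightarrow> ('h \<Rightarrow> 'h \<Rightarrow> complex) \<Rightarrow>
    'h set \<Rightarrow> ('h \<Rightarrow> 'h) \<Rightarrow> bool" where
  "skew_hermitian_operator sc ip \<D> T \<longleftrightarrow>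
     closure \<D> = UNIV \<and>
     (\<forall>x\<in>\<D>. \<forall>y\<in>\<D>. x + y \<in> \<D> \<and> T (x + y) = T x + T y) \<and>
     (\<forall>a. \<forall>x\<in>\<D>. sc a x \<in> \<D> \<and> T (sc a x) = sc a (T x)) \<and>
     (\<forall>x\<in>\<D>. \<forall>y\<in>\<D>. ip (T x) y = - ip x (T y))"

end

theory Submission
  imports Defs
begin

text \<open>
  The first variation of the volume and of the metric gives skewness, and the curvature of the
  connection gives the commutator.

  Skewness. For basic \<open>f\<close> the field \<open>X\<^sub>f\<close> preserves \<open>\<theta>\<close>: contracting \<open>d\<theta>\<close> with it gives \<open>- df\<close>, while
  \<open>\<theta>(X\<^sub>f) = f\<close>, so the two terms of Cartan's formula for the Lie derivative cancel
  (\<open>ham_preserves\<close>). Hence \<open>X\<^sub>f\<close> preserves the volume \<open>\<mu>\<^sub>\<theta>\<close> and \<open>\<integral> X\<^sub>f u \<mu>\<^sub>\<theta> = 0\<close> for every smooth \<open>u\<close>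
  (\<open>integral_preserving_field\<close>). With a metric connection the
  function \<open>h(A\<^sub>f s, t) + h(s, A\<^sub>f t)\<close> is \<open>X\<^sub>f h(s, t)\<close>, because multiplication by \<open>\<i> f\<close> is
  skew at every point; its integral therefore vanishes. The integral theorem is reduced to charts
  by a partition of unity. In a chart it is the continuity equation for the
  density of the volume (\<open>divergence_zero\<close>) together with the vanishing of \<open>\<integral> \<partial>\<^sub>b \<phi>\<close> for compactly
  supported \<open>\<phi>\<close>.

  Commutator. Writing \<open>F\<close> for the curvature form, one finds
  \<open>[A\<^sub>f, A\<^sub>g] = \<nabla>\<close> along \<open>[X\<^sub>f, X\<^sub>g]\<close>, plus multiplication by \<open>F(X\<^sub>f, X\<^sub>g) + 2 \<i> {f, g}\<close>. Both \<open>[X\<^sub>f, X\<^sub>g]\<close>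
  and the Hamiltonian field of \<open>{f, g}\<close> have the same image under \<open>\<theta>\<close> and under contraction with \<open>d\<theta>\<close>,
  so they agree by nondegeneracy (\<open>lie_bracket_ham\<close>), and it remains to see
  that \<open>F(X\<^sub>f, X\<^sub>g) = - \<i> {f, g}\<close>. Since \<open>{f, g} = d\<theta>(X\<^sub>f, X\<^sub>g)\<close>, this is the quantum condition on the contact
  distribution, once the Reeb components of \<open>X\<^sub>f\<close> and \<open>X\<^sub>g\<close> are known to contribute nothing.

  The Reeb direction. The quantum condition says nothing about \<open>F(\<xi>, v)\<close>; that it vanishes
  (\<open>reeb_curvature_zero\<close>) is a consequence of the Bianchi identity in dimension at least five. The
  closed form \<open>F + \<i> d\<theta>\<close> vanishes on the distribution, so it is \<open>\<theta> \<and> \<alpha>\<close> for some \<open>\<alpha>\<close>, and closedness forces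
  \<open>d\<theta> \<and> \<alpha>\<close> to vanish on the distribution (\<open>reeb_curvature_cyclic\<close>). If the distribution has rank at least
  four, every \<open>z\<close> in it is \<open>d\<theta>\<close>-orthogonal to some pair \<open>x\<close>, \<open>y\<close> with \<open>d\<theta>(x, y) \<noteq> 0\<close>
  (\<open>orthogonal_pair\<close>), which gives \<open>\<alpha>(z) = 0\<close>. In dimension one
  the distribution is zero, and in dimension three the vanishing is a hypothesis.

  Tangent vectors are derivations of the algebra of smooth functions. Hadamard's lemma and smooth cutoffs
  identify them with combinations of coordinate vectors (\<open>chart_frame\<close>), and this makes every
  function-linear expression in vector fields pointwise (\<open>tensorial\<close>); in particular \<open>d\<theta>\<close> and the
  curvature form, which are defined through arbitrary extensions of their arguments, can be
  computed with any fields.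
\<close>

section \<open>Calculus of smooth maps between normed spaces\<close>

lemma Ck_on_cong:
  assumes "open S" "\<And>x. x \<in> S \<Longrightarrow> f x = g x"
  shows "Ck_on k S f \<longleftrightarrow> Ck_on k S g"
  using assms(2)
proof (induction k arbitrary: f g)
  case 0
  then show ?case by (simp cong: continuous_on_cong)
next
  case (Suc k)
  have "(f has_derivative F) (at x) \<longleftrightarrow> (g has_derivative F) (at x)" if "x \<in> S" for F x
    using has_derivative_transform_within_open[OF _ assms(1) that] Suc.prems by metis
  then show ?case by simp
qed

lemma Ck_on_subset: "Ck_on k S f \<Longrightarrow> T \<subseteq> S \<Longrightarrow> Ck_on k T f"
  by (induction k arbitrary: f) (auto intro: continuous_on_subset, blast)

lemma Ck_on_SucD: "Ck_on (Suc k) S f \<Longrightarrow> Ck_on k S f"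
proof (induction k arbitrary: f)
  case 0
  then show ?case
    by (force intro!: continuous_at_imp_continuous_on dest: has_derivative_continuous)
next
  case (Suc k)
  then obtain f' where "\<forall>x\<in>S. (f has_derivative f' x) (at x)" "\<forall>v. Ck_on (Suc k) S (\<lambda>x. f' x v)"
    by (auto simp: Ck_on.simps(2)[of "Suc k"])
  then show ?case using Suc.IH by (auto intro!: exI[of _ f'])
qed

lemma Ck_on_continuous: "Ck_on k S f \<Longrightarrow> continuous_on S f"
  by (induction k) (simp, blast dest: Ck_on_SucD)

lemma Ck_on_Suc_frechet:
  assumes "open S"
  shows "Ck_on (Suc k) S f \<longleftrightarrow>
    (\<forall>x\<in>S. f differentiable (at x)) \<and> (\<forall>v. Ck_on k S (\<lambda>x. frechet_derivative f (at x) v))"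
proof
  assume "Ck_on (Suc k) S f"
  then obtain f' where f': "\<forall>x\<in>S. (f has_derivative f' x) (at x)" "\<forall>v. Ck_on k S (\<lambda>x. f' x v)"
    by auto
  have "f' x = frechet_derivative f (at x)" if "x \<in> S" for x
    using f' that frechet_derivative_at by blast
  then have "Ck_on k S (\<lambda>x. frechet_derivative f (at x) v)" for v
    using f'(2) Ck_on_cong[OF assms, of "\<lambda>x. f' x v" "\<lambda>x. frechet_derivative f (at x) v" k] by auto
  then show "(\<forall>x\<in>S. f differentiable (at x)) \<and> (\<forall>v. Ck_on k S (\<lambda>x. frechet_derivative f (at x) v))"
    using f'(1) by (auto simp: differentiable_def)
next
  assume "(\<forall>x\<in>S. f differentiable (at x)) \<and> (\<forall>v. Ck_on k S (\<lambda>x. frechet_derivative f (at x) v))"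
  then show "Ck_on (Suc k) S f"
    by (auto intro!: exI[of _ "\<lambda>x. frechet_derivative f (at x)"] simp: frechet_derivative_works)
qed

lemma Ck_on_local:
  assumes "\<And>x. x \<in> S \<Longrightarrow> \<exists>T. open T \<and> x \<in> T \<and> Ck_on k T f"
  shows "Ck_on k S f"
  using assms
proof (induction k arbitrary: f)
  case 0
  show ?case unfolding Ck_on.simps
  proof (rule continuous_at_imp_continuous_on, rule ballI)
    fix x assume "x \<in> S"
    then obtain T where "open T" "x \<in> T" "continuous_on T f" using 0 by auto
    then show "isCont f x" by (simp add: continuous_on_eq_continuous_at)
  qed
next
  case (Suc k)
  have "f differentiable (at x)" if "x \<in> S" for x
    using Suc.prems[OF that] Ck_on_Suc_frechet by blast
  moreover have "Ck_on k S (\<lambda>x. frechet_derivative f (at x) v)" for v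
  proof (rule Suc.IH)
    fix x assume "x \<in> S"
    then obtain T where "open T" "x \<in> T" "Ck_on (Suc k) T f" using Suc.prems by blast
    then show "\<exists>T. open T \<and> x \<in> T \<and> Ck_on k T (\<lambda>x. frechet_derivative f (at x) v)"
      using Ck_on_Suc_frechet[of T k f] by blast
  qed
  ultimately show ?case
    by (auto intro!: exI[of _ "\<lambda>x. frechet_derivative f (at x)"] simp: frechet_derivative_works)
qed

lemma Ck_on_const: "Ck_on k S (\<lambda>_. c)"
proof (induction k arbitrary: c)
  case (Suc k)
  then show ?case by (auto intro!: exI[of _ "\<lambda>_ _. 0"])
qed simp

lemma Ck_on_bounded_linear:
  assumes "bounded_linear l" "Ck_on k S f"
  shows "Ck_on k S (\<lambda>x. l (f x))"
  using assms(2)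
proof (induction k arbitrary: f)
  case 0
  then show ?case using bounded_linear.continuous_on[OF assms(1)] by auto
next
  case (Suc k)
  then obtain f' where "\<forall>x\<in>S. (f has_derivative f' x) (at x)" "\<forall>v. Ck_on k S (\<lambda>x. f' x v)"
    by auto
  then show ?case
    using Suc.IH by (auto intro!: exI[of _ "\<lambda>x v. l (f' x v)"] bounded_linear.has_derivative[OF assms(1)])
qed

lemma Ck_on_id: "Ck_on k S (\<lambda>x. x)"
proof (cases k)
  case (Suc m)
  then show ?thesis by (auto intro!: exI[of _ "\<lambda>_ v. v"] Ck_on_const)
qed simp

lemma Ck_on_add:
  assumes "Ck_on k S f" "Ck_on k S g"
  shows "Ck_on k S (\<lambda>x. f x + g x)"
  using assms
proof (induction k arbitrary: f g)
  case 0
  then show ?case by (auto intro: continuous_on_add)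
next
  case (Suc k)
  then obtain f' g' where "\<forall>x\<in>S. (f has_derivative f' x) (at x)" "\<forall>v. Ck_on k S (\<lambda>x. f' x v)"
    "\<forall>x\<in>S. (g has_derivative g' x) (at x)" "\<forall>v. Ck_on k S (\<lambda>x. g' x v)"
    by auto
  then show ?case
    using Suc.IH by (auto intro!: exI[of _ "\<lambda>x v. f' x v + g' x v"] has_derivative_add)
qed

lemma Ck_on_sum:
  assumes "\<And>i. i \<in> I \<Longrightarrow> Ck_on k S (f i)"
  shows "Ck_on k S (\<lambda>x. \<Sum>i\<in>I. f i x)"
  using assms by (induction I rule: infinite_finite_induct) (auto intro: Ck_on_const Ck_on_add)

lemma Ck_on_bilinear:
  assumes "bounded_bilinear m" "Ck_on k S f" "Ck_on k S g"
  shows "Ck_on k S (\<lambda>x. m (f x) (g x))"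
  using assms(2,3)
proof (induction k arbitrary: f g)
  case 0
  then show ?case by (auto intro: bounded_bilinear.continuous_on[OF assms(1)])
next
  case (Suc k)
  then obtain f' g' where d: "\<forall>x\<in>S. (f has_derivative f' x) (at x)" "\<forall>v. Ck_on k S (\<lambda>x. f' x v)"
    "\<forall>x\<in>S. (g has_derivative g' x) (at x)" "\<forall>v. Ck_on k S (\<lambda>x. g' x v)"
    by auto
  have "((\<lambda>x. m (f x) (g x)) has_derivative (\<lambda>v. m (f x) (g' x v) + m (f' x v) (g x))) (at x)"
    if "x \<in> S" for x
    using bounded_bilinear.FDERIV[OF assms(1)] d that by blast
  moreover have "Ck_on k S (\<lambda>x. m (f x) (g' x v) + m (f' x v) (g x))" for v
    by (intro Ck_on_add Suc.IH Ck_on_SucD[OF Suc.prems(1)] Ck_on_SucD[OF Suc.prems(2)]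
        d(2)[rule_format] d(4)[rule_format])
  ultimately show ?case
    by (auto intro!: exI[of _ "\<lambda>x v. m (f x) (g' x v) + m (f' x v) (g x)"])
qed

lemma Ck_on_compose:
  fixes g :: "'a::real_normed_vector \<Rightarrow> 'b::euclidean_space"
  assumes "Ck_on k T f" "Ck_on k S g" "g ` S \<subseteq> T"
  shows "Ck_on k S (\<lambda>x. f (g x))"
  using assms(1,2)
proof (induction k arbitrary: f)
  case 0
  then show ?case using assms(3) continuous_on_compose2[of T f S g] by auto
next
  case (Suc k)
  then obtain f' g' where d: "\<forall>x\<in>T. (f has_derivative f' x) (at x)" "\<forall>v. Ck_on k T (\<lambda>x. f' x v)"
    "\<forall>x\<in>S. (g has_derivative g' x) (at x)" "\<forall>v. Ck_on k S (\<lambda>x. g' x v)"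
    by auto
  \<comment> \<open>the chain rule, with the outer derivative expanded along the standard basis so that it is
    only evaluated at constant vectors\<close>
  have "((\<lambda>x. f (g x)) has_derivative (\<lambda>v. \<Sum>b\<in>Basis. (g' x v \<bullet> b) *\<^sub>R f' (g x) b)) (at x)"
    if "x \<in> S" for x
  proof -
    have gx: "(f has_derivative f' (g x)) (at (g x))" using d(1) assms(3) that by auto
    then have der: "((\<lambda>x. f (g x)) has_derivative (\<lambda>v. f' (g x) (g' x v))) (at x)"
      using d(3) that has_derivative_compose by blast
    have "f' (g x) w = (\<Sum>b\<in>Basis. (w \<bullet> b) *\<^sub>R f' (g x) b)" for w
    proof -
      have lin: "linear (f' (g x))" using gx has_derivative_linear by blast
      have "f' (g x) w = f' (g x) (\<Sum>b\<in>Basis. (w \<bullet> b) *\<^sub>R b)" by (simp add: euclidean_representation)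
      also have "\<dots> = (\<Sum>b\<in>Basis. (w \<bullet> b) *\<^sub>R f' (g x) b)"
        by (simp add: linear_sum[OF lin] linear_cmul[OF lin] o_def)
      finally show ?thesis .
    qed
    then show ?thesis by (intro has_derivative_eq_rhs[OF der] ext)
  qed
  moreover have "Ck_on k S (\<lambda>x. \<Sum>b\<in>Basis. (g' x v \<bullet> b) *\<^sub>R f' (g x) b)" for v
  proof (intro Ck_on_sum Ck_on_bilinear[OF bounded_bilinear_scaleR])
    fix b :: 'b
    show "Ck_on k S (\<lambda>x. g' x v \<bullet> b)"
      using d(4) Ck_on_bounded_linear[OF bounded_linear_inner_left] by blast
    show "Ck_on k S (\<lambda>x. f' (g x) b)"
      using Suc.IH d(2) Ck_on_SucD Suc.prems(2) by blast
  qed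
  ultimately show ?case
    by (auto intro!: exI[of _ "\<lambda>x v. \<Sum>b\<in>Basis. (g' x v \<bullet> b) *\<^sub>R f' (g x) b"])
qed

lemma Cinf_on_cong: "open S \<Longrightarrow> (\<And>x. x \<in> S \<Longrightarrow> f x = g x) \<Longrightarrow> Cinf_on S f \<longleftrightarrow> Cinf_on S g"
  unfolding Cinf_on_def using Ck_on_cong by blast

lemma Cinf_on_subset: "Cinf_on S f \<Longrightarrow> T \<subseteq> S \<Longrightarrow> Cinf_on T f"
  unfolding Cinf_on_def using Ck_on_subset by blast

lemma Cinf_on_local: "(\<And>x. x \<in> S \<Longrightarrow> \<exists>T. open T \<and> x \<in> T \<and> Cinf_on T f) \<Longrightarrow> Cinf_on S f"
  unfolding Cinf_on_def by (metis Ck_on_local)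

lemma Cinf_on_const: "Cinf_on S (\<lambda>_. c)"
  unfolding Cinf_on_def by (simp add: Ck_on_const)

lemma Cinf_on_id: "Cinf_on S (\<lambda>x. x)"
  unfolding Cinf_on_def by (simp add: Ck_on_id)

lemma Cinf_on_bounded_linear: "bounded_linear l \<Longrightarrow> Cinf_on S f \<Longrightarrow> Cinf_on S (\<lambda>x. l (f x))"
  unfolding Cinf_on_def by (simp add: Ck_on_bounded_linear)

lemma Cinf_on_add: "Cinf_on S f \<Longrightarrow> Cinf_on S g \<Longrightarrow> Cinf_on S (\<lambda>x. f x + g x)"
  unfolding Cinf_on_def by (simp add: Ck_on_add)

lemma Cinf_on_sum: "(\<And>i. i \<in> I \<Longrightarrow> Cinf_on S (f i)) \<Longrightarrow> Cinf_on S (\<lambda>x. \<Sum>i\<in>I. f i x)"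
  unfolding Cinf_on_def by (simp add: Ck_on_sum)

lemma Cinf_on_bilinear:
  "bounded_bilinear m \<Longrightarrow> Cinf_on S f \<Longrightarrow> Cinf_on S g \<Longrightarrow> Cinf_on S (\<lambda>x. m (f x) (g x))"
  unfolding Cinf_on_def by (simp add: Ck_on_bilinear)

lemma Cinf_on_compose:
  fixes g :: "'a::real_normed_vector \<Rightarrow> 'b::euclidean_space"
  shows "Cinf_on T f \<Longrightarrow> Cinf_on S g \<Longrightarrow> g ` S \<subseteq> T \<Longrightarrow> Cinf_on S (\<lambda>x. f (g x))"
  unfolding Cinf_on_def by (auto intro: Ck_on_compose)

lemma Cinf_on_continuous: "Cinf_on S f \<Longrightarrow> continuous_on S f"
  unfolding Cinf_on_def by (metis Ck_on.simps(1))

lemma Cinf_on_frechet: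
  assumes "open S" "Cinf_on S f"
  shows "x \<in> S \<Longrightarrow> f differentiable (at x)"
    and "Cinf_on S (\<lambda>x. frechet_derivative f (at x) v)"
  using assms Ck_on_Suc_frechet[OF assms(1)] unfolding Cinf_on_def by blast+

lemma Cinf_on_inverse: "Cinf_on {x::real. x \<noteq> 0} inverse"
proof -
  have "Ck_on k {x::real. x \<noteq> 0} inverse" for k
  proof (induction k)
    case 0
    then show ?case by (auto intro!: continuous_intros)
  next
    case (Suc k)
    have "Ck_on k {x::real. x \<noteq> 0} (\<lambda>x. - (inverse x * v * inverse x))" for v
      by (intro Ck_on_bounded_linear[OF bounded_linear_minus[OF bounded_linear_ident]]
          Ck_on_bilinear[OF bounded_bilinear_mult] Suc Ck_on_const)
    then show ?case
      by (auto intro!: exI[of _ "\<lambda>x v. - (inverse x * v * inverse x)"] has_derivative_inverse')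
  qed
  then show ?thesis unfolding Cinf_on_def by blast
qed

subsection \<open>A smooth plateau\<close>

text \<open>
  The functions \<open>exp (-1/x) / x^m\<close>, extended by zero, form a family whose derivatives are
  linear combinations of members of the family; so smoothness of \<open>m = 0\<close> follows by
  induction over the order of differentiability, for all \<open>m\<close> simultaneously.
\<close>

definition flat_exp :: "nat \<Rightarrow> real \<Rightarrow> real" where
  "flat_exp m x = (if x > 0 then exp (- 1 / x) / x ^ m else 0)"

lemma flat_exp_has_derivative:
  "(flat_exp m has_real_derivative flat_exp (m + 2) x - real m * flat_exp (m + 1) x) (at x)"
proof -
  consider "x > 0" | "x < 0" | "x = 0" by linarith
  then show ?thesis
  proof cases
    case 1
    have "((\<lambda>x. exp (- 1 / x) / x ^ m) has_real_derivative
        flat_exp (m + 2) x - real m * flat_exp (m + 1) x) (at x)"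
      using 1 by (auto intro!: derivative_eq_intros
          simp: flat_exp_def field_simps power2_eq_square power_diff)
        (cases m; simp add: field_simps)
    moreover have "open {0::real<..}" "x \<in> {0<..}" using 1 by auto
    ultimately show ?thesis
      by (rule has_field_derivative_transform_within_open) (auto simp: flat_exp_def)
  next
    case 2
    have "((\<lambda>_. 0) has_real_derivative flat_exp (m + 2) x - real m * flat_exp (m + 1) x) (at x)"
      using 2 by (simp add: flat_exp_def)
    moreover have "open {..<0::real}" "x \<in> {..<0}" using 2 by auto
    ultimately show ?thesis
      by (rule has_field_derivative_transform_within_open) (auto simp: flat_exp_def)
  next
    case 3
    have "((\<lambda>h::real. exp (- 1 / h) / h ^ (m + 1)) \<longlongrightarrow> 0) (at_right 0)"
    proof -
      have "((\<lambda>t::real. t ^ (m + 1) / exp t) \<longlongrightarrow> 0) at_top"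
        by (rule tendsto_power_div_exp_0)
      then have "((\<lambda>h::real. inverse h ^ (m + 1) / exp (inverse h)) \<longlongrightarrow> 0) (at_right 0)"
        using filterlim_compose filterlim_inverse_at_top_right by blast
      then show ?thesis by (simp add: exp_minus divide_simps mult_ac)
    qed
    then have "((\<lambda>h. flat_exp m h / h) \<longlongrightarrow> 0) (at_right 0)"
      by (rule Lim_transform_eventually)
        (auto simp: flat_exp_def eventually_at_filter)
    moreover have "((\<lambda>h. flat_exp m h / h) \<longlongrightarrow> 0) (at_left 0)"
      by (rule Lim_transform_eventually[OF tendsto_const])
        (auto simp: flat_exp_def eventually_at_filter)
    ultimately show ?thesis
      unfolding 3 DERIV_def by (simp add: flat_exp_def filterlim_split_at)
  qed
qed

lemma Cinf_on_flat_exp: "Cinf_on S (flat_exp m)"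
proof -
  have "Ck_on k UNIV (flat_exp m)" for k m
  proof (induction k arbitrary: m)
    case 0
    then show ?case
      using flat_exp_has_derivative by (auto intro!: continuous_at_imp_continuous_on DERIV_isCont)
  next
    case (Suc k)
    have "Ck_on k UNIV (\<lambda>x. (flat_exp (m + 2) x + (- real m) * flat_exp (m + 1) x) * v)" for v
      by (intro Ck_on_bilinear[OF bounded_bilinear_mult] Ck_on_add Suc Ck_on_const)
    then show ?case
      using flat_exp_has_derivative[of m]
      by (auto intro!: exI[of _ "\<lambda>x v. (flat_exp (m + 2) x - real m * flat_exp (m + 1) x) * v"]
          simp: has_field_derivative_def)
  qed
  then show ?thesis unfolding Cinf_on_def using Ck_on_subset by blast
qed

text \<open>
  The quotient \<open>F(s) / (F(s) + F(1-s))\<close> of flat exponentials is a smooth step from 0 to 1.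
  Applied to a decreasing affine function of the squared distance it gives the plateau.
\<close>

lemma smooth_plateau:
  fixes a :: "'e::euclidean_space"
  assumes "0 < r" "r < s"
  obtains \<psi> :: "'e \<Rightarrow> real" where "Cinf_on UNIV \<psi>" "\<And>x. 0 \<le> \<psi> x" "\<And>x. \<psi> x \<le> 1"
    "\<And>x. dist a x \<le> r \<Longrightarrow> \<psi> x = 1" "\<And>x. s \<le> dist a x \<Longrightarrow> \<psi> x = 0"
proof -
  define F where "F = flat_exp 0"
  have F: "F x \<ge> 0" "F x > 0 \<longleftrightarrow> x > 0" "F x = 0 \<longleftrightarrow> x \<le> 0" for x
    by (auto simp: F_def flat_exp_def)
  have pos: "F t + F (1 - t) > 0" for t
    using F(1)[of t] F(1)[of "1 - t"] F(2)[of t] F(2)[of "1 - t"] by (cases "t > 0") linarith+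
  define w where "w = (\<lambda>t. F t * inverse (F t + F (1 - t)))"
  have w: "Cinf_on UNIV w"
    unfolding w_def
  proof (intro Cinf_on_bilinear[OF bounded_bilinear_mult])
    show "Cinf_on UNIV F" unfolding F_def by (rule Cinf_on_flat_exp)
    have "Cinf_on UNIV (\<lambda>t. 1 + (- t))"
      by (intro Cinf_on_add Cinf_on_const
          Cinf_on_bounded_linear[OF bounded_linear_minus[OF bounded_linear_ident]] Cinf_on_id)
    then have "Cinf_on UNIV (\<lambda>t. F (1 + - t))"
      unfolding F_def by (rule Cinf_on_compose[OF Cinf_on_flat_exp]) auto
    then have "Cinf_on UNIV (\<lambda>t. F t + F (1 - t))"
      using Cinf_on_flat_exp by (auto intro!: Cinf_on_add simp: F_def)
    then show "Cinf_on UNIV (\<lambda>t. inverse (F t + F (1 - t)))"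
      using pos by (intro Cinf_on_compose[OF Cinf_on_inverse]) (auto simp: less_le)
  qed
  have sq: "r\<^sup>2 < s\<^sup>2" using assms by (simp add: power_strict_mono)
  define \<psi> where "\<psi> = (\<lambda>x::'e. w ((s\<^sup>2 + (- ((x - a) \<bullet> (x - a)))) * inverse (s\<^sup>2 - r\<^sup>2)))"
  have "Cinf_on UNIV (\<lambda>x::'e. (s\<^sup>2 + (- ((x + (- a)) \<bullet> (x + (- a))))) * inverse (s\<^sup>2 - r\<^sup>2))"
    by (intro Cinf_on_bilinear[OF bounded_bilinear_mult] Cinf_on_add Cinf_on_const Cinf_on_id
        Cinf_on_bounded_linear[OF bounded_linear_minus[OF bounded_linear_ident]]
        Cinf_on_bilinear[OF bounded_bilinear_inner])
  then have "Cinf_on UNIV \<psi>"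
    unfolding \<psi>_def using Cinf_on_compose[OF w] by auto
  moreover have "0 \<le> w t" "w t \<le> 1" for t
    using F(1)[of t] F(1)[of "1 - t"] pos[of t] by (auto simp: w_def divide_simps)
  moreover have "w t = 1" if "t \<ge> 1" for t
    using that F(3)[of "1 - t"] F(3)[of t] by (auto simp: w_def divide_simps)
  moreover have "w t = 0" if "t \<le> 0" for t
    using that F(3)[of t] by (simp add: w_def)
  moreover have n: "(x - a) \<bullet> (x - a) = (dist a x)\<^sup>2" for x
    by (metis dist_commute dist_norm power2_norm_eq_inner)
  moreover have "(s\<^sup>2 + (- ((x - a) \<bullet> (x - a)))) * inverse (s\<^sup>2 - r\<^sup>2) \<ge> 1" if "dist a x \<le> r" for x
  proof -
    have "(dist a x)\<^sup>2 \<le> r\<^sup>2" using that by (simp add: power_mono)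
    then show ?thesis
      using sq n[of x] by (simp add: field_simps)
  qed
  moreover have "(s\<^sup>2 + (- ((x - a) \<bullet> (x - a)))) * inverse (s\<^sup>2 - r\<^sup>2) \<le> 0" if "s \<le> dist a x" for x
  proof -
    have "s\<^sup>2 \<le> (dist a x)\<^sup>2" using that assms by (simp add: power_mono)
    then show ?thesis
      using sq n[of x] by (simp add: mult_le_0_iff)
  qed
  ultimately show ?thesis using that[of \<psi>] unfolding \<psi>_def by auto
qed

subsection \<open>Hadamard's lemma\<close>

text \<open>
  Every differentiation under the integral produces a factor \<open>t\<close>; the weight \<open>t ^ m\<close> makes the
  family closed under differentiation, so that the induction goes through.
\<close>

lemma Ck_on_ray_integral:
  fixes h :: "'e::euclidean_space \<Rightarrow> real"
  assumes "open S" "convex S" "q \<in> S" "Ck_on k S h"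
  shows "Ck_on k S (\<lambda>x. integral (cbox 0 1) (\<lambda>t. t ^ m * h (q + t *\<^sub>R (x - q))))"
  using assms(4)
proof (induction k arbitrary: h m)
  case 0
  have ray: "q + t *\<^sub>R (x - q) \<in> S" if "x \<in> S" "t \<in> cbox 0 1" for x and t :: real
    using convexD_alt[OF assms(2,3) that(1), of t] that(2) by (simp add: algebra_simps)
  have "continuous_on (S \<times> cbox 0 1) (\<lambda>z. snd z ^ m * h (q + snd z *\<^sub>R (fst z - q)))"
    using 0 ray by (auto intro!: continuous_intros continuous_on_compose2[of S h])
  then show ?case
    unfolding Ck_on.simps by (intro integral_continuous_on_param) (simp add: case_prod_unfold)
next
  case (Suc k)
  then obtain h' where h': "\<forall>x\<in>S. (h has_derivative h' x) (at x)" "\<forall>v. Ck_on k S (\<lambda>x. h' x v)"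
    by auto
  have ray: "q + t *\<^sub>R (x - q) \<in> S" if "x \<in> S" "t \<in> cbox 0 1" for x and t :: real
    using convexD_alt[OF assms(2,3) that(1), of t] that(2) by (simp add: algebra_simps)
  have conth: "continuous_on S h" using Suc.prems Ck_on_continuous by blast
  have conth': "continuous_on S (\<lambda>x. h' x v)" for v
    using h'(2) Ck_on_continuous by blast
  have c: "continuous_on (S \<times> cbox 0 1) (\<lambda>z. h' (q + snd z *\<^sub>R (fst z - q)) v)" for v
    using ray by (auto intro!: continuous_intros continuous_on_compose2[OF conth'])
  define H where "H x t = (\<Sum>b\<in>Basis. (t ^ Suc m * h' (q + t *\<^sub>R (x - q)) b) *\<^sub>R blinfun_inner_left b)" for x t
  have app: "blinfun_apply (H x t) v = t ^ Suc m * h' (q + t *\<^sub>R (x - q)) v" if "x \<in> S" "t \<in> cbox 0 1" for x t v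
  proof -
    have lin: "linear (h' (q + t *\<^sub>R (x - q)))"
      using h'(1) ray[OF that] has_derivative_linear by blast
    have "h' (q + t *\<^sub>R (x - q)) v = h' (q + t *\<^sub>R (x - q)) (\<Sum>b\<in>Basis. (v \<bullet> b) *\<^sub>R b)"
      by (simp add: euclidean_representation)
    also have "\<dots> = (\<Sum>b\<in>Basis. (v \<bullet> b) * h' (q + t *\<^sub>R (x - q)) b)"
      by (simp add: linear_sum[OF lin] linear_cmul[OF lin] o_def)
    finally show ?thesis
      by (simp add: H_def blinfun.sum_left blinfun.scaleR_left sum_distrib_left inner_commute mult_ac)
  qed
  have contH: "continuous_on (S \<times> cbox 0 1) (\<lambda>(x, t). H x t)"
    unfolding H_def case_prod_unfold by (intro continuous_intros c)
  have der: "((\<lambda>x. integral (cbox 0 1) (\<lambda>t. t ^ m * h (q + t *\<^sub>R (x - q)))) has_derivative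
      (\<lambda>v. integral (cbox 0 1) (\<lambda>t. t ^ Suc m * h' (q + t *\<^sub>R (x - q)) v))) (at x)" if x: "x \<in> S" for x
  proof -
    have d: "((\<lambda>x. integral (cbox 0 1) (\<lambda>t. t ^ m * h (q + t *\<^sub>R (x - q)))) has_derivative
      integral (cbox 0 1) (H x)) (at x within S)"
    proof (rule leibniz_rule[OF _ _ contH x assms(2)])
      fix x and t :: real assume xt: "x \<in> S" "t \<in> cbox 0 1"
      have "((\<lambda>x. t ^ m * h (q + t *\<^sub>R (x - q))) has_derivative (\<lambda>v. t ^ m * h' (q + t *\<^sub>R (x - q)) (t *\<^sub>R v))) (at x)"
        using h'(1) ray[OF xt]
        by (auto intro!: derivative_eq_intros has_derivative_compose[of _ _ _ _ h])
      moreover have "t ^ m * h' (q + t *\<^sub>R (x - q)) (t *\<^sub>R v) = blinfun_apply (H x t) v" for v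
        using app[OF xt] h'(1) ray[OF xt] linear_cmul[OF has_derivative_linear] by fastforce
      ultimately show "((\<lambda>x. t ^ m * h (q + t *\<^sub>R (x - q))) has_derivative blinfun_apply (H x t)) (at x within S)"
        by (simp add: has_derivative_at_withinI)
    next
      fix x assume "x \<in> S"
      then show "(\<lambda>t. t ^ m * h (q + t *\<^sub>R (x - q))) integrable_on cbox 0 1"
        using ray by (intro integrable_continuous continuous_intros continuous_on_compose2[OF conth]) auto
    qed
    have i: "blinfun_apply (integral (cbox 0 1) (H x)) v
        = integral (cbox 0 1) (\<lambda>t. t ^ Suc m * h' (q + t *\<^sub>R (x - q)) v)" for v
    proof -
      have "continuous_on (cbox 0 1) (H x)"
      proof -
        have "continuous_on (cbox 0 1) (\<lambda>t. (\<lambda>(x, t). H x t) (x, t))"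
          by (rule continuous_on_compose2[OF contH])
            (rule continuous_on_Pair continuous_on_const continuous_on_id, use x in auto)+
        then show ?thesis by simp
      qed
      then have "H x integrable_on cbox 0 1" by (rule integrable_continuous)
      then have "blinfun_apply (integral (cbox 0 1) (H x)) v = integral (cbox 0 1) (\<lambda>t. blinfun_apply (H x t) v)"
        by (rule blinfun_apply_integral)
      also have "\<dots> = integral (cbox 0 1) (\<lambda>t. t ^ Suc m * h' (q + t *\<^sub>R (x - q)) v)"
        using app[OF x] by (intro integral_cong) auto
      finally show ?thesis .
    qed
    show ?thesis
      using d unfolding at_within_open[OF x assms(1)] by (rule has_derivative_eq_rhs) (rule ext, rule i)
  qed
  have "Ck_on k S (\<lambda>x. integral (cbox 0 1) (\<lambda>t. t ^ Suc m * h' (q + t *\<^sub>R (x - q)) v))" for v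
    using Suc.IH h'(2) by blast
  with der show ?case
    by (auto intro!: exI[of _ "\<lambda>x v. integral (cbox 0 1) (\<lambda>t. t ^ Suc m * h' (q + t *\<^sub>R (x - q)) v)"])
qed

text \<open>
  The fundamental theorem of calculus along the segment from \<open>q\<close> to \<open>x\<close>: the coefficient \<open>g b\<close> is the mean of the
  partial derivative over the segment.
\<close>

lemma hadamard:
  fixes f :: "'e::euclidean_space \<Rightarrow> real"
  assumes S: "open S" "convex S" "q \<in> S" and f: "Cinf_on S f"
  obtains g where "\<And>b. Cinf_on S (g b)"
    "\<And>x. x \<in> S \<Longrightarrow> f x = f q + (\<Sum>b\<in>Basis. ((x - q) \<bullet> b) * g b x)"
    "\<And>b. g b q = frechet_derivative f (at q) b"
proof -
  define f' where "f' = (\<lambda>x. frechet_derivative f (at x))"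
  define g where "g b x = integral (cbox 0 1) (\<lambda>t. t ^ 0 * f' (q + t *\<^sub>R (x - q)) b)" for b x
  have f': "(f has_derivative f' x) (at x)" if "x \<in> S" for x
    using Cinf_on_frechet(1)[OF S(1) f that] unfolding f'_def by (simp add: frechet_derivative_works)
  have smooth': "Cinf_on S (\<lambda>x. f' x b)" for b
    unfolding f'_def using Cinf_on_frechet(2)[OF S(1) f] .
  have "Cinf_on S (g b)" for b
    unfolding Cinf_on_def g_def
    by (intro allI Ck_on_ray_integral S) (use smooth' in \<open>auto simp: Cinf_on_def\<close>)
  moreover have "f x = f q + (\<Sum>b\<in>Basis. ((x - q) \<bullet> b) * g b x)" if x: "x \<in> S" for x
  proof -
    have ray: "q + t *\<^sub>R (x - q) \<in> S" if "t \<in> {0..1}" for t :: real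
      using convexD_alt[OF S(2,3) x, of t] that by (simp add: algebra_simps)
    have "((\<lambda>t. f' (q + t *\<^sub>R (x - q)) (x - q)) has_integral
        f (q + 1 *\<^sub>R (x - q)) - f (q + 0 *\<^sub>R (x - q))) {0..1}"
    proof (rule fundamental_theorem_of_calculus)
      fix t :: real assume t: "t \<in> {0..1}"
      have lin: "linear (f' (q + t *\<^sub>R (x - q)))" using f'[OF ray[OF t]] has_derivative_linear by blast
      have "((\<lambda>t. f (q + t *\<^sub>R (x - q))) has_derivative (\<lambda>v. f' (q + t *\<^sub>R (x - q)) (v *\<^sub>R (x - q)))) (at t)"
        using f'[OF ray[OF t]]
        by (auto intro!: derivative_eq_intros has_derivative_compose[of _ _ _ _ f])
      then show "((\<lambda>t. f (q + t *\<^sub>R (x - q))) has_vector_derivative f' (q + t *\<^sub>R (x - q)) (x - q)) (at t within {0..1})"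
        by (auto simp: has_vector_derivative_def linear_cmul[OF lin] has_derivative_at_withinI)
    qed simp
    then have "((\<lambda>t. f' (q + t *\<^sub>R (x - q)) (x - q)) has_integral f x - f q) (cbox 0 1)" by simp
    moreover have "((\<lambda>t. f' (q + t *\<^sub>R (x - q)) (x - q)) has_integral (\<Sum>b\<in>Basis. ((x - q) \<bullet> b) * g b x)) (cbox 0 1)"
    proof -
      have "continuous_on {0..1} (\<lambda>t. f' (q + t *\<^sub>R (x - q)) b)" for b
        by (rule continuous_on_compose2[OF Cinf_on_continuous[OF smooth'[of b]]], intro continuous_intros)
          (use ray in auto)
      then have "((\<lambda>t. f' (q + t *\<^sub>R (x - q)) b) has_integral g b x) (cbox 0 1)" for b
        unfolding g_def using integrable_continuous_interval by (auto intro!: integrable_integral)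
      then have s: "((\<lambda>t. \<Sum>b\<in>Basis. ((x - q) \<bullet> b) * f' (q + t *\<^sub>R (x - q)) b) has_integral
          (\<Sum>b\<in>Basis. ((x - q) \<bullet> b) * g b x)) (cbox 0 1)"
        by (intro has_integral_sum has_integral_mult_right) auto
      have e: "f' (q + t *\<^sub>R (x - q)) (x - q) = (\<Sum>b\<in>Basis. ((x - q) \<bullet> b) * f' (q + t *\<^sub>R (x - q)) b)"
        if "t \<in> cbox 0 1" for t
      proof -
        have lin: "linear (f' (q + t *\<^sub>R (x - q)))"
          using has_derivative_linear[OF f'[OF ray]] that by auto
        have "f' (q + t *\<^sub>R (x - q)) (\<Sum>b\<in>Basis. ((x - q) \<bullet> b) *\<^sub>R b)
          = (\<Sum>b\<in>Basis. ((x - q) \<bullet> b) * f' (q + t *\<^sub>R (x - q)) b)"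
          by (simp only: linear_sum[OF lin] linear_cmul[OF lin] o_def real_scaleR_def)
        then show ?thesis by (simp only: euclidean_representation)
      qed
      show ?thesis by (rule has_integral_eq[OF e[symmetric] s])
    qed
    ultimately have "f x - f q = (\<Sum>b\<in>Basis. ((x - q) \<bullet> b) * g b x)" by (rule has_integral_unique)
    then show ?thesis by linarith
  qed
  moreover have "g b q = frechet_derivative f (at q) b" for b
    by (simp add: g_def f'_def)
  ultimately show ?thesis using that by blast
qed

section \<open>Smooth functions and tangent vectors on a manifold\<close>

locale smooth_manifold =
  fixes A :: "('m::t2_space, 'e::euclidean_space) chart set"
  assumes atlas: "smooth_atlas A"
begin

lemma chart_at: obtains c where "c \<in> A" "p \<in> fst c"
  using atlas unfolding smooth_atlas_def by blast

lemma chart_open: "c \<in> A \<Longrightarrow> open (fst c)"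
  using atlas unfolding smooth_atlas_def by blast

lemma chart_homeo: "c \<in> A \<Longrightarrow> homeomorphism (fst c) (snd c ` fst c) (snd c) (chart_inv c)"
  using atlas unfolding smooth_atlas_def by blast

lemma chart_inv_left: "c \<in> A \<Longrightarrow> p \<in> fst c \<Longrightarrow> chart_inv c (snd c p) = p"
  using chart_homeo by (auto simp: homeomorphism_def)

lemma chart_inv_right: "c \<in> A \<Longrightarrow> x \<in> snd c ` fst c \<Longrightarrow> snd c (chart_inv c x) = x"
  by (auto simp: chart_inv_left)

lemma chart_inv_mem: "c \<in> A \<Longrightarrow> x \<in> snd c ` fst c \<Longrightarrow> chart_inv c x \<in> fst c"
  by (auto simp: chart_inv_left)

lemma chart_continuous: "c \<in> A \<Longrightarrow> continuous_on (fst c) (snd c)"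
  and chart_inv_continuous: "c \<in> A \<Longrightarrow> continuous_on (snd c ` fst c) (chart_inv c)"
  using chart_homeo by (simp_all add: homeomorphism_def)

lemma chart_image_open:
  assumes "c \<in> A" "open W" "W \<subseteq> fst c"
  shows "open (snd c ` W)"
proof -
  have "open (snd c ` fst c)" using atlas assms(1) unfolding smooth_atlas_def by blast
  moreover have "openin (top_of_set (fst c)) W"
    using assms by (auto simp: openin_open)
  ultimately show ?thesis
    using homeomorphism_imp_open_map[OF chart_homeo[OF assms(1)]] openin_open_eq by blast
qed

lemma chart_inv_image_open:
  assumes "c \<in> A" "open B" "B \<subseteq> snd c ` fst c"
  shows "open (chart_inv c ` B)"
proof -
  have "openin (top_of_set (snd c ` fst c)) B"
    using assms by (auto simp: openin_open)
  then show ?thesis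
    using homeomorphism_imp_open_map[OF homeomorphism_symD[OF chart_homeo[OF assms(1)]]]
      chart_open[OF assms(1)] openin_open_eq by blast
qed

subsection \<open>Smoothness\<close>

lemma smooth_onD:
  assumes "smooth_on A W f" "c \<in> A" "V \<subseteq> fst c" "V \<subseteq> W"
  shows "Cinf_on (snd c ` V) (f \<circ> chart_inv c)"
  using assms unfolding smooth_on_def by (blast intro: Cinf_on_subset)

lemma smooth_on_subset: "smooth_on A W f \<Longrightarrow> V \<subseteq> W \<Longrightarrow> smooth_on A V f"
  unfolding smooth_on_def by (blast intro: Cinf_on_subset)

lemma smooth_on_cong:
  assumes "open W" "\<And>x. x \<in> W \<Longrightarrow> f x = g x" "smooth_on A W f"
  shows "smooth_on A W g"
  unfolding smooth_on_def
proof
  fix c assume c: "c \<in> A"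
  have "open (snd c ` (fst c \<inter> W))" using chart_image_open[OF c] chart_open[OF c] assms(1) by blast
  moreover have "(f \<circ> chart_inv c) x = (g \<circ> chart_inv c) x" if "x \<in> snd c ` (fst c \<inter> W)" for x
    using that assms(2) chart_inv_left[OF c] by auto
  ultimately show "Cinf_on (snd c ` (fst c \<inter> W)) (g \<circ> chart_inv c)"
    using assms(3) c Cinf_on_cong unfolding smooth_on_def by blast
qed

lemma smooth_on_local:
  assumes "\<And>p. p \<in> W \<Longrightarrow> \<exists>V. open V \<and> p \<in> V \<and> smooth_on A V f"
  shows "smooth_on A W f"
  unfolding smooth_on_def
proof
  fix c assume c: "c \<in> A"
  show "Cinf_on (snd c ` (fst c \<inter> W)) (f \<circ> chart_inv c)"
  proof (rule Cinf_on_local)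
    fix x assume "x \<in> snd c ` (fst c \<inter> W)"
    then obtain p where p: "p \<in> fst c" "p \<in> W" "x = snd c p" by blast
    obtain V where V: "open V" "p \<in> V" "smooth_on A V f" using assms p(2) by blast
    have "open (snd c ` (fst c \<inter> V))" using chart_image_open[OF c] chart_open[OF c] V(1) by blast
    then show "\<exists>T. open T \<and> x \<in> T \<and> Cinf_on T (f \<circ> chart_inv c)"
      using p V c unfolding smooth_on_def by blast
  qed
qed

text \<open>The transition maps carry smoothness in one chart to all others.\<close>

lemma smooth_on_chartI:
  assumes c: "c \<in> A" and V: "open V" "V \<subseteq> fst c" and f: "Cinf_on (snd c ` V) (f \<circ> chart_inv c)"
  shows "smooth_on A V f"
  unfolding smooth_on_def
proof
  fix d assume d: "d \<in> A"
  have "Cinf_on (snd d ` (fst d \<inter> V)) (snd c \<circ> chart_inv d)"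
    using atlas c d V unfolding smooth_atlas_def by (blast intro: Cinf_on_subset)
  moreover have "(snd c \<circ> chart_inv d) ` (snd d ` (fst d \<inter> V)) \<subseteq> snd c ` V"
    using chart_inv_left[OF d] by auto
  ultimately have a: "Cinf_on (snd d ` (fst d \<inter> V)) (\<lambda>x. (f \<circ> chart_inv c) ((snd c \<circ> chart_inv d) x))"
    using Cinf_on_compose[OF f] by blast
  have b: "(f \<circ> chart_inv c) ((snd c \<circ> chart_inv d) x) = (f \<circ> chart_inv d) x"
    if "x \<in> snd d ` (fst d \<inter> V)" for x
    using that chart_inv_left[OF d] chart_inv_left[OF c] V by auto
  have o: "open (snd d ` (fst d \<inter> V))"
    using chart_image_open[OF d] chart_open[OF d] V(1) by blast
  show "Cinf_on (snd d ` (fst d \<inter> V)) (f \<circ> chart_inv d)"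
    by (rule iffD1[OF Cinf_on_cong[OF o b] a])
qed

lemma smooth_on_const [simp]: "smooth_on A W (\<lambda>_. k)"
  unfolding smooth_on_def o_def by (simp add: Cinf_on_const)

lemma smooth_on_bilinear:
  "bounded_bilinear m \<Longrightarrow> smooth_on A W f \<Longrightarrow> smooth_on A W g \<Longrightarrow> smooth_on A W (\<lambda>x. m (f x) (g x))"
  unfolding smooth_on_def o_def by (auto intro: Cinf_on_bilinear)

lemma smooth_on_linear: "bounded_linear l \<Longrightarrow> smooth_on A W f \<Longrightarrow> smooth_on A W (\<lambda>x. l (f x))"
  unfolding smooth_on_def o_def by (auto intro: Cinf_on_bounded_linear)

lemma smooth_on_add [simp]:
  "smooth_on A W f \<Longrightarrow> smooth_on A W g \<Longrightarrow> smooth_on A W (\<lambda>x. f x + g x)"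
  unfolding smooth_on_def o_def by (simp add: Cinf_on_add)

lemma smooth_on_sum [simp]:
  "(\<And>i. i \<in> I \<Longrightarrow> smooth_on A W (f i)) \<Longrightarrow> smooth_on A W (\<lambda>x. \<Sum>i\<in>I. f i x)"
  unfolding smooth_on_def o_def by (simp add: Cinf_on_sum)

lemma smooth_on_minus [simp]: "smooth_on A W f \<Longrightarrow> smooth_on A W (\<lambda>x. - f x)"
  by (rule smooth_on_linear[OF bounded_linear_minus[OF bounded_linear_ident]])

lemma smooth_on_diff [simp]:
  "smooth_on A W f \<Longrightarrow> smooth_on A W g \<Longrightarrow> smooth_on A W (\<lambda>x. f x - g x)"
  using smooth_on_add[of W f "\<lambda>x. - g x"] by simp

lemma smooth_on_mult [simp]:
  fixes f g :: "'m \<Rightarrow> 'b::real_normed_algebra"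
  shows "smooth_on A W f \<Longrightarrow> smooth_on A W g \<Longrightarrow> smooth_on A W (\<lambda>x. f x * g x)"
  by (rule smooth_on_bilinear[OF bounded_bilinear_mult])

lemma smooth_on_scaleR [simp]:
  "smooth_on A W f \<Longrightarrow> smooth_on A W g \<Longrightarrow> smooth_on A W (\<lambda>x. f x *\<^sub>R g x)"
  by (rule smooth_on_bilinear[OF bounded_bilinear_scaleR])

lemma smooth_on_prod [simp]:
  fixes f :: "'i \<Rightarrow> 'm \<Rightarrow> real"
  shows "(\<And>i. i \<in> I \<Longrightarrow> smooth_on A W (f i)) \<Longrightarrow> smooth_on A W (\<lambda>x. \<Prod>i\<in>I. f i x)"
  by (induction I rule: infinite_finite_induct) auto

lemma smooth_on_of_real [simp]: "smooth_on A W f \<Longrightarrow> smooth_on A W (\<lambda>x. complex_of_real (f x))"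
  by (rule smooth_on_linear[OF bounded_linear_of_real])

lemma smooth_on_Re [simp]: "smooth_on A W f \<Longrightarrow> smooth_on A W (\<lambda>x. Re (f x))"
  by (rule smooth_on_linear[OF bounded_linear_Re])

lemma smooth_on_Im [simp]: "smooth_on A W f \<Longrightarrow> smooth_on A W (\<lambda>x. Im (f x))"
  by (rule smooth_on_linear[OF bounded_linear_Im])

lemma smooth_on_Complex [simp]:
  assumes "smooth_on A W f" "smooth_on A W g"
  shows "smooth_on A W (\<lambda>x. Complex (f x) (g x))"
proof -
  have "smooth_on A W (\<lambda>x. complex_of_real (f x) + \<i> * complex_of_real (g x))"
    using assms by (intro smooth_on_add smooth_on_mult smooth_on_of_real smooth_on_const)
  then show ?thesis by (simp add: Complex_eq)
qed

lemma smooth_on_inverse: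
  fixes f :: "'m \<Rightarrow> real"
  assumes "smooth_on A W f" "\<And>x. x \<in> W \<Longrightarrow> f x \<noteq> 0"
  shows "smooth_on A W (\<lambda>x. inverse (f x))"
  unfolding smooth_on_def o_def
proof
  fix c assume c: "c \<in> A"
  show "Cinf_on (snd c ` (fst c \<inter> W)) (\<lambda>x. inverse (f (chart_inv c x)))"
    using assms c chart_inv_left[OF c]
    by (intro Cinf_on_compose[OF Cinf_on_inverse]) (auto simp: smooth_on_def o_def)
qed

lemma smooth_on_continuous:
  assumes "smooth_on A W f" "open W"
  shows "continuous_on W f"
proof (rule continuous_at_imp_continuous_on, rule ballI)
  fix p assume p: "p \<in> W"
  obtain c where c: "c \<in> A" "p \<in> fst c" using chart_at .
  let ?V = "fst c \<inter> W"
  have "continuous_on (snd c ` ?V) (f \<circ> chart_inv c)"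
    using assms c unfolding smooth_on_def by (blast intro: Cinf_on_continuous)
  then have "continuous_on ?V ((f \<circ> chart_inv c) \<circ> snd c)"
    by (rule continuous_on_compose[OF continuous_on_subset[OF chart_continuous[OF c(1)] Int_lower1]])
  moreover have "((f \<circ> chart_inv c) \<circ> snd c) x = f x" if "x \<in> ?V" for x
    using that chart_inv_left[OF c(1)] by simp
  ultimately have "continuous_on ?V f" by (metis (no_types, lifting) continuous_on_cong)
  moreover have "open ?V" using chart_open c assms by blast
  ultimately show "isCont f p" using p c by (simp add: continuous_on_eq_continuous_at)
qed

lemma smooth_cutoff_mult:
  assumes "smooth A \<psi>" "closed K" "K \<subseteq> W" "open W" "\<And>x. x \<notin> K \<Longrightarrow> \<psi> x = 0" "smooth_on A W g"
  shows "smooth A (\<lambda>x. \<psi> x *\<^sub>R g x)"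
proof (rule smooth_on_local)
  fix p
  show "\<exists>V. open V \<and> p \<in> V \<and> smooth_on A V (\<lambda>x. \<psi> x *\<^sub>R g x)"
  proof (cases "p \<in> W")
    case True
    then show ?thesis
      using assms smooth_on_subset[OF assms(1), of W] smooth_on_scaleR by blast
  next
    case False
    have "open (- K)" using assms(2) by blast
    moreover have "smooth_on A (- K) (\<lambda>x. \<psi> x *\<^sub>R g x)"
      by (rule smooth_on_cong[OF calculation, of "\<lambda>_. 0"]) (use assms(5) in auto)
    ultimately show ?thesis using False assms(3) by blast
  qed
qed

text \<open>
  The plateau around the chart image of \<open>p\<close>, transported to the manifold. As \<open>K\<close> is compact, it is closed
  in the Hausdorff space \<open>'m\<close>, and so the extension by zero is smooth.
\<close>

lemma chart_cutoff:
  assumes c: "c \<in> A" "p \<in> fst c" and W: "open W" "p \<in> W"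
  obtains r \<psi> K V where "r > 0" "V = chart_inv c ` ball (snd c p) r" "open V" "p \<in> V"
    "snd c ` V = ball (snd c p) r" "V \<subseteq> K" "compact K" "K \<subseteq> W" "K \<subseteq> fst c"
    "smooth A \<psi>" "\<And>x. 0 \<le> \<psi> x" "\<And>x. x \<in> V \<Longrightarrow> \<psi> x = (1::real)" "\<And>x. x \<notin> K \<Longrightarrow> \<psi> x = 0"
proof -
  let ?O = "snd c ` (fst c \<inter> W)"
  have "open ?O" using chart_image_open[OF c(1)] chart_open[OF c(1)] W(1) by blast
  then obtain e where e: "e > 0" "cball (snd c p) e \<subseteq> ?O"
    using open_contains_cball c(2) W(2) by blast
  obtain \<psi> :: "'e \<Rightarrow> real" where \<psi>: "Cinf_on UNIV \<psi>" "\<And>x. 0 \<le> \<psi> x" "\<And>x. \<psi> x \<le> 1"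
    "\<And>x. dist (snd c p) x \<le> e / 2 \<Longrightarrow> \<psi> x = 1" "\<And>x. e \<le> dist (snd c p) x \<Longrightarrow> \<psi> x = 0"
  proof -
    have "0 < e / 2" "e / 2 < e" using e(1) by auto
    from smooth_plateau[OF this, of "snd c p"] that show ?thesis by metis
  qed
  define V where "V = chart_inv c ` ball (snd c p) (e / 2)"
  define K where "K = chart_inv c ` cball (snd c p) e"
  define \<Psi> where "\<Psi> = (\<lambda>q. if q \<in> fst c then \<psi> (snd c q) else 0)"
  have sub: "cball (snd c p) e \<subseteq> snd c ` fst c" "ball (snd c p) (e / 2) \<subseteq> cball (snd c p) e"
    using e by auto
  have "open V" unfolding V_def using chart_inv_image_open[OF c(1)] sub by blast
  have "continuous_on (cball (snd c p) e) (chart_inv c)"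
    using continuous_on_subset[OF chart_inv_continuous[OF c(1)] sub(1)] .
  then have K: "compact K" unfolding K_def using compact_continuous_image compact_cball by blast
  have KW: "K \<subseteq> fst c \<inter> W" unfolding K_def using e(2) chart_inv_left[OF c(1)] by auto
  have "p \<in> V" unfolding V_def
    using e(1) chart_inv_left[OF c] by (intro image_eqI[of _ _ "snd c p"]) auto
  have sV: "snd c ` V = ball (snd c p) (e / 2)"
  proof -
    have "snd c (chart_inv c x) = x" if "x \<in> ball (snd c p) (e / 2)" for x
      using chart_inv_right[OF c(1), of x] sub that by blast
    then have "(\<lambda>x. snd c (chart_inv c x)) ` ball (snd c p) (e / 2) = (\<lambda>x. x) ` ball (snd c p) (e / 2)"
      by (rule image_cong[OF refl])
    then show ?thesis unfolding V_def image_image by (simp only: image_ident)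
  qed
  have sm: "smooth A \<Psi>"
  proof (rule smooth_on_local)
    fix q
    have z: "\<Psi> x = 0" if "x \<notin> K" for x
    proof (cases "x \<in> fst c")
      case True
      then have "snd c x \<notin> cball (snd c p) e"
        using that chart_inv_left[OF c(1), of x] unfolding K_def by (metis imageI)
      then show ?thesis unfolding \<Psi>_def using \<psi>(5) by auto
    qed (simp add: \<Psi>_def)
    show "\<exists>V. open V \<and> q \<in> V \<and> smooth_on A V \<Psi>"
    proof (cases "q \<in> fst c")
      case True
      have "Cinf_on (snd c ` fst c) (\<Psi> \<circ> chart_inv c) \<longleftrightarrow> Cinf_on (snd c ` fst c) \<psi>"
        using chart_image_open[OF c(1) chart_open[OF c(1)]] chart_inv_right[OF c(1)] chart_inv_mem[OF c(1)]
        by (intro Cinf_on_cong) (auto simp: \<Psi>_def)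
      then have "smooth_on A (fst c) \<Psi>"
        using smooth_on_chartI[OF c(1) chart_open[OF c(1)]] Cinf_on_subset[OF \<psi>(1)] by blast
      then show ?thesis using True chart_open c(1) by blast
    next
      case False
      have "open (- K)" using K compact_imp_closed by blast
      moreover have "smooth_on A (- K) \<Psi>"
        by (rule smooth_on_cong[OF calculation, of "\<lambda>_. 0"]) (use z in auto)
      ultimately show ?thesis using False KW by blast
    qed
  qed
  have one: "\<Psi> x = 1" if x: "x \<in> V" for x
  proof -
    have "snd c x \<in> ball (snd c p) (e / 2)" using sV x by blast
    moreover have "x \<in> fst c" using x sub chart_inv_mem[OF c(1)] unfolding V_def by blast
    ultimately show ?thesis unfolding \<Psi>_def using \<psi>(4) by auto
  qed
  have zero: "\<Psi> x = 0" if "x \<notin> K" for x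
  proof (cases "x \<in> fst c")
    case True
    then have "snd c x \<notin> cball (snd c p) e"
      using that chart_inv_left[OF c(1), of x] unfolding K_def by (metis imageI)
    then show ?thesis unfolding \<Psi>_def using \<psi>(5) by auto
  qed (simp add: \<Psi>_def)
  have nonneg: "0 \<le> \<Psi> x" for x using \<psi>(2) by (simp add: \<Psi>_def)
  have VK: "V \<subseteq> K" unfolding V_def K_def using sub(2) by (rule image_mono)
  show ?thesis
    by (rule that[OF _ V_def \<open>open V\<close> \<open>p \<in> V\<close> sV VK K _ _ sm nonneg one zero]) (use e(1) KW in auto)
qed

lemma smooth_extension:
  fixes g :: "'m \<Rightarrow> 'b::real_normed_vector"
  assumes "open W" "p \<in> W" "smooth_on A W g"
  obtains G V where "smooth A G" "open V" "p \<in> V" "V \<subseteq> W" "\<And>x. x \<in> V \<Longrightarrow> G x = g x"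
proof -
  obtain c where c: "c \<in> A" "p \<in> fst c" using chart_at .
  obtain r \<psi> K V where "open V" "p \<in> V" "V \<subseteq> K" "compact K" "K \<subseteq> W"
    "smooth A \<psi>" "\<And>x. x \<in> V \<Longrightarrow> \<psi> x = (1::real)" "\<And>x. x \<notin> K \<Longrightarrow> \<psi> x = 0"
    using chart_cutoff[OF c assms(1,2)] by metis
  moreover from this have "smooth A (\<lambda>x. \<psi> x *\<^sub>R g x)"
    using smooth_cutoff_mult[of \<psi> K W g] assms compact_imp_closed by blast
  ultimately show ?thesis using that[of "\<lambda>x. \<psi> x *\<^sub>R g x" V] by auto
qed

subsection \<open>Tangent vectors\<close>

lemma tangent_add:
  "v \<in> tangent_space A p \<Longrightarrow> smooth A f \<Longrightarrow> smooth A g \<Longrightarrow> v (\<lambda>x. f x + g x) = v f + v g"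
  unfolding tangent_space_def by blast

lemma tangent_cmult: "v \<in> tangent_space A p \<Longrightarrow> smooth A f \<Longrightarrow> v (\<lambda>x. k * f x) = k * v f"
  unfolding tangent_space_def by blast

lemma tangent_mult:
  "v \<in> tangent_space A p \<Longrightarrow> smooth A f \<Longrightarrow> smooth A g \<Longrightarrow> v (\<lambda>x. f x * g x) = v f * g p + f p * v g"
  unfolding tangent_space_def by blast

lemma tangent_nonsmooth: "v \<in> tangent_space A p \<Longrightarrow> \<not> smooth A f \<Longrightarrow> v f = 0"
  unfolding tangent_space_def by blast

lemma tangent_const:
  assumes "v \<in> tangent_space A p"
  shows "v (\<lambda>_. k) = 0"
proof -
  have "v (\<lambda>_. 1 * 1) = v (\<lambda>_. 1) * 1 + 1 * v (\<lambda>_. 1)"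
    using tangent_mult[OF assms, of "\<lambda>_. 1" "\<lambda>_. 1"] by simp
  then have "v (\<lambda>_. 1) = 0" by simp
  then show ?thesis using tangent_cmult[OF assms, of "\<lambda>_. 1" k] by simp
qed

lemma tangent_minus: "v \<in> tangent_space A p \<Longrightarrow> smooth A f \<Longrightarrow> v (\<lambda>x. - f x) = - v f"
  using tangent_cmult[of v p f "-1"] by simp

lemma tangent_diff:
  "v \<in> tangent_space A p \<Longrightarrow> smooth A f \<Longrightarrow> smooth A g \<Longrightarrow> v (\<lambda>x. f x - g x) = v f - v g"
  using tangent_add[of v p f "\<lambda>x. - g x"] by (simp add: tangent_minus)

lemma tangent_sum:
  assumes "v \<in> tangent_space A p" "\<And>i. i \<in> I \<Longrightarrow> smooth A (f i)"
  shows "v (\<lambda>x. \<Sum>i\<in>I. f i x) = (\<Sum>i\<in>I. v (f i))"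
  using assms(2)
proof (induction I rule: infinite_finite_induct)
  case (insert i I)
  then show ?case using tangent_add[OF assms(1), of "f i" "\<lambda>x. \<Sum>i\<in>I. f i x"] by simp
qed (simp_all add: tangent_const[OF assms(1)])

lemma tangent_prod:
  assumes "v \<in> tangent_space A p" "\<And>i. i \<in> I \<Longrightarrow> smooth A (f i)" "finite I"
  shows "v (\<lambda>x. \<Prod>i\<in>I. f i x) = (\<Sum>i\<in>I. v (f i) * (\<Prod>j\<in>I - {i}. f j p))"
  using assms(3,2)
proof (induction I rule: finite_induct)
  case (insert i I)
  have "(\<Sum>k\<in>I. v (f k) * (\<Prod>j\<in>insert i I - {k}. f j p)) = f i p * (\<Sum>k\<in>I. v (f k) * (\<Prod>j\<in>I - {k}. f j p))"
    unfolding sum_distrib_left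
  proof (rule sum.cong[OF refl])
    fix k assume "k \<in> I"
    then have "insert i I - {k} = insert i (I - {k})" using insert.hyps by auto
    then show "v (f k) * (\<Prod>j\<in>insert i I - {k}. f j p) = f i p * (v (f k) * (\<Prod>j\<in>I - {k}. f j p))"
      using insert.hyps by simp
  qed
  then show ?case
    using insert tangent_mult[OF assms(1), of "f i" "\<lambda>x. \<Prod>i\<in>I. f i x"] by simp
qed (simp add: tangent_const[OF assms(1)])

text \<open>If \<open>\<psi>\<close> is a cutoff supported where \<open>f = g\<close>, then \<open>\<psi> (f - g) = 0\<close>, and the product rule gives \<open>v f = v g\<close>.\<close>

lemma tangent_local:
  assumes v: "v \<in> tangent_space A p" and s: "smooth A f" "smooth A g"
    and V: "open V" "p \<in> V" "\<And>x. x \<in> V \<Longrightarrow> f x = g x"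
  shows "v f = v g"
proof -
  obtain c where c: "c \<in> A" "p \<in> fst c" using chart_at .
  obtain r \<psi> K V' where \<psi>: "p \<in> V'" "K \<subseteq> V" "smooth A \<psi>"
    "\<And>x. x \<in> V' \<Longrightarrow> \<psi> x = (1::real)" "\<And>x. x \<notin> K \<Longrightarrow> \<psi> x = 0"
    using chart_cutoff[OF c V(1,2)] by metis
  have "(\<lambda>x. \<psi> x * (f x - g x)) = (\<lambda>_. 0)" using V(3) \<psi>(2,5) by fastforce
  then have "0 = v (\<lambda>x. \<psi> x * (f x - g x))" using tangent_const[OF v] by simp
  also have "\<dots> = v \<psi> * (f p - g p) + \<psi> p * v (\<lambda>x. f x - g x)"
    using s \<psi> by (intro tangent_mult[OF v]) auto
  also have "\<dots> = v f - v g" using V \<psi> s by (simp add: tangent_diff[OF v])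
  finally show ?thesis by simp
qed

lemma tangent_zero: "(\<lambda>_. 0) \<in> tangent_space A p"
  unfolding tangent_space_def by auto

lemma tangent_space_add:
  "v \<in> tangent_space A p \<Longrightarrow> w \<in> tangent_space A p \<Longrightarrow> (\<lambda>u. v u + w u) \<in> tangent_space A p"
  unfolding tangent_space_def by (auto simp: algebra_simps)

lemma tangent_space_scale: "v \<in> tangent_space A p \<Longrightarrow> (\<lambda>u. k * v u) \<in> tangent_space A p"
  unfolding tangent_space_def by (auto simp: algebra_simps)

lemma tangent_space_sum:
  "(\<And>i. i \<in> I \<Longrightarrow> v i \<in> tangent_space A p) \<Longrightarrow> (\<lambda>u. \<Sum>i\<in>I. v i u) \<in> tangent_space A p"
  by (induction I rule: infinite_finite_induct) (auto intro: tangent_zero tangent_space_add)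

lemma coord_vector_has_derivative:
  assumes c: "c \<in> A" "p \<in> fst c" and f: "smooth A f"
  shows "((f \<circ> chart_inv c) has_derivative (\<lambda>b. coord_vector A c p b f)) (at (snd c p))"
proof -
  have "(f \<circ> chart_inv c) differentiable (at (snd c p))"
    using Cinf_on_frechet(1)[OF chart_image_open[OF c(1) chart_open[OF c(1)]]]
      smooth_onD[OF f c(1), of "fst c"] c(2) by auto
  then show ?thesis using f by (simp add: coord_vector_def frechet_derivative_works)
qed

lemma coord_vector_eqI:
  assumes c: "c \<in> A" "p \<in> fst c" and f: "smooth A f"
    and "((f \<circ> chart_inv c) has_derivative F) (at (snd c p))"
  shows "coord_vector A c p b f = F b"
  using coord_vector_has_derivative[OF c f] assms(4) has_derivative_unique by metis

lemma coord_vector_tangent: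
  assumes c: "c \<in> A" "p \<in> fst c"
  shows "coord_vector A c p b \<in> tangent_space A p"
proof -
  note d = coord_vector_has_derivative[OF c]
  have "coord_vector A c p b (\<lambda>x. f x + g x) = coord_vector A c p b f + coord_vector A c p b g"
    if "smooth A f" "smooth A g" for f g
    using coord_vector_eqI[OF c, of "\<lambda>x. f x + g x" "\<lambda>b. coord_vector A c p b f + coord_vector A c p b g"]
      has_derivative_add[OF d d, OF that] that by (simp add: o_def)
  moreover have "coord_vector A c p b (\<lambda>x. k * f x) = k * coord_vector A c p b f"
    if "smooth A f" for f k
    using coord_vector_eqI[OF c, of "\<lambda>x. k * f x" "\<lambda>b. k * coord_vector A c p b f"]
      has_derivative_mult_right[OF d, OF that] that by (simp add: o_def)
  moreover have "coord_vector A c p b (\<lambda>x. f x * g x) = coord_vector A c p b f * g p + f p * coord_vector A c p b g"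
    if "smooth A f" "smooth A g" for f g
    using coord_vector_eqI[OF c, of "\<lambda>x. f x * g x"
        "\<lambda>b. f p * coord_vector A c p b g + coord_vector A c p b f * g p"]
      has_derivative_mult[OF d d, OF that] that chart_inv_left[OF c] by (simp add: o_def)
  moreover have "coord_vector A c p b f = 0" if "\<not> smooth A f" for f
    using that by (simp add: coord_vector_def)
  ultimately show ?thesis unfolding tangent_space_def by blast
qed

subsection \<open>Vector fields\<close>

lemma vf_tangent: "X \<in> vector_fields A \<Longrightarrow> X p \<in> tangent_space A p"
  unfolding vector_fields_def by blast

lemma vf_smooth [simp]: "X \<in> vector_fields A \<Longrightarrow> smooth A f \<Longrightarrow> smooth A (\<lambda>p. X p f)"
  unfolding vector_fields_def by blast

lemmas vf_derivation = tangent_add[OF vf_tangent] tangent_cmult[OF vf_tangent]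
  tangent_mult[OF vf_tangent] tangent_const[OF vf_tangent] tangent_minus[OF vf_tangent]
  tangent_diff[OF vf_tangent]

lemma vf_add [simp]: "X \<in> vector_fields A \<Longrightarrow> Y \<in> vector_fields A \<Longrightarrow> vf_add X Y \<in> vector_fields A"
  unfolding vector_fields_def vf_add_def by (auto intro: tangent_space_add)

lemma vf_scale [simp]: "X \<in> vector_fields A \<Longrightarrow> smooth A f \<Longrightarrow> vf_scale f X \<in> vector_fields A"
  unfolding vector_fields_def vf_scale_def by (auto intro: tangent_space_scale)

lemma vf_zero [simp]: "(\<lambda>_ _. 0) \<in> vector_fields A"
  unfolding vector_fields_def by (auto intro: tangent_zero)

lemma vf_sum:
  "(\<And>i. i \<in> I \<Longrightarrow> X i \<in> vector_fields A) \<Longrightarrow> (\<lambda>p u. \<Sum>i\<in>I. X i p u) \<in> vector_fields A"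
  unfolding vector_fields_def by (auto intro: tangent_space_sum)

lemma vf_lie_bracket [simp]:
  assumes X: "X \<in> vector_fields A" and Y: "Y \<in> vector_fields A"
  shows "lie_bracket X Y \<in> vector_fields A"
proof -
  note s = vf_smooth[OF X] vf_smooth[OF Y]
  have "lie_bracket X Y p \<in> tangent_space A p" for p
  proof -
    have "lie_bracket X Y p (\<lambda>x. f x + g x) = lie_bracket X Y p f + lie_bracket X Y p g"
      if "smooth A f" "smooth A g" for f g
      using that s by (simp add: lie_bracket_def vf_derivation[OF X] vf_derivation[OF Y])
    moreover have "lie_bracket X Y p (\<lambda>x. k * f x) = k * lie_bracket X Y p f"
      if "smooth A f" for f k
      using that s by (simp add: lie_bracket_def vf_derivation[OF X] vf_derivation[OF Y] algebra_simps)
    moreover have "lie_bracket X Y p (\<lambda>x. f x * g x) = lie_bracket X Y p f * g p + f p * lie_bracket X Y p g"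
      if "smooth A f" "smooth A g" for f g
      using that s by (simp add: lie_bracket_def vf_derivation[OF X] vf_derivation[OF Y] algebra_simps)
    moreover have "lie_bracket X Y p f = 0" if "\<not> smooth A f" for f
      using that tangent_nonsmooth[OF vf_tangent[OF X]] tangent_nonsmooth[OF vf_tangent[OF Y]]
      by (simp add: lie_bracket_def vf_derivation[OF X] vf_derivation[OF Y])
    ultimately show ?thesis unfolding tangent_space_def by blast
  qed
  then show ?thesis
    unfolding vector_fields_def using s by (auto simp: lie_bracket_def)
qed

text \<open>
  On the domain of a frame the tangent spaces are the spans of the \<open>Y b\<close>, and the functions
  \<open>y b\<close> are the dual coordinates; but \<open>y b\<close> and \<open>Y b\<close> are globally defined, so that global
  statements can be reduced to them by multiplication with a cutoff.
\<close>

definition local_frame :: "'m set \<Rightarrow> ('e \<Rightarrow> 'm \<Rightarrow> real) \<Rightarrow> ('e \<Rightarrow> 'm vector_field) \<Rightarrow> bool" where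
  "local_frame V y Y \<longleftrightarrow> open V \<and> (\<forall>b. smooth A (y b)) \<and> (\<forall>b. Y b \<in> vector_fields A) \<and>
     (\<forall>q\<in>V. \<forall>v\<in>tangent_space A q. \<forall>u. v u = (\<Sum>b\<in>Basis. v (y b) * Y b q u)) \<and>
     (\<forall>q\<in>V. \<forall>b\<in>Basis. \<forall>c\<in>Basis. Y b q (y c) = (if b = c then 1 else 0))"

text \<open>
  A chart gives a frame: the coordinates and the coordinate fields, cut off. That every derivation
  is a combination of coordinate derivations is Hadamard's lemma.
\<close>

lemma chart_frame:
  assumes c: "c \<in> A" "p \<in> fst c" and W: "open W" "p \<in> W"
  obtains r K V y Y where "r > 0" "V = chart_inv c ` ball (snd c p) r" "open V" "p \<in> V"
    "snd c ` V = ball (snd c p) r" "V \<subseteq> K" "compact K" "K \<subseteq> W" "K \<subseteq> fst c"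
    "local_frame V y Y" "\<And>b q. q \<in> V \<Longrightarrow> Y b q = coord_vector A c q b"
    "\<And>b q. q \<in> V \<Longrightarrow> y b q = snd c q \<bullet> b"
proof -
  obtain r \<psi> K V where V: "r > 0" "V = chart_inv c ` ball (snd c p) r" "open V" "p \<in> V"
    "snd c ` V = ball (snd c p) r" "V \<subseteq> K" "compact K" "K \<subseteq> W" "K \<subseteq> fst c"
    and \<psi>: "smooth A \<psi>" "\<And>x. 0 \<le> \<psi> x" "\<And>x. x \<in> V \<Longrightarrow> \<psi> x = (1::real)" "\<And>x. x \<notin> K \<Longrightarrow> \<psi> x = 0"
    using chart_cutoff[OF c W] by metis
  have VU: "V \<subseteq> fst c" using V by blast
  define y where "y = (\<lambda>b q. \<psi> q *\<^sub>R (snd c q \<bullet> b))"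
  define Y where "Y = (\<lambda>b q u. \<psi> q * (if q \<in> fst c then coord_vector A c q b u else 0))"
  have oc: "open (snd c ` fst c)" using chart_image_open[OF c(1) chart_open[OF c(1)]] by blast
  have y: "smooth A (y b)" for b
    unfolding y_def
  proof (rule smooth_cutoff_mult[OF \<psi>(1) compact_imp_closed[OF V(7)] V(9) chart_open[OF c(1)] \<psi>(4)])
    have "Cinf_on (snd c ` fst c) ((\<lambda>q. snd c q \<bullet> b) \<circ> chart_inv c) \<longleftrightarrow> Cinf_on (snd c ` fst c) (\<lambda>x. x \<bullet> b)"
      using chart_inv_right[OF c(1)] by (intro Cinf_on_cong[OF oc]) auto
    then show "smooth_on A (fst c) (\<lambda>q. snd c q \<bullet> b)"
      using smooth_on_chartI[OF c(1) chart_open[OF c(1)] order_refl]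
        Cinf_on_bounded_linear[OF bounded_linear_inner_left Cinf_on_id] by blast
  qed
  have Y: "Y b \<in> vector_fields A" for b
  proof -
    have "Y b q \<in> tangent_space A q" for q
      unfolding Y_def
      by (rule tangent_space_scale, cases "q \<in> fst c")
        (simp_all add: tangent_zero coord_vector_tangent[OF c(1)])
    moreover have "smooth A (\<lambda>q. Y b q u)" if u: "smooth A u" for u
    proof -
      let ?g = "\<lambda>q. if q \<in> fst c then coord_vector A c q b u else 0"
      have "smooth A (\<lambda>q. \<psi> q *\<^sub>R ?g q)"
      proof (rule smooth_cutoff_mult[OF \<psi>(1) compact_imp_closed[OF V(7)] V(9) chart_open[OF c(1)] \<psi>(4)])
        have "Cinf_on (snd c ` fst c) (?g \<circ> chart_inv c) \<longleftrightarrow>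
            Cinf_on (snd c ` fst c) (\<lambda>x. frechet_derivative (u \<circ> chart_inv c) (at x) b)"
          using chart_inv_right[OF c(1)] chart_inv_mem[OF c(1)] u
          by (intro Cinf_on_cong[OF oc]) (auto simp: coord_vector_def)
        then show "smooth_on A (fst c) ?g"
          using smooth_on_chartI[OF c(1) chart_open[OF c(1)] order_refl]
            Cinf_on_frechet(2)[OF oc smooth_onD[OF u c(1)]] by blast
      qed
      then show ?thesis by (simp add: Y_def)
    qed
    ultimately show ?thesis unfolding vector_fields_def by blast
  qed
  have Yc: "Y b q = coord_vector A c q b" if "q \<in> V" for b q
    using that \<psi>(3) VU by (auto simp: Y_def fun_eq_iff)
  have yc: "y b q = snd c q \<bullet> b" if "q \<in> V" for b q
    using that \<psi>(3) by (simp add: y_def)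
  have dual: "Y b q (y d) = (if b = d then 1 else 0)" if q: "q \<in> V" and bd: "b \<in> Basis" "d \<in> Basis" for b d q
  proof -
    have "((\<lambda>x. x \<bullet> d) has_derivative (\<lambda>v. v \<bullet> d)) (at (snd c q))"
      by (auto intro!: derivative_eq_intros)
    moreover have "(y d \<circ> chart_inv c) x = x \<bullet> d" if "x \<in> ball (snd c p) r" for x
    proof -
      have "chart_inv c x \<in> V" using V(2) that by blast
      moreover have "snd c (chart_inv c x) = x" using chart_inv_right[OF c(1)] that V(5) VU by blast
      ultimately show ?thesis using yc by simp
    qed
    ultimately have "((y d \<circ> chart_inv c) has_derivative (\<lambda>v. v \<bullet> d)) (at (snd c q))"
      using has_derivative_transform_within_open[of "\<lambda>x. x \<bullet> d" _ "snd c q" UNIV "ball (snd c p) r"]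
        V(5) q by (metis imageI open_ball)
    then have "coord_vector A c q b (y d) = b \<bullet> d"
      using coord_vector_eqI[OF c(1) _ y] q VU by blast
    then show ?thesis using Yc[OF q] inner_Basis[OF bd] by simp
  qed
  have expand: "v u = (\<Sum>b\<in>Basis. v (y b) * Y b q u)" if q: "q \<in> V" and v: "v \<in> tangent_space A q" for q v u
  proof (cases "smooth A u")
    case False
    then show ?thesis
      using tangent_nonsmooth[OF v] tangent_nonsmooth[OF vf_tangent[OF Y]] by simp
  next
    case u: True
    let ?B = "ball (snd c p) r" and ?x = "snd c q"
    have uB: "Cinf_on ?B (u \<circ> chart_inv c)" using smooth_onD[OF u c(1) VU] V(5) by simp
    have xB: "?x \<in> ?B" using V(5) q by blast
    obtain g where g: "\<And>b. Cinf_on ?B (g b)"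
      "\<And>x. x \<in> ?B \<Longrightarrow> (u \<circ> chart_inv c) x = (u \<circ> chart_inv c) ?x + (\<Sum>b\<in>Basis. ((x - ?x) \<bullet> b) * g b x)"
      "\<And>b. g b ?x = frechet_derivative (u \<circ> chart_inv c) (at ?x) b"
      by (rule hadamard[OF open_ball convex_ball xB uB]) (rule that; assumption)
    have sg: "smooth_on A V (\<lambda>z. g b (snd c z))" for b
    proof -
      have "snd c (chart_inv c x) = x" if "x \<in> ?B" for x
        using chart_inv_right[OF c(1), of x] V(5) VU that by blast
      then have "Cinf_on ?B ((\<lambda>z. g b (snd c z)) \<circ> chart_inv c) \<longleftrightarrow> Cinf_on ?B (g b)"
        by (intro Cinf_on_cong) (simp_all only: o_apply open_ball)
      then show ?thesis using smooth_on_chartI[OF c(1) V(3) VU] g(1) V(5) by simp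
    qed
    have "\<forall>b. \<exists>G U. smooth A G \<and> open U \<and> q \<in> U \<and> U \<subseteq> V \<and> (\<forall>x\<in>U. G x = g b (snd c x))"
    proof
      fix b
      show "\<exists>G U. smooth A G \<and> open U \<and> q \<in> U \<and> U \<subseteq> V \<and> (\<forall>x\<in>U. G x = g b (snd c x))"
        by (rule smooth_extension[OF V(3) q sg[of b]]) blast
    qed
    then obtain G U where G: "\<And>b. smooth A (G b)" "\<And>b. open (U b)" "\<And>b. q \<in> U b" "\<And>b. U b \<subseteq> V"
      "\<And>b x. x \<in> U b \<Longrightarrow> G b x = g b (snd c x)" by metis
    have "v u = v (\<lambda>z. u q + (\<Sum>b\<in>Basis. (y b z - y b q) * G b z))"
    proof (rule tangent_local[OF v u])
      show "smooth A (\<lambda>z. u q + (\<Sum>b\<in>Basis. (y b z - y b q) * G b z))"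
        using y G by auto
      show "open (V \<inter> (\<Inter>b\<in>Basis. U b))" using V(3) G(2) by (intro open_Int open_INT) auto
      show "q \<in> V \<inter> (\<Inter>b\<in>Basis. U b)" using q G(3) by auto
      fix z assume z: "z \<in> V \<inter> (\<Inter>b\<in>Basis. U b)"
      then have "snd c z \<in> ?B" using V(5) by blast
      then have "u z = u q + (\<Sum>b\<in>Basis. ((snd c z - ?x) \<bullet> b) * g b (snd c z))"
        using g(2)[of "snd c z"] chart_inv_left[OF c(1) subsetD[OF VU q]]
          chart_inv_left[OF c(1) subsetD[OF VU, of z]] z by (simp del: mem_ball)
      moreover have "((snd c z - ?x) \<bullet> b) * g b (snd c z) = (y b z - y b q) * G b z" if "b \<in> Basis" for b
        using z q yc G(5) that by (simp add: inner_diff_left)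
      ultimately show "u z = u q + (\<Sum>b\<in>Basis. (y b z - y b q) * G b z)" by simp
    qed
    also have "\<dots> = (\<Sum>b\<in>Basis. v (\<lambda>z. (y b z - y b q) * G b z))"
      using y G by (simp add: tangent_add[OF v] tangent_const[OF v] tangent_sum[OF v])
    also have "\<dots> = (\<Sum>b\<in>Basis. v (y b) * G b q)"
      using y G by (simp add: tangent_mult[OF v] tangent_diff[OF v] tangent_const[OF v])
    also have "\<dots> = (\<Sum>b\<in>Basis. v (y b) * Y b q u)"
      using G(3,5) g(3) Yc[OF q] u by (simp add: coord_vector_def)
    finally show ?thesis .
  qed
  have "local_frame V y Y"
    unfolding local_frame_def using V(3) y Y expand dual by blast
  then show ?thesis using that[OF V] Yc yc by blast
qed

end

section \<open>Tensoriality and the exterior derivative\<close>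

context smooth_manifold
begin

lemma frame_at: obtains V y Y where "p \<in> V" "local_frame V y Y"
proof -
  obtain c where "c \<in> A" "p \<in> fst c" using chart_at .
  then show ?thesis by (rule chart_frame[OF _ _ open_UNIV UNIV_I]) (rule that; assumption)
qed

lemma local_frameD:
  assumes "local_frame V y Y"
  shows "open V" "smooth A (y b)" "Y b \<in> vector_fields A"
    and "q \<in> V \<Longrightarrow> v \<in> tangent_space A q \<Longrightarrow> v u = (\<Sum>b\<in>Basis. v (y b) * Y b q u)"
    and "q \<in> V \<Longrightarrow> b \<in> Basis \<Longrightarrow> d \<in> Basis \<Longrightarrow> Y b q (y d) = (if b = d then 1 else 0)"
  using assms unfolding local_frame_def by blast+

lemma extend_tangent:
  assumes "v \<in> tangent_space A p"
  shows "\<exists>X\<in>vector_fields A. X p = v"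
proof -
  obtain V y Y where F: "p \<in> V" "local_frame V y Y" using frame_at .
  have "vf_scale (\<lambda>_. v (y b)) (Y b) \<in> vector_fields A" for b
    using local_frameD[OF F(2)] by simp
  then have "(\<lambda>q u. \<Sum>b\<in>Basis. vf_scale (\<lambda>_. v (y b)) (Y b) q u) \<in> vector_fields A"
    by (rule vf_sum)
  moreover have "(\<lambda>u. \<Sum>b\<in>Basis. vf_scale (\<lambda>_. v (y b)) (Y b) p u) = v"
    by (rule ext) (simp only: vf_scale_def local_frameD(4)[OF F(2,1) assms, symmetric])
  ultimately show ?thesis by fastforce
qed

lemma extend_vector:
  assumes "v \<in> tangent_space A p"
  shows "extend_vector A p v \<in> vector_fields A" "extend_vector A p v p = v"
  using someI_ex[of "\<lambda>X. X \<in> vector_fields A \<and> X p = v"] extend_tangent[OF assms]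
  unfolding extend_vector_def by blast+

text \<open>
  Near \<open>p\<close> a field is a combination of frame fields, whose coefficients can be cut off. Hence an
  additive map that pulls out functions only sees the values of these coefficients at \<open>p\<close>.
\<close>

lemma tensorial:
  fixes \<Phi> :: "'m vector_field \<Rightarrow> 'b::real_vector"
  assumes add: "\<And>X Y. X \<in> vector_fields A \<Longrightarrow> Y \<in> vector_fields A \<Longrightarrow> \<Phi> (vf_add X Y) = \<Phi> X + \<Phi> Y"
    and scale: "\<And>f X. smooth A f \<Longrightarrow> X \<in> vector_fields A \<Longrightarrow> \<Phi> (vf_scale f X) = f p *\<^sub>R \<Phi> X"
    and X: "X \<in> vector_fields A" "X' \<in> vector_fields A" "X p = X' p"
  shows "\<Phi> X = \<Phi> X'"
proof -
  obtain V y Y where F: "p \<in> V" "local_frame V y Y" using frame_at .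
  note F' = local_frameD[OF F(2)]
  obtain c where c: "c \<in> A" "p \<in> fst c" using chart_at .
  obtain r \<psi> K V' where \<psi>: "p \<in> V'" "K \<subseteq> V" "smooth A \<psi>"
    "\<And>x. x \<in> V' \<Longrightarrow> \<psi> x = (1::real)" "\<And>x. x \<notin> K \<Longrightarrow> \<psi> x = 0"
    using chart_cutoff[OF c F'(1) F(1)] by metis
  have zero: "\<Phi> (\<lambda>_ _. 0) = 0"
    using scale[of "\<lambda>_. 0" X] X by (simp add: vf_scale_def)
  have sum: "\<Phi> (\<lambda>q u. \<Sum>b\<in>I. Z b q u) = (\<Sum>b\<in>I. \<Phi> (Z b))"
    if "finite I" "\<And>b. Z b \<in> vector_fields A" for I and Z :: "'e \<Rightarrow> 'm vector_field"
    using that(1)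
  proof (induction I rule: finite_induct)
    case (insert i I)
    have "(\<lambda>q u. \<Sum>b\<in>insert i I. Z b q u) = vf_add (Z i) (\<lambda>q u. \<Sum>b\<in>I. Z b q u)"
      using insert by (simp add: vf_add_def)
    moreover have "(\<lambda>q u. \<Sum>b\<in>I. Z b q u) \<in> vector_fields A" by (rule vf_sum) (rule that(2))
    ultimately show ?case using insert add[OF that(2), of "\<lambda>q u. \<Sum>b\<in>I. Z b q u" i] by simp
  qed (simp add: zero)
  have "\<Phi> Z = (\<Sum>b\<in>Basis. Z p (y b) *\<^sub>R \<Phi> (Y b))" if Z: "Z \<in> vector_fields A" for Z
  proof -
    let ?Z = "\<lambda>b. vf_scale (\<lambda>q. \<psi> q * Z q (y b)) (Y b)"
    have s: "smooth A (\<lambda>q. \<psi> q * Z q (y b))" for b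
      using \<psi>(3) Z F'(2) by simp
    have "vf_scale \<psi> Z = (\<lambda>q u. \<Sum>b\<in>Basis. ?Z b q u)"
    proof (intro ext)
      fix q u
      show "vf_scale \<psi> Z q u = (\<Sum>b\<in>Basis. ?Z b q u)"
      proof (cases "q \<in> V")
        case True
        show ?thesis
          unfolding vf_scale_def F'(4)[OF True vf_tangent[OF Z], of u]
          by (simp add: sum_distrib_left mult.assoc)
      next
        case False
        then have "\<psi> q = 0" using \<psi>(2,5) by blast
        then show ?thesis by (simp add: vf_scale_def)
      qed
    qed
    then have "\<Phi> (vf_scale \<psi> Z) = (\<Sum>b\<in>Basis. \<Phi> (?Z b))"
      using sum[of Basis ?Z] s F'(3) by simp
    then show ?thesis using scale[OF \<psi>(3) Z] scale[OF s F'(3)] \<psi>(1,4) by simp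
  qed
  then show ?thesis using X by simp
qed

lemma one_form_add:
  "\<eta> \<in> one_forms A \<Longrightarrow> v \<in> tangent_space A p \<Longrightarrow> w \<in> tangent_space A p \<Longrightarrow>
    \<eta> p (\<lambda>u. v u + w u) = \<eta> p v + \<eta> p w"
  unfolding one_forms_def by blast

lemma one_form_scale:
  "\<eta> \<in> one_forms A \<Longrightarrow> v \<in> tangent_space A p \<Longrightarrow> \<eta> p (\<lambda>u. k * v u) = k * \<eta> p v"
  unfolding one_forms_def by blast

lemma one_form_smooth [simp]:
  "\<eta> \<in> one_forms A \<Longrightarrow> X \<in> vector_fields A \<Longrightarrow> smooth A (\<lambda>p. \<eta> p (X p))"
  unfolding one_forms_def by blast

lemma one_form_zero: "\<eta> \<in> one_forms A \<Longrightarrow> \<eta> p (\<lambda>_. 0) = 0"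
  using one_form_scale[of \<eta> "\<lambda>_. 0" p 0] tangent_zero by simp

lemma one_form_lincomb:
  assumes "\<eta> \<in> one_forms A" "v \<in> tangent_space A p" "w \<in> tangent_space A p"
  shows "\<eta> p (\<lambda>u. a * v u + b * w u) = a * \<eta> p v + b * \<eta> p w"
  using one_form_add[OF assms(1) tangent_space_scale[OF assms(2)] tangent_space_scale[OF assms(3)]]
    one_form_scale[OF assms(1,2)] one_form_scale[OF assms(1,3)] by simp

lemma differential_one_form: "smooth A f \<Longrightarrow> differential f \<in> one_forms A"
  unfolding one_forms_def differential_def by simp

lemma vf_nonsmooth: "X \<in> vector_fields A \<Longrightarrow> \<not> smooth A u \<Longrightarrow> X p u = 0"
  using tangent_nonsmooth[OF vf_tangent] by blast

lemma lie_bracket_antisym: "lie_bracket Y X p u = - lie_bracket X Y p u"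
  by (simp add: lie_bracket_def)

lemma lie_bracket_add:
  assumes X: "X \<in> vector_fields A" "X' \<in> vector_fields A" and Y: "Y \<in> vector_fields A"
  shows "lie_bracket (vf_add X X') Y p = (\<lambda>u. lie_bracket X Y p u + lie_bracket X' Y p u)"
proof
  fix u
  show "lie_bracket (vf_add X X') Y p u = lie_bracket X Y p u + lie_bracket X' Y p u"
    using X Y by (cases "smooth A u")
      (simp_all add: lie_bracket_def vf_add_def vf_derivation[OF Y] vf_derivation[OF X(1)]
        vf_derivation[OF X(2)] vf_nonsmooth)
qed

lemma lie_bracket_scale:
  assumes X: "X \<in> vector_fields A" and Y: "Y \<in> vector_fields A" and f: "smooth A f"
  shows "lie_bracket (vf_scale f X) Y p = (\<lambda>u. f p * lie_bracket X Y p u + (- Y p f) * X p u)"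
proof
  fix u
  show "lie_bracket (vf_scale f X) Y p u = f p * lie_bracket X Y p u + (- Y p f) * X p u"
    using X Y f by (cases "smooth A u")
      (simp_all add: lie_bracket_def vf_scale_def vf_derivation[OF Y] vf_derivation[OF X]
        vf_nonsmooth algebra_simps)
qed

lemma lie_bracket_jacobi:
  assumes X: "X \<in> vector_fields A" and Y: "Y \<in> vector_fields A" and Z: "Z \<in> vector_fields A"
  shows "lie_bracket X (lie_bracket Y Z) p u
    = lie_bracket (lie_bracket X Y) Z p u + lie_bracket Y (lie_bracket X Z) p u"
  using X Y Z by (cases "smooth A u")
    (simp_all add: lie_bracket_def vf_derivation[OF Y] vf_derivation[OF X] vf_derivation[OF Z]
      vf_nonsmooth)

text \<open>
  The exterior derivative as a function of vector fields. Function-linearity in both arguments makes it agree with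
  \<open>ext_deriv\<close> for whatever extensions that chooses.
\<close>

definition dform :: "'m one_form \<Rightarrow> 'm vector_field \<Rightarrow> 'm vector_field \<Rightarrow> 'm \<Rightarrow> real" where
  "dform \<eta> X Y p = X p (\<lambda>q. \<eta> q (Y q)) - Y p (\<lambda>q. \<eta> q (X q)) - \<eta> p (lie_bracket X Y p)"

lemma dform_antisym:
  assumes \<eta>: "\<eta> \<in> one_forms A" and X: "X \<in> vector_fields A" and Y: "Y \<in> vector_fields A"
  shows "dform \<eta> Y X p = - dform \<eta> X Y p"
proof -
  have "lie_bracket Y X p = (\<lambda>u. (- 1) * lie_bracket X Y p u)"
    by (simp add: lie_bracket_antisym[of Y X] fun_eq_iff)
  then have "\<eta> p (lie_bracket Y X p) = - \<eta> p (lie_bracket X Y p)"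
    using one_form_scale[OF \<eta> vf_tangent[OF vf_lie_bracket[OF X Y]], of p "-1"] by simp
  then show ?thesis by (simp add: dform_def)
qed

lemma dform_add:
  assumes \<eta>: "\<eta> \<in> one_forms A" and X: "X \<in> vector_fields A" "X' \<in> vector_fields A"
    and Y: "Y \<in> vector_fields A"
  shows "dform \<eta> (vf_add X X') Y p = dform \<eta> X Y p + dform \<eta> X' Y p"
proof -
  have "\<eta> q (vf_add X X' q) = \<eta> q (X q) + \<eta> q (X' q)" for q
    using one_form_add[OF \<eta> vf_tangent[OF X(1)] vf_tangent[OF X(2)]] by (simp add: vf_add_def)
  moreover have "\<eta> p (lie_bracket (vf_add X X') Y p) = \<eta> p (lie_bracket X Y p) + \<eta> p (lie_bracket X' Y p)"
    unfolding lie_bracket_add[OF X Y]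
    by (rule one_form_add[OF \<eta>]) (use X Y vf_tangent in auto)
  ultimately show ?thesis
    using X Y \<eta> by (simp add: dform_def vf_derivation[OF Y]) (simp add: vf_add_def)
qed

lemma dform_scale:
  assumes \<eta>: "\<eta> \<in> one_forms A" and X: "X \<in> vector_fields A"
    and Y: "Y \<in> vector_fields A" and f: "smooth A f"
  shows "dform \<eta> (vf_scale f X) Y p = f p * dform \<eta> X Y p"
proof -
  have "\<eta> q (vf_scale f X q) = f q * \<eta> q (X q)" for q
    using one_form_scale[OF \<eta> vf_tangent[OF X]] by (simp add: vf_scale_def)
  moreover have "\<eta> p (lie_bracket (vf_scale f X) Y p) = f p * \<eta> p (lie_bracket X Y p) + (- Y p f) * \<eta> p (X p)"
    unfolding lie_bracket_scale[OF X Y f]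
    by (rule one_form_lincomb[OF \<eta>]) (use X Y vf_tangent in auto)
  ultimately show ?thesis
    using X Y \<eta> f by (simp add: dform_def vf_derivation[OF Y]) (simp add: vf_scale_def algebra_simps)
qed

lemma dform_cong:
  assumes \<eta>: "\<eta> \<in> one_forms A" and X: "X \<in> vector_fields A" "X' \<in> vector_fields A" "X p = X' p"
    and Y: "Y \<in> vector_fields A"
  shows "dform \<eta> X Y p = dform \<eta> X' Y p"
  by (rule tensorial[where \<Phi> = "\<lambda>X. dform \<eta> X Y p", OF _ _ X])
    (simp_all add: dform_add[OF \<eta> _ _ Y] dform_scale[OF \<eta> _ Y])

lemma ext_deriv_dform:
  assumes \<eta>: "\<eta> \<in> one_forms A" and X: "X \<in> vector_fields A" and Y: "Y \<in> vector_fields A"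
  shows "ext_deriv A \<eta> p (X p) (Y p) = dform \<eta> X Y p"
proof -
  note eX = extend_vector[OF vf_tangent[OF X, of p]] and eY = extend_vector[OF vf_tangent[OF Y, of p]]
  have "ext_deriv A \<eta> p (X p) (Y p) = dform \<eta> (extend_vector A p (X p)) (extend_vector A p (Y p)) p"
    by (simp add: ext_deriv_def dform_def Let_def)
  also have "\<dots> = dform \<eta> X (extend_vector A p (Y p)) p"
    using dform_cong[OF \<eta> eX(1) X eX(2) eY(1)] .
  also have "\<dots> = - dform \<eta> (extend_vector A p (Y p)) X p"
    using dform_antisym[OF \<eta> eY(1) X] by simp
  also have "\<dots> = dform \<eta> X Y p"
    using dform_cong[OF \<eta> eY(1) Y eY(2) X] dform_antisym[OF \<eta> Y X] by simp
  finally show ?thesis .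
qed

lemma dform_smooth [simp]:
  "\<eta> \<in> one_forms A \<Longrightarrow> X \<in> vector_fields A \<Longrightarrow> Y \<in> vector_fields A \<Longrightarrow> smooth A (dform \<eta> X Y)"
  unfolding dform_def[abs_def] by simp

lemma ext_deriv_antisym:
  assumes "\<eta> \<in> one_forms A" "v \<in> tangent_space A p" "w \<in> tangent_space A p"
  shows "ext_deriv A \<eta> p w v = - ext_deriv A \<eta> p v w"
proof -
  obtain X Y where "X \<in> vector_fields A" "X p = v" "Y \<in> vector_fields A" "Y p = w"
    using extend_tangent assms by metis
  then show ?thesis
    using ext_deriv_dform[OF assms(1)] dform_antisym[OF assms(1), of X Y p] by metis
qed

lemma ext_deriv_lincomb:
  assumes "\<eta> \<in> one_forms A" "v \<in> tangent_space A p" "v' \<in> tangent_space A p" "w \<in> tangent_space A p"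
  shows "ext_deriv A \<eta> p (\<lambda>u. a * v u + b * v' u) w = a * ext_deriv A \<eta> p v w + b * ext_deriv A \<eta> p v' w"
    and "ext_deriv A \<eta> p w (\<lambda>u. a * v u + b * v' u) = a * ext_deriv A \<eta> p w v + b * ext_deriv A \<eta> p w v'"
proof -
  obtain X X' Y where X: "X \<in> vector_fields A" "X p = v" "X' \<in> vector_fields A" "X' p = v'"
    "Y \<in> vector_fields A" "Y p = w"
    using extend_tangent assms by metis
  let ?Z = "vf_add (vf_scale (\<lambda>_. a) X) (vf_scale (\<lambda>_. b) X')"
  have "?Z \<in> vector_fields A" "?Z p = (\<lambda>u. a * v u + b * v' u)"
    using X by (simp_all, simp add: vf_add_def vf_scale_def)
  note Z = this
  have "dform \<eta> ?Z Y p = a * dform \<eta> X Y p + b * dform \<eta> X' Y p"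
    using X assms(1) by (simp add: dform_add dform_scale)
  then show 1: "ext_deriv A \<eta> p (\<lambda>u. a * v u + b * v' u) w = a * ext_deriv A \<eta> p v w + b * ext_deriv A \<eta> p v' w"
    using X Z(2) ext_deriv_dform[OF assms(1) Z(1) X(5), of p] ext_deriv_dform[OF assms(1) X(1,5), of p]
      ext_deriv_dform[OF assms(1) X(3,5), of p] by simp
  have "(\<lambda>u. a * v u + b * v' u) \<in> tangent_space A p"
    using assms by (intro tangent_space_add tangent_space_scale)
  then show "ext_deriv A \<eta> p w (\<lambda>u. a * v u + b * v' u) = a * ext_deriv A \<eta> p w v + b * ext_deriv A \<eta> p w v'"
    using 1 ext_deriv_antisym[OF assms(1), of _ p w] assms by (simp add: algebra_simps)
qed

text \<open>
  The identity \<open>d(d\<eta>) = 0\<close>: the iterated derivatives cancel in pairs, and the double brackets add up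
  to zero by the Jacobi identity.
\<close>

lemma dform_closed:
  assumes \<eta>: "\<eta> \<in> one_forms A" and X: "X \<in> vector_fields A" and Y: "Y \<in> vector_fields A"
    and Z: "Z \<in> vector_fields A"
  shows "X p (dform \<eta> Y Z) + Y p (dform \<eta> Z X) + Z p (dform \<eta> X Y)
    = dform \<eta> (lie_bracket X Y) Z p + dform \<eta> (lie_bracket Y Z) X p + dform \<eta> (lie_bracket Z X) Y p"
proof -
  note b = vf_lie_bracket[OF X Y] vf_lie_bracket[OF Y Z] vf_lie_bracket[OF Z X]
  let ?a = "lie_bracket (lie_bracket X Y) Z p" and ?b = "lie_bracket (lie_bracket Y Z) X p"
    and ?c = "lie_bracket (lie_bracket Z X) Y p"
  have t: "?a \<in> tangent_space A p" "?b \<in> tangent_space A p" "?c \<in> tangent_space A p"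
    using X Y Z by (auto intro: vf_tangent)
  have "?a u + ?b u + ?c u = 0" for u
    using X Y Z by (cases "smooth A u")
      (simp_all add: lie_bracket_def vf_derivation[OF Y] vf_derivation[OF X] vf_derivation[OF Z]
        vf_nonsmooth)
  then have "(\<lambda>u. (\<lambda>u. ?a u + ?b u) u + ?c u) = (\<lambda>_. 0)" by simp
  then have J: "\<eta> p ?a + \<eta> p ?b + \<eta> p ?c = 0"
    using one_form_add[OF \<eta> tangent_space_add[OF t(1,2)] t(3)] one_form_add[OF \<eta> t(1,2)]
      one_form_zero[OF \<eta>] by simp
  have w: "W p (dform \<eta> U V) = W p (\<lambda>q. U q (\<lambda>q. \<eta> q (V q))) - W p (\<lambda>q. V q (\<lambda>q. \<eta> q (U q)))
      - W p (\<lambda>q. \<eta> q (lie_bracket U V q))"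
    if "W \<in> vector_fields A" "U \<in> vector_fields A" "V \<in> vector_fields A" for U V W
    unfolding dform_def[abs_def] using that \<eta> by (simp add: vf_derivation[OF that(1)])
  have l: "lie_bracket U V p (\<lambda>q. \<eta> q (W q)) = U p (\<lambda>q. V q (\<lambda>q. \<eta> q (W q))) - V p (\<lambda>q. U q (\<lambda>q. \<eta> q (W q)))" for U V W
    by (simp add: lie_bracket_def)
  show ?thesis
    unfolding dform_def w[OF X Y Z] w[OF Y Z X] w[OF Z X Y] l using J by linarith
qed

text \<open>The Lie derivative of \<open>\<eta>\<close> along \<open>X\<close> is \<open>Y \<mapsto> X(\<eta>(Y)) - \<eta>([X, Y])\<close>.\<close>

definition preserves :: "'m vector_field \<Rightarrow> 'm one_form \<Rightarrow> bool" where
  "preserves X \<eta> \<longleftrightarrow> X \<in> vector_fields A \<and>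
     (\<forall>Y\<in>vector_fields A. \<forall>p. X p (\<lambda>q. \<eta> q (Y q)) = \<eta> p (lie_bracket X Y p))"

text \<open>The Lie derivative commutes with the exterior derivative, so \<open>X\<close> preserves \<open>d\<eta>\<close> as well.\<close>

lemma preserves_dform:
  assumes \<eta>: "\<eta> \<in> one_forms A" and inv: "preserves X \<eta>" and Y: "Y \<in> vector_fields A"
    and Z: "Z \<in> vector_fields A"
  shows "X p (dform \<eta> Y Z) = dform \<eta> (lie_bracket X Y) Z p + dform \<eta> Y (lie_bracket X Z) p"
proof -
  have X: "X \<in> vector_fields A" using inv by (simp add: preserves_def)
  have i: "X p (\<lambda>q. \<eta> q (W q)) = \<eta> p (lie_bracket X W p)" if "W \<in> vector_fields A" for W p
    using inv that by (simp add: preserves_def)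
  let ?a = "lie_bracket (lie_bracket X Y) Z p" and ?b = "lie_bracket Y (lie_bracket X Z) p"
  have "lie_bracket X (lie_bracket Y Z) p = (\<lambda>u. ?a u + ?b u)"
    using lie_bracket_jacobi[OF X Y Z] by blast
  then have "\<eta> p (lie_bracket X (lie_bracket Y Z) p) = \<eta> p ?a + \<eta> p ?b"
    using one_form_add[OF \<eta>, of ?a p ?b] X Y Z vf_tangent by simp
  moreover have "X p (dform \<eta> Y Z) = X p (\<lambda>q. Y q (\<lambda>q. \<eta> q (Z q))) - X p (\<lambda>q. Z q (\<lambda>q. \<eta> q (Y q)))
      - X p (\<lambda>q. \<eta> q (lie_bracket Y Z q))"
    unfolding dform_def[abs_def] using X Y Z \<eta> by (simp add: vf_derivation[OF X])
  moreover have "lie_bracket X Y p (\<lambda>q. \<eta> q (Z q)) = X p (\<lambda>q. Y q (\<lambda>q. \<eta> q (Z q))) - Y p (\<lambda>q. \<eta> q (lie_bracket X Z q))"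
    unfolding lie_bracket_def[of X Y] by (simp add: i[OF Z])
  moreover have "lie_bracket X Z p (\<lambda>q. \<eta> q (Y q)) = X p (\<lambda>q. Z q (\<lambda>q. \<eta> q (Y q))) - Z p (\<lambda>q. \<eta> q (lie_bracket X Y q))"
    unfolding lie_bracket_def[of X Z] by (simp add: i[OF Y])
  ultimately show ?thesis
    using i[OF vf_lie_bracket[OF Y Z], of p] by (simp add: dform_def)
qed

end

section \<open>Hamiltonian vector fields on a contact manifold\<close>

locale contact_manifold = smooth_manifold A
  for A :: "('m::t2_space, 'e::euclidean_space) chart set" +
  fixes \<theta> :: "'m one_form" and \<xi> :: "'m vector_field" and \<Lambda> :: "'m one_form \<Rightarrow> 'm vector_field"
  assumes \<theta>: "\<theta> \<in> one_forms A" and reeb: "reeb_field A \<theta> \<xi>" and sharp: "sharp_map A \<theta> \<xi> \<Lambda>"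
begin

abbreviation d\<theta> :: "'m \<Rightarrow> 'm tangent \<Rightarrow> 'm tangent \<Rightarrow> real" where
  "d\<theta> \<equiv> ext_deriv A \<theta>"

abbreviation ham :: "('m \<Rightarrow> real) \<Rightarrow> 'm vector_field" where
  "ham \<equiv> hamiltonian_field \<Lambda> \<xi>"

lemma reeb_vf [simp]: "\<xi> \<in> vector_fields A"
  and \<theta>_reeb: "\<theta> p (\<xi> p) = 1"
  and d\<theta>_reeb: "w \<in> tangent_space A p \<Longrightarrow> d\<theta> p (\<xi> p) w = 0"
  using reeb unfolding reeb_field_def by blast+

lemma \<theta>_lincomb:
  "v \<in> tangent_space A p \<Longrightarrow> w \<in> tangent_space A p \<Longrightarrow>
    \<theta> p (\<lambda>u. a * v u + b * w u) = a * \<theta> p v + b * \<theta> p w"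
  by (rule one_form_lincomb[OF \<theta>])

text \<open>
  Nondegeneracy of \<open>d\<theta>\<close> on \<open>ker \<theta>\<close>: such a vector is annihilated by all differentials, since
  \<open>\<Lambda>\<close> realises every differential by contraction of \<open>d\<theta>\<close> up to a multiple of \<open>\<theta>\<close>.
\<close>

lemma d\<theta>_nondegenerate:
  assumes v: "v \<in> tangent_space A p" and "\<theta> p v = 0" "\<And>w. w \<in> tangent_space A p \<Longrightarrow> d\<theta> p v w = 0"
  shows "v = (\<lambda>_. 0)"
proof
  fix u
  show "v u = 0"
  proof (cases "smooth A u")
    case True
    then have \<eta>: "differential u \<in> one_forms A" by (rule differential_one_form)
    let ?Z = "\<Lambda> (differential u)"
    have Z: "?Z p \<in> tangent_space A p" using sharp \<eta> vf_tangent unfolding sharp_map_def by blast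
    have "d\<theta> p (?Z p) v = \<xi> p u * \<theta> p v - v u"
      using sharp \<eta> v unfolding sharp_map_def differential_def by blast
    moreover have "d\<theta> p (?Z p) v = 0" using ext_deriv_antisym[OF \<theta> v Z] assms(3)[OF Z] by simp
    ultimately show ?thesis using assms(2) by simp
  qed (rule tangent_nonsmooth[OF v])
qed

lemma tangent_eqI:
  assumes v: "v \<in> tangent_space A p" and w: "w \<in> tangent_space A p" and "\<theta> p v = \<theta> p w"
    and "\<And>z. z \<in> tangent_space A p \<Longrightarrow> d\<theta> p v z = d\<theta> p w z"
  shows "v = w"
proof -
  have "(\<lambda>u. 1 * v u + (-1) * w u) = (\<lambda>_. 0)"
  proof (rule d\<theta>_nondegenerate)
    show "(\<lambda>u. 1 * v u + (-1) * w u) \<in> tangent_space A p"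
      using v w by (intro tangent_space_add tangent_space_scale)
    show "\<theta> p (\<lambda>u. 1 * v u + (-1) * w u) = 0"
      using \<theta>_lincomb[OF v w, of 1 "-1"] assms(3) by simp
    show "d\<theta> p (\<lambda>u. 1 * v u + (-1) * w u) z = 0" if "z \<in> tangent_space A p" for z
      using ext_deriv_lincomb(1)[OF \<theta> v w that, of 1 "-1"] assms(4)[OF that] by simp
  qed
  then have "v u = w u" for u by (metis add_uminus_conv_diff eq_iff_diff_eq_0 mult_1 mult_minus1)
  then show ?thesis by blast
qed

lemma ham_at: "ham f p = (\<lambda>u. 1 * \<Lambda> (differential f) p u + f p * \<xi> p u)"
  by (simp add: hamiltonian_field_def vf_add_def vf_scale_def)

lemma sharp_differential:
  assumes "smooth A f"
  shows "\<Lambda> (differential f) \<in> vector_fields A" "\<theta> p (\<Lambda> (differential f) p) = 0"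
    "w \<in> tangent_space A p \<Longrightarrow> d\<theta> p (\<Lambda> (differential f) p) w = \<xi> p f * \<theta> p w - w f"
  using sharp differential_one_form[OF assms] unfolding sharp_map_def differential_def by blast+

lemma ham_vf [simp]: "smooth A f \<Longrightarrow> ham f \<in> vector_fields A"
  unfolding hamiltonian_field_def by (simp add: sharp_differential)

lemma \<theta>_ham: "smooth A f \<Longrightarrow> \<theta> p (ham f p) = f p"
  unfolding ham_at
  by (subst \<theta>_lincomb) (simp_all add: vf_tangent sharp_differential \<theta>_reeb)

lemma d\<theta>_ham:
  "smooth A f \<Longrightarrow> w \<in> tangent_space A p \<Longrightarrow> d\<theta> p (ham f p) w = \<xi> p f * \<theta> p w - w f"
  unfolding ham_at
  by (subst ext_deriv_lincomb(1)[OF \<theta>]) (simp_all add: vf_tangent sharp_differential d\<theta>_reeb)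

lemma basicD: "f \<in> basic_functions A \<xi> \<Longrightarrow> smooth A f" "f \<in> basic_functions A \<xi> \<Longrightarrow> \<xi> p f = 0"
  unfolding basic_functions_def by blast+

lemma d\<theta>_ham_basic:
  "f \<in> basic_functions A \<xi> \<Longrightarrow> w \<in> tangent_space A p \<Longrightarrow> d\<theta> p (ham f p) w = - w f"
  using d\<theta>_ham basicD by simp

text \<open>
  For basic \<open>f\<close> the contraction of \<open>d\<theta>\<close> with \<open>X\<^sub>f\<close> is \<open>- df\<close>, which cancels the term \<open>d(\<theta>(X\<^sub>f)) = df\<close> in the
  Lie derivative.
\<close>

lemma ham_preserves:
  assumes f: "f \<in> basic_functions A \<xi>"
  shows "preserves (ham f) \<theta>"
  unfolding preserves_def
proof (intro conjI ballI allI)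
  show X: "ham f \<in> vector_fields A" using basicD f by simp
  fix Y p assume Y: "Y \<in> vector_fields A"
  have "dform \<theta> (ham f) Y p = - Y p f"
    using ext_deriv_dform[OF \<theta> X Y] d\<theta>_ham_basic[OF f vf_tangent[OF Y]] by metis
  then show "ham f p (\<lambda>q. \<theta> q (Y q)) = \<theta> p (lie_bracket (ham f) Y p)"
    using basicD(1)[OF f] by (simp add: dform_def \<theta>_ham)
qed

lemma reeb_preserves: "preserves \<xi> \<theta>"
  unfolding preserves_def
proof (intro conjI ballI allI)
  fix Y p assume Y: "Y \<in> vector_fields A"
  have "dform \<theta> \<xi> Y p = 0"
    using ext_deriv_dform[OF \<theta> reeb_vf Y] d\<theta>_reeb[OF vf_tangent[OF Y]] by metis
  then show "\<xi> p (\<lambda>q. \<theta> q (Y q)) = \<theta> p (lie_bracket \<xi> Y p)"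
    by (simp add: dform_def \<theta>_reeb tangent_const[OF vf_tangent[OF Y]])
qed simp

lemma jacobi_bracket_basic:
  "f \<in> basic_functions A \<xi> \<Longrightarrow> jacobi_bracket \<Lambda> \<xi> f g = (\<lambda>p. ham f p g)"
  unfolding jacobi_bracket_def using basicD by simp

lemma dform_ham_ham:
  assumes f: "f \<in> basic_functions A \<xi>" and g: "g \<in> basic_functions A \<xi>"
  shows "dform \<theta> (ham f) (ham g) p = ham f p g" "ham g p f = - ham f p g"
proof -
  note X = ham_vf[OF basicD(1)[OF f]] ham_vf[OF basicD(1)[OF g]]
  have 1: "dform \<theta> (ham f) (ham g) p = - ham g p f"
    using ext_deriv_dform[OF \<theta> X] d\<theta>_ham_basic[OF f vf_tangent[OF X(2)]] by metis
  have 2: "dform \<theta> (ham g) (ham f) p = - ham f p g"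
    using ext_deriv_dform[OF \<theta> X(2,1)] d\<theta>_ham_basic[OF g vf_tangent[OF X(1)]] by metis
  show "dform \<theta> (ham f) (ham g) p = ham f p g" "ham g p f = - ham f p g"
    using 1 2 dform_antisym[OF \<theta> X, of p] by simp_all
qed

text \<open>
  The Reeb flow preserves \<open>d\<theta>\<close>, and \<open>{f,g} = d\<theta>(X\<^sub>f, X\<^sub>g)\<close>. The product rule for
  \<open>\<xi> \<cdot> d\<theta>(X\<^sub>f, X\<^sub>g)\<close> has two terms, and each of them equals \<open>\<xi> \<cdot> {f,g}\<close>; so \<open>\<xi> \<cdot> {f,g} = 2 \<xi> \<cdot> {f,g}\<close>.
\<close>

lemma jacobi_bracket_closed:
  assumes f: "f \<in> basic_functions A \<xi>" and g: "g \<in> basic_functions A \<xi>"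
  shows "jacobi_bracket \<Lambda> \<xi> f g \<in> basic_functions A \<xi>"
proof -
  note s = basicD(1)[OF f] basicD(1)[OF g]
  note X = ham_vf[OF s(1)] ham_vf[OF s(2)]
  let ?k = "\<lambda>p. ham f p g"
  have "\<xi> p ?k = 0" for p
  proof -
    have "lie_bracket \<xi> (ham f) p g = \<xi> p ?k"
      using tangent_const[OF vf_tangent[OF X(1)]] basicD(2)[OF g] by (simp add: lie_bracket_def)
    moreover have "lie_bracket \<xi> (ham g) p f = - \<xi> p ?k"
      using tangent_const[OF vf_tangent[OF X(2)]] basicD(2)[OF f]
      by (simp add: lie_bracket_def dform_ham_ham(2)[OF f g] tangent_minus[OF vf_tangent[OF reeb_vf]] X s)
    moreover have "dform \<theta> (lie_bracket \<xi> (ham f)) (ham g) p = lie_bracket \<xi> (ham f) p g"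
    proof -
      have b: "lie_bracket \<xi> (ham f) \<in> vector_fields A" using X by simp
      show ?thesis
        using dform_antisym[OF \<theta> X(2) b, of p] ext_deriv_dform[OF \<theta> X(2) b, of p]
          d\<theta>_ham_basic[OF g vf_tangent[OF b, of p]] by simp
    qed
    moreover have "dform \<theta> (ham f) (lie_bracket \<xi> (ham g)) p = - lie_bracket \<xi> (ham g) p f"
    proof -
      have b: "lie_bracket \<xi> (ham g) \<in> vector_fields A" using X by simp
      show ?thesis
        using ext_deriv_dform[OF \<theta> X(1) b, of p] d\<theta>_ham_basic[OF f vf_tangent[OF b, of p]] by simp
    qed
    moreover have "dform \<theta> (ham f) (ham g) = ?k" using dform_ham_ham(1)[OF f g] by blast
    ultimately show ?thesis
      using preserves_dform[OF \<theta> reeb_preserves X, of p] by simp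
  qed
  then show ?thesis
    using X s by (simp add: jacobi_bracket_basic[OF f] basic_functions_def)
qed

text \<open>Both sides have the same image under \<open>\<theta>\<close> and under contraction with \<open>d\<theta>\<close>.\<close>

lemma lie_bracket_ham:
  assumes f: "f \<in> basic_functions A \<xi>" and g: "g \<in> basic_functions A \<xi>"
  shows "lie_bracket (ham f) (ham g) = ham (jacobi_bracket \<Lambda> \<xi> f g)"
proof
  fix p
  let ?k = "jacobi_bracket \<Lambda> \<xi> f g"
  note s = basicD(1)[OF f] basicD(1)[OF g]
  note X = ham_vf[OF s(1)] ham_vf[OF s(2)]
  note b = vf_lie_bracket[OF X]
  have k: "?k \<in> basic_functions A \<xi>" using jacobi_bracket_closed[OF f g] .
  show "lie_bracket (ham f) (ham g) p = ham ?k p"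
  proof (rule tangent_eqI)
    show "lie_bracket (ham f) (ham g) p \<in> tangent_space A p" using b by (rule vf_tangent)
    show "ham ?k p \<in> tangent_space A p" using basicD(1)[OF k] by (simp add: vf_tangent)
    have "\<theta> p (lie_bracket (ham f) (ham g) p) = ham f p (\<lambda>q. \<theta> q (ham g q))"
      using ham_preserves[OF f] X(2) unfolding preserves_def by simp
    then show "\<theta> p (lie_bracket (ham f) (ham g) p) = \<theta> p (ham ?k p)"
      using \<theta>_ham[OF s(2)] \<theta>_ham[OF basicD(1)[OF k]] by (simp add: jacobi_bracket_basic[OF f])
    fix w assume w: "w \<in> tangent_space A p"
    then obtain W where W: "W \<in> vector_fields A" "W p = w" using extend_tangent by blast
    have "dform \<theta> (ham g) W = (\<lambda>q. - W q g)"
      using ext_deriv_dform[OF \<theta> X(2) W(1)] d\<theta>_ham_basic[OF g vf_tangent[OF W(1)]] by metis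
    moreover have "dform \<theta> (ham g) (lie_bracket (ham f) W) p = - lie_bracket (ham f) W p g"
      using ext_deriv_dform[OF \<theta> X(2) vf_lie_bracket[OF X(1) W(1)]]
        d\<theta>_ham_basic[OF g vf_tangent[OF vf_lie_bracket[OF X(1) W(1)]]] by metis
    ultimately have "dform \<theta> (lie_bracket (ham f) (ham g)) W p = ham f p (\<lambda>q. - W q g) + lie_bracket (ham f) W p g"
      using preserves_dform[OF \<theta> ham_preserves[OF f] X(2) W(1), of p] by simp
    also have "\<dots> = - W p ?k"
      using X W s by (simp add: lie_bracket_def jacobi_bracket_basic[OF f] tangent_minus[OF vf_tangent[OF X(1)]])
    finally show "d\<theta> p (lie_bracket (ham f) (ham g) p) w = d\<theta> p (ham ?k p) w"
      using ext_deriv_dform[OF \<theta> b W(1), of p] d\<theta>_ham_basic[OF k w] W(2) by simp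
  qed
qed

text \<open>
  \<open>\<Lambda>\<close> is only known through the equations that it satisfies; they have a unique solution at each
  point, and this makes it linear.
\<close>

lemma ham_lincomb:
  assumes s: "smooth A f" "smooth A g"
  shows "ham (\<lambda>q. a * f q + b * g q) = vf_add (vf_scale (\<lambda>_. a) (ham f)) (vf_scale (\<lambda>_. b) (ham g))"
proof
  fix p
  have s': "smooth A (\<lambda>q. a * f q + b * g q)" using s by simp
  note t = vf_tangent[OF ham_vf[OF s(1)]] vf_tangent[OF ham_vf[OF s(2)]] vf_tangent[OF ham_vf[OF s']]
  have "ham (\<lambda>q. a * f q + b * g q) p = (\<lambda>u. a * ham f p u + b * ham g p u)"
  proof (rule tangent_eqI[OF t(3)])
    show "(\<lambda>u. a * ham f p u + b * ham g p u) \<in> tangent_space A p"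
      using t by (intro tangent_space_add tangent_space_scale)
    show "\<theta> p (ham (\<lambda>q. a * f q + b * g q) p) = \<theta> p (\<lambda>u. a * ham f p u + b * ham g p u)"
      using s s' by (simp add: \<theta>_lincomb[OF t(1,2)] \<theta>_ham)
    fix z assume z: "z \<in> tangent_space A p"
    have "v (\<lambda>q. a * f q + b * g q) = a * v f + b * v g" if "v \<in> tangent_space A p" for v
      using s by (simp add: tangent_add[OF that] tangent_cmult[OF that])
    note * = this[OF vf_tangent[OF reeb_vf]] this[OF z]
    show "d\<theta> p (ham (\<lambda>q. a * f q + b * g q) p) z = d\<theta> p (\<lambda>u. a * ham f p u + b * ham g p u) z"
      unfolding ext_deriv_lincomb(1)[OF \<theta> t(1,2) z] d\<theta>_ham[OF s(1) z] d\<theta>_ham[OF s(2) z]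
        d\<theta>_ham[OF s' z] * by (simp add: algebra_simps)
  qed
  then show "ham (\<lambda>q. a * f q + b * g q) p = vf_add (vf_scale (\<lambda>_. a) (ham f)) (vf_scale (\<lambda>_. b) (ham g)) p"
    by (simp add: vf_add_def vf_scale_def)
qed

lemma basic_lincomb:
  assumes "f \<in> basic_functions A \<xi>" "g \<in> basic_functions A \<xi>"
  shows "(\<lambda>p. a * f p + b * g p) \<in> basic_functions A \<xi>"
  using assms unfolding basic_functions_def
  by (simp add: tangent_add[OF vf_tangent[OF reeb_vf]] tangent_cmult[OF vf_tangent[OF reeb_vf]])

end

section \<open>Line bundles and the curvature form\<close>

locale line_bundle_connection = smooth_manifold A
  for A :: "('m::t2_space, 'e::euclidean_space) chart set" +
  fixes L :: "('m, 'l) line_bundle" and D :: "('m, 'l) covariant_derivative"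
  assumes lineb: "complex_line_bundle A L" and conn: "connection A L D"
begin

abbreviation S :: "('m, 'l) sect set" where "S \<equiv> smooth_sections A L"

lemma triv_props:
  assumes "T \<in> trivs L"
  shows "open (fst T)"
    "p \<in> fst T \<Longrightarrow> bij_betw (snd T) (fibre L p) UNIV"
    "p \<in> fst T \<Longrightarrow> l \<in> fibre L p \<Longrightarrow> l' \<in> fibre L p \<Longrightarrow> fadd L l l' \<in> fibre L p"
    "p \<in> fst T \<Longrightarrow> l \<in> fibre L p \<Longrightarrow> l' \<in> fibre L p \<Longrightarrow> snd T (fadd L l l') = snd T l + snd T l'"
    "p \<in> fst T \<Longrightarrow> l \<in> fibre L p \<Longrightarrow> fscale L k l \<in> fibre L p"
    "p \<in> fst T \<Longrightarrow> l \<in> fibre L p \<Longrightarrow> snd T (fscale L k l) = k * snd T l"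
  using lineb assms unfolding complex_line_bundle_def by (cases T; force)+

lemma triv_transition:
  "T \<in> trivs L \<Longrightarrow> T' \<in> trivs L \<Longrightarrow>
    smooth_on A (fst T \<inter> fst T') (\<lambda>p. snd T' (inv_into (fibre L p) (snd T) 1))"
  using lineb unfolding complex_line_bundle_def by (cases T; cases T'; force)

definition triv :: "'m \<Rightarrow> 'm set \<times> ('l \<Rightarrow> complex)" where
  "triv p = (SOME T. T \<in> trivs L \<and> p \<in> fst T)"

lemma triv: "triv p \<in> trivs L" "p \<in> fst (triv p)"
proof -
  have "(\<Union>(U, \<tau>)\<in>trivs L. U) = UNIV"
    using lineb unfolding complex_line_bundle_def by (rule conjunct1)
  then have "p \<in> (\<Union>(U, \<tau>)\<in>trivs L. U)" by simp
  then have "\<exists>T. T \<in> trivs L \<and> p \<in> fst T" by force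
  then have "triv p \<in> trivs L \<and> p \<in> fst (triv p)" unfolding triv_def by (rule someI_ex)
  then show "triv p \<in> trivs L" "p \<in> fst (triv p)" by auto
qed

text \<open>
  A linear coordinate on each fibre, chosen independently at each point. It turns identities
  between sections into identities between complex numbers.
\<close>

definition coo :: "'m \<Rightarrow> 'l \<Rightarrow> complex" where
  "coo p l = snd (triv p) l"

lemma coo_inj: "l \<in> fibre L p \<Longrightarrow> l' \<in> fibre L p \<Longrightarrow> coo p l = coo p l' \<Longrightarrow> l = l'"
  using triv_props(2)[OF triv] unfolding coo_def bij_betw_def inj_on_def by blast

lemma coo_surj: "\<exists>l\<in>fibre L p. coo p l = z"
proof -
  have "z \<in> snd (triv p) ` fibre L p"
    using bij_betw_imp_surj_on[OF triv_props(2)[OF triv]] by simp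
  then show ?thesis unfolding coo_def by auto
qed

lemmas fibre_add = triv_props(3)[OF triv] and fibre_scale = triv_props(5)[OF triv]

lemma coo_add: "l \<in> fibre L p \<Longrightarrow> l' \<in> fibre L p \<Longrightarrow> coo p (fadd L l l') = coo p l + coo p l'"
  unfolding coo_def using triv_props(4)[OF triv] .

lemma coo_scale: "l \<in> fibre L p \<Longrightarrow> coo p (fscale L k l) = k * coo p l"
  unfolding coo_def using triv_props(6)[OF triv] .

text \<open>By linearity, as every vector of the fibre is a multiple of the unit vector of the first trivialisation.\<close>

lemma triv_change:
  assumes T: "T \<in> trivs L" "p \<in> fst T" and T': "T' \<in> trivs L" "p \<in> fst T'" and l: "l \<in> fibre L p"
  shows "snd T' l = snd T l * snd T' (inv_into (fibre L p) (snd T) 1)"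
proof -
  let ?u = "inv_into (fibre L p) (snd T) 1"
  have b: "bij_betw (snd T) (fibre L p) UNIV" using triv_props(2)[OF T] .
  have u: "?u \<in> fibre L p" "snd T ?u = 1"
    using b inv_into_into[of 1 "snd T" "fibre L p"] f_inv_into_f[of 1 "snd T" "fibre L p"]
    unfolding bij_betw_def by auto
  have "snd T (fscale L (snd T l) ?u) = snd T l" using triv_props(6)[OF T u(1)] u(2) by simp
  then have "fscale L (snd T l) ?u = l"
    using b l triv_props(5)[OF T u(1)] unfolding bij_betw_def inj_on_def by blast
  then show ?thesis using triv_props(6)[OF T' u(1)] by metis
qed

lemma sections_fibre [simp]: "s \<in> S \<Longrightarrow> s p \<in> fibre L p"
  unfolding smooth_sections_def by blast

lemma section_smooth: "s \<in> S \<Longrightarrow> T \<in> trivs L \<Longrightarrow> smooth_on A (fst T) (\<lambda>p. snd T (s p))"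
  unfolding smooth_sections_def by (cases T) (force simp: o_def)

lemma sectionI:
  "(\<And>p. s p \<in> fibre L p) \<Longrightarrow> (\<And>T. T \<in> trivs L \<Longrightarrow> smooth_on A (fst T) (\<lambda>p. snd T (s p))) \<Longrightarrow> s \<in> S"
  unfolding smooth_sections_def by (force simp: o_def)

lemma section_eqI: "s \<in> S \<Longrightarrow> t \<in> S \<Longrightarrow> (\<And>p. coo p (s p) = coo p (t p)) \<Longrightarrow> s = t"
  using coo_inj sections_fibre by blast

lemma sec_add [simp]:
  assumes "s \<in> S" "t \<in> S"
  shows "sec_add L s t \<in> S"
proof (rule sectionI)
  show "sec_add L s t p \<in> fibre L p" for p using assms fibre_add by (simp add: sec_add_def)
  fix T assume T: "T \<in> trivs L"
  show "smooth_on A (fst T) (\<lambda>p. snd T (sec_add L s t p))"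
    by (rule smooth_on_cong[OF triv_props(1)[OF T], of "\<lambda>p. snd T (s p) + snd T (t p)"])
      (use assms T triv_props(4)[OF T] section_smooth in \<open>auto simp: sec_add_def\<close>)
qed

lemma sec_scale [simp]:
  assumes "s \<in> S" "smooth A f"
  shows "sec_scale L f s \<in> S"
proof (rule sectionI)
  show "sec_scale L f s p \<in> fibre L p" for p using assms fibre_scale by (simp add: sec_scale_def)
  fix T assume T: "T \<in> trivs L"
  show "smooth_on A (fst T) (\<lambda>p. snd T (sec_scale L f s p))"
    by (rule smooth_on_cong[OF triv_props(1)[OF T], of "\<lambda>p. f p * snd T (s p)"])
      (use assms T triv_props(6)[OF T] section_smooth smooth_on_subset[OF assms(2)] in \<open>auto simp: sec_scale_def\<close>)
qed

lemma sec_diff [simp]: "s \<in> S \<Longrightarrow> t \<in> S \<Longrightarrow> sec_diff L s t \<in> S"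
  unfolding sec_diff_def by simp

lemma coo_sec_add [simp]:
  "s \<in> S \<Longrightarrow> t \<in> S \<Longrightarrow> coo p (sec_add L s t p) = coo p (s p) + coo p (t p)"
  by (simp add: sec_add_def coo_add)

lemma coo_sec_scale [simp]: "s \<in> S \<Longrightarrow> coo p (sec_scale L f s p) = f p * coo p (s p)"
  by (simp add: sec_scale_def coo_scale)

lemma coo_sec_diff [simp]:
  "s \<in> S \<Longrightarrow> t \<in> S \<Longrightarrow> coo p (sec_diff L s t p) = coo p (s p) - coo p (t p)"
  by (simp add: sec_diff_def)

text \<open>
  The unit section of a trivialisation, multiplied by a cutoff \<open>\<psi>\<close>. For any section \<open>s\<close> with
  coordinate \<open>\<sigma>\<close> in that trivialisation, \<open>\<psi>\<^sup>2 s\<close> is the multiple \<open>\<psi> \<sigma>\<close> of it, and these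
  coefficients are globally smooth.
\<close>

lemma section_at:
  obtains e where "e \<in> S" "coo p (e p) = 1"
    "\<And>s. s \<in> S \<Longrightarrow> \<exists>\<psi> g. smooth A \<psi> \<and> smooth A g \<and> \<psi> p = 1 \<and> g p = coo p (s p) \<and>
      sec_scale L (\<lambda>q. complex_of_real (\<psi> q)) s = sec_scale L g e"
proof -
  let ?T = "triv p"
  let ?U = "fst ?T"
  note T = triv[of p]
  obtain c where c: "c \<in> A" "p \<in> fst c" using chart_at .
  obtain r \<psi> K V' where \<psi>: "p \<in> V'" "compact K" "K \<subseteq> ?U" "smooth A \<psi>"
    "\<And>x. x \<in> V' \<Longrightarrow> \<psi> x = (1::real)" "\<And>x. x \<notin> K \<Longrightarrow> \<psi> x = 0"
    using chart_cutoff[OF c triv_props(1)[OF T(1)] T(2)] by metis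
  have cK: "closed K" using \<psi>(2) by (rule compact_imp_closed)
  have "\<exists>l. l \<in> fibre L q \<and> (if q \<in> ?U then snd ?T l = of_real (\<psi> q) else coo q l = 0)" for q
  proof (cases "q \<in> ?U")
    case True
    have "complex_of_real (\<psi> q) \<in> snd ?T ` fibre L q"
      using bij_betw_imp_surj_on[OF triv_props(2)[OF T(1) True]] by simp
    then show ?thesis using True by auto
  next
    case False
    then show ?thesis using coo_surj[of q 0] by auto
  qed
  then obtain e where e: "\<And>q. e q \<in> fibre L q" "\<And>q. q \<in> ?U \<Longrightarrow> snd ?T (e q) = of_real (\<psi> q)"
    "\<And>q. q \<notin> ?U \<Longrightarrow> coo q (e q) = 0" by metis
  have eS: "e \<in> S"
  proof (rule sectionI[OF e(1)])
    fix T' assume T': "T' \<in> trivs L"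
    show "smooth_on A (fst T') (\<lambda>q. snd T' (e q))"
    proof (rule smooth_on_local)
      fix q assume q: "q \<in> fst T'"
      show "\<exists>V. open V \<and> q \<in> V \<and> smooth_on A V (\<lambda>q. snd T' (e q))"
      proof (cases "q \<in> ?U")
        case True
        have o: "open (?U \<inter> fst T')" using triv_props(1) T T' by blast
        have "smooth_on A (?U \<inter> fst T') (\<lambda>q. snd T' (e q))"
          by (rule smooth_on_cong[OF o _ smooth_on_mult[OF smooth_on_of_real[OF smooth_on_subset[OF \<psi>(4)]]
                triv_transition[OF T(1) T']]])
            (use triv_change[OF T(1) _ T' _ e(1)] e(2) in auto)
        then show ?thesis using o True q by blast
      next
        case False
        have o: "open (fst T' - K)" using triv_props(1)[OF T'] cK by blast
        have "snd T' (e x) = 0" if x: "x \<in> fst T' - K" for x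
        proof (cases "x \<in> ?U")
          case True
          then show ?thesis using triv_change[OF T(1) True T' _ e(1)] x e(2) \<psi>(6) by simp
        next
          case False
          then show ?thesis using triv_change[OF triv T' _ e(1), of x] x e(3) by (simp add: coo_def)
        qed
        then have "smooth_on A (fst T' - K) (\<lambda>q. snd T' (e q))"
          by (intro smooth_on_cong[OF o _ smooth_on_const[of _ 0]]) auto
        then show ?thesis using o False q \<psi>(3) by blast
      qed
    qed
  qed
  moreover have "coo p (e p) = 1" using e(2)[OF T(2)] \<psi>(1,5) by (simp add: coo_def)
  moreover have "\<exists>\<phi> g. smooth A \<phi> \<and> smooth A g \<and> \<phi> p = (1::real) \<and> g p = coo p (s p) \<and>
      sec_scale L (\<lambda>q. complex_of_real (\<phi> q)) s = sec_scale L g e" if s: "s \<in> S" for s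
  proof (intro exI conjI)
    let ?g = "\<lambda>q. \<psi> q *\<^sub>R snd ?T (s q)"
    show \<phi>: "smooth A (\<lambda>q. \<psi> q * \<psi> q)" using \<psi>(4) by simp
    show g: "smooth A ?g"
      by (rule smooth_cutoff_mult[OF \<psi>(4) cK \<psi>(3) triv_props(1)[OF T(1)] \<psi>(6) section_smooth[OF s T(1)]])
    show "\<psi> p * \<psi> p = 1" "?g p = coo p (s p)" using \<psi>(1,5) by (simp_all add: coo_def)
    show "sec_scale L (\<lambda>q. complex_of_real (\<psi> q * \<psi> q)) s = sec_scale L ?g e"
    proof (rule section_eqI)
      fix q
      show "coo q (sec_scale L (\<lambda>q. complex_of_real (\<psi> q * \<psi> q)) s q) = coo q (sec_scale L ?g e q)"
      proof (cases "q \<in> ?U")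
        case True
        note ch = triv_change[OF T(1) True triv]
        show ?thesis
          using s eS ch[OF sections_fibre[OF s]] ch[OF e(1)] e(2)[OF True]
          by (simp add: coo_def[symmetric] scaleR_conv_of_real)
      next
        case False
        then have "\<psi> q = 0" using \<psi>(3,6) by blast
        then show ?thesis using s eS by simp
      qed
    qed (use s g eS smooth_on_of_real[OF \<phi>] in simp_all)
  qed
  ultimately show ?thesis using that by blast
qed

lemma D_section [simp]: "X \<in> vector_fields A \<Longrightarrow> s \<in> S \<Longrightarrow> D X s \<in> S"
  using conn unfolding connection_def by blast

lemma D_vf_add [simp]:
  "X \<in> vector_fields A \<Longrightarrow> Y \<in> vector_fields A \<Longrightarrow> s \<in> S \<Longrightarrow> D (vf_add X Y) s = sec_add L (D X s) (D Y s)"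
  using conn unfolding connection_def by blast

lemma D_vf_scale [simp]:
  "X \<in> vector_fields A \<Longrightarrow> smooth A f \<Longrightarrow> s \<in> S \<Longrightarrow>
    D (vf_scale f X) s = sec_scale L (\<lambda>p. of_real (f p)) (D X s)"
  using conn unfolding connection_def by blast

lemma D_sec_add [simp]:
  "X \<in> vector_fields A \<Longrightarrow> s \<in> S \<Longrightarrow> t \<in> S \<Longrightarrow> D X (sec_add L s t) = sec_add L (D X s) (D X t)"
  using conn unfolding connection_def by blast

lemma D_sec_scale [simp]:
  "X \<in> vector_fields A \<Longrightarrow> smooth A f \<Longrightarrow> s \<in> S \<Longrightarrow>
    D X (sec_scale L f s) = sec_add L (sec_scale L f (D X s)) (sec_scale L (vf_apply X f) s)"
  using conn unfolding connection_def by blast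

lemma vf_apply_smooth [simp]: "X \<in> vector_fields A \<Longrightarrow> smooth A f \<Longrightarrow> smooth A (vf_apply X f)"
  unfolding vf_apply_def by simp

lemma vf_apply_of_real:
  "X \<in> vector_fields A \<Longrightarrow> vf_apply X (\<lambda>p. complex_of_real (f p)) p = of_real (X p f)"
  unfolding vf_apply_def by (simp add: complex_eq_iff tangent_const[OF vf_tangent])

lemma vf_apply_i_of_real:
  "X \<in> vector_fields A \<Longrightarrow> vf_apply X (\<lambda>p. \<i> * complex_of_real (f p)) p = \<i> * of_real (X p f)"
  unfolding vf_apply_def by (simp add: complex_eq_iff tangent_const[OF vf_tangent])

lemma vf_apply_const: "X \<in> vector_fields A \<Longrightarrow> vf_apply X (\<lambda>p. k) p = 0"
  unfolding vf_apply_def by (simp add: complex_eq_iff tangent_const[OF vf_tangent])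

lemma D_zero:
  assumes "s \<in> S"
  shows "coo p (D (\<lambda>_ _. 0) s p) = 0"
proof -
  have "D (\<lambda>_ _. 0) s = sec_scale L (\<lambda>_. 0) (D (\<lambda>_ _. 0) s)"
    using D_vf_scale[OF vf_zero, of "\<lambda>_. 0" s] assms by (simp add: vf_scale_def)
  then have "coo p (D (\<lambda>_ _. 0) s p) = coo p (sec_scale L (\<lambda>_. 0) (D (\<lambda>_ _. 0) s) p)" by metis
  then show ?thesis using assms by simp
qed

text \<open>The curvature operator, read off in the fibre coordinate.\<close>

definition K :: "'m vector_field \<Rightarrow> 'm vector_field \<Rightarrow> ('m, 'l) sect \<Rightarrow> 'm \<Rightarrow> complex" where
  "K X Y s p = coo p (D X (D Y s) p) - coo p (D Y (D X s) p) - coo p (D (lie_bracket X Y) s p)"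

lemma coo_curvature:
  "X \<in> vector_fields A \<Longrightarrow> Y \<in> vector_fields A \<Longrightarrow> s \<in> S \<Longrightarrow> coo p (curvature L D X Y s p) = K X Y s p"
  unfolding curvature_def K_def by simp

lemma K_antisym:
  assumes "X \<in> vector_fields A" "Y \<in> vector_fields A" "s \<in> S"
  shows "K Y X s p = - K X Y s p"
proof -
  have "lie_bracket Y X = vf_scale (\<lambda>_. -1) (lie_bracket X Y)"
    by (simp add: fun_eq_iff vf_scale_def lie_bracket_def)
  then show ?thesis using assms by (simp add: K_def)
qed

lemma K_vf_add:
  assumes "X \<in> vector_fields A" "X' \<in> vector_fields A" "Y \<in> vector_fields A" "s \<in> S"
  shows "K (vf_add X X') Y s p = K X Y s p + K X' Y s p"
proof -
  have "lie_bracket (vf_add X X') Y = vf_add (lie_bracket X Y) (lie_bracket X' Y)"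
    using lie_bracket_add[OF assms(1-3)] by (simp add: fun_eq_iff vf_add_def)
  then show ?thesis using assms by (simp add: K_def)
qed

lemma K_vf_scale:
  assumes "X \<in> vector_fields A" "Y \<in> vector_fields A" "s \<in> S" "smooth A f"
  shows "K (vf_scale f X) Y s p = f p *\<^sub>R K X Y s p"
proof -
  have "lie_bracket (vf_scale f X) Y = vf_add (vf_scale f (lie_bracket X Y)) (vf_scale (\<lambda>q. - Y q f) X)"
    using lie_bracket_scale[OF assms(1,2,4)] by (simp add: fun_eq_iff vf_add_def vf_scale_def)
  then show ?thesis
    using assms by (simp add: K_def vf_apply_of_real scaleR_conv_of_real algebra_simps)
qed

text \<open>The first derivatives of \<open>g\<close> cancel by symmetry, the second ones against the derivative along \<open>[X, Y]\<close>.\<close>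

lemma K_sec_scale:
  assumes X: "X \<in> vector_fields A" and Y: "Y \<in> vector_fields A" and s: "s \<in> S" and g: "smooth A g"
  shows "K X Y (sec_scale L g s) p = g p * K X Y s p"
proof -
  have b: "vf_apply (lie_bracket X Y) g p = vf_apply X (vf_apply Y g) p - vf_apply Y (vf_apply X g) p"
    by (simp add: vf_apply_def lie_bracket_def complex_eq_iff)
  show ?thesis
    using X Y s g by (simp add: K_def b algebra_simps)
qed

abbreviation F :: "'m \<Rightarrow> 'm tangent \<Rightarrow> 'm tangent \<Rightarrow> complex" where
  "F \<equiv> curvature_form A L D"

text \<open>
  Near \<open>p\<close> every section is a function times \<open>e\<close>, and the curvature operator pulls out functions; so at \<open>p\<close> it
  multiplies every section by its value on \<open>e\<close>.
\<close>

lemma K_scalar: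
  assumes X: "X \<in> vector_fields A" and Y: "Y \<in> vector_fields A"
    and e: "e \<in> S" "coo p (e p) = 1"
      "\<And>s. s \<in> S \<Longrightarrow> \<exists>\<psi> g. smooth A \<psi> \<and> smooth A g \<and> \<psi> p = 1 \<and> g p = coo p (s p) \<and>
        sec_scale L (\<lambda>q. complex_of_real (\<psi> q)) s = sec_scale L g e"
    and s: "s \<in> S"
  shows "K X Y s p = K X Y e p * coo p (s p)"
proof -
  obtain \<psi> g where g: "smooth A \<psi>" "smooth A g" "\<psi> p = 1" "g p = coo p (s p)"
    "sec_scale L (\<lambda>q. complex_of_real (\<psi> q)) s = sec_scale L g e"
    using e(3)[OF s] by blast
  have "K X Y s p = K X Y (sec_scale L (\<lambda>q. complex_of_real (\<psi> q)) s) p"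
    using K_sec_scale[OF X Y s smooth_on_of_real[OF g(1)]] g(3) by simp
  also have "\<dots> = K X Y e p * coo p (s p)"
    unfolding g(5) using K_sec_scale[OF X Y e(1) g(2)] g(4) by simp
  finally show ?thesis .
qed

lemma K_cong:
  assumes X: "X \<in> vector_fields A" "X' \<in> vector_fields A" "X p = X' p" and Y: "Y \<in> vector_fields A" and s: "s \<in> S"
  shows "K X Y s p = K X' Y s p"
  by (rule tensorial[where \<Phi> = "\<lambda>X. K X Y s p", OF _ _ X])
    (use Y s in \<open>simp_all add: K_vf_add K_vf_scale\<close>)

text \<open>
  Linearity over functions in the two fields removes the dependence on the extensions that
  \<open>curvature_form\<close> chooses, and \<open>e\<close> witnesses uniqueness of its value.
\<close>

lemma K_curvature_form:
  assumes X: "X \<in> vector_fields A" and Y: "Y \<in> vector_fields A" and s: "s \<in> S"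
  shows "K X Y s p = F p (X p) (Y p) * coo p (s p)"
proof -
  obtain e where e: "e \<in> S" "coo p (e p) = 1"
    "\<And>s. s \<in> S \<Longrightarrow> \<exists>\<psi> g. smooth A \<psi> \<and> smooth A g \<and> \<psi> p = 1 \<and> g p = coo p (s p) \<and>
      sec_scale L (\<lambda>q. complex_of_real (\<psi> q)) s = sec_scale L g e"
    by (rule section_at[of p]) (rule that)
  note eX = extend_vector[OF vf_tangent[OF X, of p]] and eY = extend_vector[OF vf_tangent[OF Y, of p]]
  let ?X = "extend_vector A p (X p)" and ?Y = "extend_vector A p (Y p)"
  have "curvature L D ?X ?Y s p = fscale L z (s p) \<longleftrightarrow> K ?X ?Y s p = z * coo p (s p)" if s: "s \<in> S" for s z
  proof -
    have c: "curvature L D ?X ?Y s \<in> S" unfolding curvature_def using s eX eY by simp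
    have "curvature L D ?X ?Y s p = fscale L z (s p) \<longleftrightarrow>
        coo p (curvature L D ?X ?Y s p) = coo p (fscale L z (s p))"
      using coo_inj[OF sections_fibre[OF c] fibre_scale[OF sections_fibre[OF s]]] by auto
    then show ?thesis using coo_curvature[OF eX(1) eY(1) s] coo_scale[OF sections_fibre[OF s]] by simp
  qed
  then have "F p (X p) (Y p) = (THE z. \<forall>s\<in>S. K ?X ?Y s p = z * coo p (s p))"
    unfolding curvature_form_def by (simp cong: ball_cong)
  also have "\<dots> = K ?X ?Y e p"
  proof (rule the_equality)
    show "\<forall>s\<in>S. K ?X ?Y s p = K ?X ?Y e p * coo p (s p)"
      by (intro ballI K_scalar[OF eX(1) eY(1)] e)
    show "z = K ?X ?Y e p" if "\<forall>s\<in>S. K ?X ?Y s p = z * coo p (s p)" for z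
      using bspec[OF that e(1)] e(2) by simp
  qed
  finally have F: "F p (X p) (Y p) = K ?X ?Y e p" .
  have "K X Y s p = K ?X Y s p" using K_cong[OF X eX(1) _ Y s] eX(2) by simp
  also have "\<dots> = - K Y ?X s p" using K_antisym[OF Y eX(1) s] by simp
  also have "\<dots> = - K ?Y ?X s p" using K_cong[OF Y eY(1) _ eX(1) s] eY(2) by simp
  also have "\<dots> = K ?X ?Y s p" using K_antisym[OF eY(1) eX(1) s] by simp
  also have "\<dots> = K ?X ?Y e p * coo p (s p)" using K_scalar[OF eX(1) eY(1) e s] .
  finally show ?thesis using F by simp
qed

lemma curvature_form_lincomb:
  assumes "v \<in> tangent_space A p" "v' \<in> tangent_space A p" "w \<in> tangent_space A p"
  shows "F p (\<lambda>u. a * v u + b * v' u) w = of_real a * F p v w + of_real b * F p v' w"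
    and "F p w v = - F p v w"
proof -
  obtain X X' Y where X: "X \<in> vector_fields A" "X p = v" "X' \<in> vector_fields A" "X' p = v'"
    "Y \<in> vector_fields A" "Y p = w"
    using extend_tangent assms by metis
  obtain e where e: "e \<in> S" "coo p (e p) = 1" using section_at by metis
  let ?Z = "vf_add (vf_scale (\<lambda>_. a) X) (vf_scale (\<lambda>_. b) X')"
  have Z: "?Z \<in> vector_fields A" "?Z p = (\<lambda>u. a * v u + b * v' u)"
    using X by (simp_all, simp add: vf_add_def vf_scale_def)
  have "K ?Z Y e p = of_real a * K X Y e p + of_real b * K X' Y e p"
    using X e(1) by (simp add: K_vf_add K_vf_scale scaleR_conv_of_real)
  then show "F p (\<lambda>u. a * v u + b * v' u) w = of_real a * F p v w + of_real b * F p v' w"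
    using K_curvature_form[OF Z(1) X(5) e(1), of p] K_curvature_form[OF X(1,5) e(1), of p]
      K_curvature_form[OF X(3,5) e(1), of p] Z(2) X e(2) by simp
  show "F p w v = - F p v w"
    using K_curvature_form[OF X(1,5) e(1), of p] K_curvature_form[OF X(5,1) e(1), of p]
      K_antisym[OF X(1,5) e(1), of p] X e(2) by simp
qed

lemma curvature_form_lincomb_right:
  assumes v: "v \<in> tangent_space A p" "v' \<in> tangent_space A p" and w: "w \<in> tangent_space A p"
  shows "F p w (\<lambda>u. a * v u + b * v' u) = of_real a * F p w v + of_real b * F p w v'"
proof -
  have "(\<lambda>u. a * v u + b * v' u) \<in> tangent_space A p"
    using v by (intro tangent_space_add tangent_space_scale)
  then show ?thesis
    using curvature_form_lincomb[OF v w] curvature_form_lincomb(2)[OF _ _ w] v by simp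
qed

end

section \<open>Curvature in the Reeb direction and the commutator identity\<close>

locale quantum_contact = contact_manifold A \<theta> \<xi> \<Lambda> + line_bundle_connection A L D
  for A :: "('m::t2_space, 'e::euclidean_space) chart set" and \<theta> \<xi> \<Lambda>
    and L :: "('m, 'l) line_bundle" and D +
  assumes quantum: "\<And>p v w. v \<in> contact_distribution A \<theta> p \<Longrightarrow> w \<in> contact_distribution A \<theta> p \<Longrightarrow>
    curvature_form A L D p v w = \<i> * of_real (- ext_deriv A \<theta> p v w)"
begin

lemma contact_part:
  assumes v: "v \<in> tangent_space A p"
  shows "(\<lambda>u. 1 * v u + (- \<theta> p v) * \<xi> p u) \<in> contact_distribution A \<theta> p"
proof -
  have "(\<lambda>u. 1 * v u + (- \<theta> p v) * \<xi> p u) \<in> tangent_space A p"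
    using v vf_tangent[OF reeb_vf] by (intro tangent_space_add tangent_space_scale)
  then show ?thesis
    using \<theta>_lincomb[OF v vf_tangent[OF reeb_vf], of 1 "- \<theta> p v"] \<theta>_reeb
    by (simp add: contact_distribution_def)
qed

lemma extend_contact:
  assumes "v \<in> contact_distribution A \<theta> p"
  obtains X where "X \<in> vector_fields A" "X p = v" "\<And>q. X q \<in> contact_distribution A \<theta> q"
proof -
  obtain X where X: "X \<in> vector_fields A" "X p = v"
    using extend_tangent assms unfolding contact_distribution_def by blast
  let ?Y = "vf_add X (vf_scale (\<lambda>q. - \<theta> q (X q)) \<xi>)"
  have at: "?Y q = (\<lambda>u. 1 * X q u + (- \<theta> q (X q)) * \<xi> q u)" for q
    by (simp add: vf_add_def vf_scale_def)
  have "?Y \<in> vector_fields A" using X(1) \<theta> by simp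
  moreover have "?Y p = v" using assms X(2) at[of p] by (simp add: contact_distribution_def)
  moreover have "?Y q \<in> contact_distribution A \<theta> q" for q
    unfolding at using contact_part vf_tangent X(1) by blast
  ultimately show ?thesis using that by blast
qed

lemma contactD: "v \<in> contact_distribution A \<theta> p \<Longrightarrow> v \<in> tangent_space A p"
  "v \<in> contact_distribution A \<theta> p \<Longrightarrow> \<theta> p v = 0"
  unfolding contact_distribution_def by blast+

lemma d\<theta>_reeb_right: "w \<in> tangent_space A p \<Longrightarrow> d\<theta> p w (\<xi> p) = 0"
  using ext_deriv_antisym[OF \<theta> vf_tangent[OF reeb_vf]] d\<theta>_reeb by simp

text \<open>The quantum condition, applied to the component of \<open>v\<close> in the distribution; the Reeb component remains.\<close>

lemma F_contact_left:
  assumes x: "x \<in> contact_distribution A \<theta> p" and v: "v \<in> tangent_space A p"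
  shows "F p x v = - \<i> * of_real (d\<theta> p x v) + of_real (\<theta> p v) * F p x (\<xi> p)"
proof -
  let ?v = "\<lambda>u. 1 * v u + (- \<theta> p v) * \<xi> p u"
  note t = contactD(1)[OF x] vf_tangent[OF reeb_vf, of p]
  have "F p x ?v = \<i> * of_real (- d\<theta> p x ?v)" using quantum[OF x contact_part[OF v]] .
  then show ?thesis
    using curvature_form_lincomb_right[OF v t(2,1), of 1 "- \<theta> p v"]
      ext_deriv_lincomb(2)[OF \<theta> v t(2,1), of 1 "- \<theta> p v"] d\<theta>_reeb_right[OF t(1)]
    by (simp add: algebra_simps)
qed

text \<open>
  The Bianchi identity says that the curvature form is closed, and \<open>d\<theta>\<close> is closed. So the form
  \<open>F + \<i> d\<theta>\<close>, which vanishes on the contact distribution, is closed. On three fields in the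
  distribution its differential only sees the Reeb components \<open>- d\<theta>(Y,Z)\<close> of their brackets.
\<close>

lemma reeb_curvature_cyclic:
  assumes x: "x \<in> contact_distribution A \<theta> p" and y: "y \<in> contact_distribution A \<theta> p"
    and z: "z \<in> contact_distribution A \<theta> p"
  shows "of_real (d\<theta> p y z) * F p x (\<xi> p) + of_real (d\<theta> p z x) * F p y (\<xi> p)
    + of_real (d\<theta> p x y) * F p z (\<xi> p) = 0"
proof -
  obtain X where X: "X \<in> vector_fields A" "X p = x" "\<And>q. X q \<in> contact_distribution A \<theta> q"
    by (rule extend_contact[OF x]) (rule that)
  obtain Y where Y: "Y \<in> vector_fields A" "Y p = y" "\<And>q. Y q \<in> contact_distribution A \<theta> q"
    by (rule extend_contact[OF y]) (rule that)
  obtain Z where Z: "Z \<in> vector_fields A" "Z p = z" "\<And>q. Z q \<in> contact_distribution A \<theta> q"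
    by (rule extend_contact[OF z]) (rule that)
  obtain e where e: "e \<in> S" "coo p (e p) = 1" using section_at by metis
  \<comment> \<open>as operators on sections, \<open>[D U, D V] = - \<i> d\<theta>(U,V) + D [U,V]\<close> for fields in the distribution\<close>
  have comm: "D U (D V s) = sec_add L (D V (D U s))
      (sec_add L (sec_scale L (\<lambda>q. \<i> * of_real (- dform \<theta> U V q)) s) (D (lie_bracket U V) s))"
    if U: "U \<in> vector_fields A" "\<And>q. U q \<in> contact_distribution A \<theta> q"
      and V: "V \<in> vector_fields A" "\<And>q. V q \<in> contact_distribution A \<theta> q" and s: "s \<in> S" for U V s
  proof (rule section_eqI)
    have sm: "smooth A (\<lambda>q. \<i> * complex_of_real (- dform \<theta> U V q))"
      using U V \<theta> by (intro smooth_on_mult smooth_on_of_real smooth_on_minus smooth_on_const dform_smooth)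
    then show "sec_add L (D V (D U s))
      (sec_add L (sec_scale L (\<lambda>q. \<i> * of_real (- dform \<theta> U V q)) s) (D (lie_bracket U V) s)) \<in> S"
      using U V s by simp
    show "D U (D V s) \<in> S" using U V s by simp
    fix q
    have "K U V s q = \<i> * of_real (- dform \<theta> U V q) * coo q (s q)"
      using K_curvature_form[OF U(1) V(1) s, of q] quantum[OF U(2) V(2), of q]
        ext_deriv_dform[OF \<theta> U(1) V(1), of q] by simp
    then show "coo q (D U (D V s) q) = coo q (sec_add L (D V (D U s))
      (sec_add L (sec_scale L (\<lambda>q. \<i> * of_real (- dform \<theta> U V q)) s) (D (lie_bracket U V) s)) q)"
      using U V s sm unfolding K_def by (simp add: algebra_simps)
  qed
  have step: "coo p (D W (D U (D V e)) p) - coo p (D W (D V (D U e)) p)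
      - coo p (D U (D V (D W e)) p) + coo p (D V (D U (D W e)) p)
    = - \<i> * of_real (W p (dform \<theta> U V)) + F p (W p) (lie_bracket U V p)
      + coo p (D (lie_bracket W (lie_bracket U V)) e p)"
    if U: "U \<in> vector_fields A" "\<And>q. U q \<in> contact_distribution A \<theta> q"
      and V: "V \<in> vector_fields A" "\<And>q. V q \<in> contact_distribution A \<theta> q"
      and W: "W \<in> vector_fields A" for U V W
  proof -
    have sm: "smooth A (\<lambda>q. - dform \<theta> U V q)" using U V \<theta> by simp
    have sm': "smooth A (\<lambda>q. \<i> * complex_of_real (- dform \<theta> U V q))"
      using sm by (intro smooth_on_mult smooth_on_of_real smooth_on_const)
    have ap: "vf_apply W (\<lambda>q. \<i> * complex_of_real (- dform \<theta> U V q)) p = \<i> * of_real (- W p (dform \<theta> U V))"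
      using vf_apply_i_of_real[OF W, of "\<lambda>q. - dform \<theta> U V q"]
        tangent_minus[OF vf_tangent[OF W], of "dform \<theta> U V" p] U V \<theta> by simp
    note b = vf_lie_bracket[OF U(1) V(1)]
    have "coo p (D W (D U (D V e)) p) = coo p (D W (D V (D U e)) p)
        + (\<i> * of_real (- dform \<theta> U V p)) * coo p (D W e p) + \<i> * of_real (- W p (dform \<theta> U V))
        + coo p (D W (D (lie_bracket U V) e) p)"
      unfolding comm[OF U V e(1)] using U V W e sm' b ap by (simp add: algebra_simps)
    moreover have "coo p (D U (D V (D W e)) p) = coo p (D V (D U (D W e)) p)
        + (\<i> * of_real (- dform \<theta> U V p)) * coo p (D W e p) + coo p (D (lie_bracket U V) (D W e) p)"
      using comm[OF U V D_section[OF W e(1)]] U V W e sm' b by (simp add: algebra_simps)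
    moreover have "K W (lie_bracket U V) e p = F p (W p) (lie_bracket U V p)"
      using K_curvature_form[OF W b e(1), of p] e(2) by simp
    ultimately show ?thesis unfolding K_def of_real_minus by algebra
  qed
  have jac: "coo p (D (lie_bracket X (lie_bracket Y Z)) e p) + coo p (D (lie_bracket Y (lie_bracket Z X)) e p)
      + coo p (D (lie_bracket Z (lie_bracket X Y)) e p) = 0"
  proof -
    let ?a = "lie_bracket X (lie_bracket Y Z)" and ?b = "lie_bracket Y (lie_bracket Z X)"
      and ?c = "lie_bracket Z (lie_bracket X Y)"
    have "?a q u + ?b q u + ?c q u = 0" for q u
      using X(1) Y(1) Z(1) by (cases "smooth A u")
        (simp_all add: lie_bracket_def vf_derivation[OF Y(1)] vf_derivation[OF X(1)]
          vf_derivation[OF Z(1)] vf_nonsmooth)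
    then have "vf_add (vf_add ?a ?b) ?c = (\<lambda>_ _. 0)" by (simp add: vf_add_def fun_eq_iff)
    then have "coo p (D (vf_add (vf_add ?a ?b) ?c) e p) = 0" using D_zero[OF e(1)] by simp
    then show ?thesis using X(1) Y(1) Z(1) e(1) by simp
  qed
  have br: "F p (W p) (lie_bracket U V p) = - \<i> * of_real (dform \<theta> W (lie_bracket U V) p)
      - of_real (dform \<theta> U V p) * F p (W p) (\<xi> p)"
    if U: "U \<in> vector_fields A" "\<And>q. U q \<in> contact_distribution A \<theta> q"
      and V: "V \<in> vector_fields A" "\<And>q. V q \<in> contact_distribution A \<theta> q"
      and W: "W \<in> vector_fields A" "\<And>q. W q \<in> contact_distribution A \<theta> q" for U V W
  proof -
    note b = vf_lie_bracket[OF U(1) V(1)]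
    have "\<theta> p (lie_bracket U V p) = - dform \<theta> U V p"
      using contactD(2)[OF U(2)] contactD(2)[OF V(2)] tangent_const[OF vf_tangent[OF U(1)]]
        tangent_const[OF vf_tangent[OF V(1)]] by (simp add: dform_def)
    then show ?thesis
      using F_contact_left[OF W(2) vf_tangent[OF b], of p] ext_deriv_dform[OF \<theta> W(1) b, of p] by simp
  qed
  have "X p (dform \<theta> Y Z) + Y p (dform \<theta> Z X) + Z p (dform \<theta> X Y)
      + dform \<theta> X (lie_bracket Y Z) p + dform \<theta> Y (lie_bracket Z X) p + dform \<theta> Z (lie_bracket X Y) p = 0"
    using dform_closed[OF \<theta> X(1) Y(1) Z(1), of p]
      dform_antisym[OF \<theta> X(1) vf_lie_bracket[OF Y(1) Z(1)], of p]
      dform_antisym[OF \<theta> Y(1) vf_lie_bracket[OF Z(1) X(1)], of p]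
      dform_antisym[OF \<theta> Z(1) vf_lie_bracket[OF X(1) Y(1)], of p] by simp
  then have closed: "complex_of_real (X p (dform \<theta> Y Z)) + of_real (Y p (dform \<theta> Z X)) + of_real (Z p (dform \<theta> X Y))
      + of_real (dform \<theta> X (lie_bracket Y Z) p) + of_real (dform \<theta> Y (lie_bracket Z X) p)
      + of_real (dform \<theta> Z (lie_bracket X Y) p) = 0"
    by (metis of_real_0 of_real_add)
  have "(- \<i> * of_real (X p (dform \<theta> Y Z)) + F p x (lie_bracket Y Z p))
      + (- \<i> * of_real (Y p (dform \<theta> Z X)) + F p y (lie_bracket Z X p))
      + (- \<i> * of_real (Z p (dform \<theta> X Y)) + F p z (lie_bracket X Y p)) = 0"
    using step[OF Y(1,3) Z(1,3) X(1)] step[OF Z(1,3) X(1,3) Y(1)] step[OF X(1,3) Y(1,3) Z(1)] jac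
    unfolding X(2) Y(2) Z(2) by algebra
  then have "of_real (dform \<theta> Y Z p) * F p x (\<xi> p) + of_real (dform \<theta> Z X p) * F p y (\<xi> p)
    + of_real (dform \<theta> X Y p) * F p z (\<xi> p) = 0"
    using br[OF Y(1,3) Z(1,3) X(1,3)] br[OF Z(1,3) X(1,3) Y(1,3)] br[OF X(1,3) Y(1,3) Z(1,3)] closed
    unfolding X(2) Y(2) Z(2) by algebra
  then show ?thesis
    using ext_deriv_dform[OF \<theta> Y(1) Z(1), of p] ext_deriv_dform[OF \<theta> Z(1) X(1), of p]
      ext_deriv_dform[OF \<theta> X(1) Y(1), of p] X(2) Y(2) Z(2) by simp
qed

text \<open>The tangent space has the dimension of the model space: evaluation on the frame coordinates is onto.\<close>

lemma tangent_span_dim: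
  assumes "\<And>w. w \<in> tangent_space A p \<Longrightarrow> \<exists>a b c. w = (\<lambda>u. a * v1 u + b * v2 u + c * v3 u)"
  shows "DIM('e) \<le> 3"
proof -
  obtain V y Y where F: "p \<in> V" "local_frame V y Y" using frame_at .
  note F' = local_frameD[OF F(2)]
  define \<phi> where "\<phi> v = (\<Sum>b\<in>Basis. v (y b) *\<^sub>R b)" for v :: "'m tangent"
  have "x \<in> span {\<phi> v1, \<phi> v2, \<phi> v3}" for x :: 'e
  proof -
    let ?w = "\<lambda>u. \<Sum>b\<in>Basis. (x \<bullet> b) * Y b p u"
    have "?w \<in> tangent_space A p"
      by (intro tangent_space_sum tangent_space_scale vf_tangent F'(3))
    then obtain a b c where w: "?w = (\<lambda>u. a * v1 u + b * v2 u + c * v3 u)" using assms by blast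
    have "?w (y d) = x \<bullet> d" if d: "d \<in> Basis" for d
    proof -
      have "?w (y d) = (\<Sum>b\<in>Basis. if b = d then x \<bullet> b else 0)"
        using F'(5)[OF F(1) _ d] by (intro sum.cong) auto
      then show ?thesis using d by simp
    qed
    then have "\<phi> ?w = x" by (simp add: \<phi>_def euclidean_representation)
    moreover have "\<phi> ?w = a *\<^sub>R \<phi> v1 + b *\<^sub>R \<phi> v2 + c *\<^sub>R \<phi> v3"
      unfolding w by (simp add: \<phi>_def scaleR_sum_right sum.distrib scaleR_add_left)
    ultimately show ?thesis by (metis insertCI span_add span_base span_scale)
  qed
  then have "(UNIV :: 'e set) \<subseteq> span {\<phi> v1, \<phi> v2, \<phi> v3}" by blast
  then have "dim (UNIV :: 'e set) \<le> card {\<phi> v1, \<phi> v2, \<phi> v3}" by (rule dim_le_card) simp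
  also have "\<dots> \<le> 3" by (simp add: card_insert_if)
  finally show ?thesis by simp
qed

text \<open>
  A nonzero \<open>z\<close> in the distribution has a partner \<open>w\<close> with \<open>d\<theta>(z,w) = 1\<close>. If \<open>d\<theta>\<close> vanished on the
  symplectic complement of \<open>z\<close>, then nondegeneracy would leave only the span of \<open>\<xi>\<close>, \<open>z\<close>, \<open>w\<close>.
\<close>

lemma orthogonal_pair:
  assumes z: "z \<in> contact_distribution A \<theta> p" "z \<noteq> (\<lambda>_. 0)" and dim: "DIM('e) > 3"
  obtains x y where "x \<in> contact_distribution A \<theta> p" "y \<in> contact_distribution A \<theta> p"
    "d\<theta> p z x = 0" "d\<theta> p y z = 0" "d\<theta> p x y \<noteq> 0"
proof -
  note zt = contactD(1)[OF z(1)] and rt = vf_tangent[OF reeb_vf, of p]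
  obtain w0 where w0: "w0 \<in> tangent_space A p" "d\<theta> p z w0 \<noteq> 0"
    using d\<theta>_nondegenerate[OF zt contactD(2)[OF z(1)]] z(2) by blast
  define w where "w = (\<lambda>u. (1 / d\<theta> p z w0) * w0 u + (- \<theta> p w0 / d\<theta> p z w0) * \<xi> p u)"
  have wt: "w \<in> tangent_space A p"
    unfolding w_def using w0(1) rt by (intro tangent_space_add tangent_space_scale)
  have "\<theta> p w = 0" unfolding w_def \<theta>_lincomb[OF w0(1) rt] using \<theta>_reeb by simp
  then have w: "w \<in> contact_distribution A \<theta> p" using wt by (simp add: contact_distribution_def)
  have zw: "d\<theta> p z w = 1"
    unfolding w_def ext_deriv_lincomb(2)[OF \<theta> w0(1) rt zt] using w0(2) d\<theta>_reeb_right[OF zt] by simp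
  have wz: "d\<theta> p w z = -1" using ext_deriv_antisym[OF \<theta> zt wt] zw by simp
  have zz: "d\<theta> p z z = 0" using ext_deriv_antisym[OF \<theta> zt zt] by simp
  have ww: "d\<theta> p w w = 0" using ext_deriv_antisym[OF \<theta> wt wt] by simp
  \<comment> \<open>the component of \<open>v\<close> that is orthogonal to both \<open>z\<close> and \<open>w\<close>\<close>
  define red where "red v = (\<lambda>u. 1 * v u + 1 * ((- d\<theta> p z v) * w u + (- d\<theta> p v w) * z u))" for v :: "'m tangent"
  have aux: "(\<lambda>u. a * w u + b * z u) \<in> tangent_space A p" for a b
    using wt zt by (intro tangent_space_add tangent_space_scale)
  have red: "red v \<in> contact_distribution A \<theta> p" "d\<theta> p z (red v) = 0" "d\<theta> p (red v) w = 0"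
    if v: "v \<in> contact_distribution A \<theta> p" for v
  proof -
    note vt = contactD(1)[OF v]
    have "red v \<in> tangent_space A p"
      unfolding red_def by (rule tangent_space_add[OF tangent_space_scale[OF vt] tangent_space_scale[OF aux]])
    moreover have "\<theta> p (red v) = 0"
      unfolding red_def \<theta>_lincomb[OF vt aux] \<theta>_lincomb[OF wt zt]
      using contactD(2)[OF v] contactD(2)[OF w] contactD(2)[OF z(1)] by simp
    ultimately show "red v \<in> contact_distribution A \<theta> p" by (simp add: contact_distribution_def)
    show "d\<theta> p z (red v) = 0"
      unfolding red_def ext_deriv_lincomb(2)[OF \<theta> vt aux zt] ext_deriv_lincomb(2)[OF \<theta> wt zt zt]
      using zw zz by simp
    show "d\<theta> p (red v) w = 0"
      unfolding red_def ext_deriv_lincomb(1)[OF \<theta> vt aux wt] ext_deriv_lincomb(1)[OF \<theta> wt zt wt]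
      using zw ww by simp
  qed
  show ?thesis
  proof (cases "\<exists>v v'. v \<in> contact_distribution A \<theta> p \<and> v' \<in> contact_distribution A \<theta> p \<and> d\<theta> p (red v) (red v') \<noteq> 0")
    case True
    then obtain v v' where v: "v \<in> contact_distribution A \<theta> p" "v' \<in> contact_distribution A \<theta> p"
      "d\<theta> p (red v) (red v') \<noteq> 0" by blast
    show ?thesis
      using that[OF red(1)[OF v(1)] red(1)[OF v(2)] red(2)[OF v(1)] _ v(3)] red(2)[OF v(2)]
        ext_deriv_antisym[OF \<theta> zt contactD(1)[OF red(1)[OF v(2)]]] by simp
  next
    case False
    then have all: "d\<theta> p (red v) (red v') = 0"
      if "v \<in> contact_distribution A \<theta> p" "v' \<in> contact_distribution A \<theta> p" for v v'
      using that by blast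
    have zero: "red v = (\<lambda>_. 0)" if v: "v \<in> contact_distribution A \<theta> p" for v
    proof (rule d\<theta>_nondegenerate)
      note rv = red[OF v]
      note rvt = contactD(1)[OF rv(1)]
      show "red v \<in> tangent_space A p" "\<theta> p (red v) = 0" using contactD[OF rv(1)] by blast+
      have rz: "d\<theta> p (red v) z = 0" using ext_deriv_antisym[OF \<theta> zt rvt] rv(2) by simp
      fix t assume t: "t \<in> tangent_space A p"
      let ?t = "\<lambda>u. 1 * t u + (- \<theta> p t) * \<xi> p u"
      note tE = contact_part[OF t]
      have "0 = d\<theta> p (red v) (red ?t)" using all[OF v tE] by simp
      also have "\<dots> = d\<theta> p (red v) ?t"
        unfolding red_def[of ?t] ext_deriv_lincomb(2)[OF \<theta> contactD(1)[OF tE] aux rvt]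
          ext_deriv_lincomb(2)[OF \<theta> wt zt rvt] using rv(3) rz by simp
      also have "\<dots> = d\<theta> p (red v) t"
        unfolding ext_deriv_lincomb(2)[OF \<theta> t rt rvt] using d\<theta>_reeb_right[OF rvt] by simp
      finally show "d\<theta> p (red v) t = 0" by simp
    qed
    have "DIM('e) \<le> 3"
    proof (rule tangent_span_dim)
      fix t assume t: "t \<in> tangent_space A p"
      let ?t = "\<lambda>u. 1 * t u + (- \<theta> p t) * \<xi> p u"
      have red0: "red ?t u = 0" for u using zero[OF contact_part[OF t]] by simp
      have "t u = \<theta> p t * \<xi> p u + d\<theta> p z ?t * w u + d\<theta> p ?t w * z u" for u
        using red0[of u] unfolding red_def[of ?t] by algebra
      then show "\<exists>a b c. t = (\<lambda>u. a * \<xi> p u + b * w u + c * z u)" by blast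
    qed
    then show ?thesis using dim by simp
  qed
qed

text \<open>A one-dimensional tangent space is spanned by \<open>\<xi>\<close>, so the distribution is zero.\<close>

lemma contact_trivial_if_dim_1:
  assumes "DIM('e) = 1" and z: "z \<in> contact_distribution A \<theta> p"
  shows "z = (\<lambda>_. 0)"
proof -
  obtain V y Y where F: "p \<in> V" "local_frame V y Y" using frame_at .
  note F' = local_frameD[OF F(2)]
  obtain b where b: "(Basis :: 'e set) = {b}" using assms(1) card_1_singletonE by metis
  have *: "v = (\<lambda>u. v (y b) * Y b p u)" if "v \<in> tangent_space A p" for v
  proof
    show "v u = v (y b) * Y b p u" for u using F'(4)[OF F(1) that, of u] unfolding b by simp
  qed
  have "\<theta> p v = v (y b) * \<theta> p (Y b p)" if "v \<in> tangent_space A p" for v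
    using one_form_scale[OF \<theta> vf_tangent[OF F'(3)], of p "v (y b)"] *[OF that] by metis
  then have "z (y b) = 0"
    using \<theta>_reeb[of p] contactD[OF z] vf_tangent[OF reeb_vf, of p] by (metis mult_eq_0_iff zero_neq_one)
  then show ?thesis using *[OF contactD(1)[OF z]] by simp
qed

text \<open>
  In the cyclic identity for \<open>x\<close>, \<open>y\<close>, \<open>z\<close> with \<open>z\<close> orthogonal to \<open>x\<close> and \<open>y\<close>, only the term
  \<open>d\<theta>(x, y) F(z, \<xi>)\<close> is left.
\<close>

lemma reeb_curvature_zero:
  assumes dim: "DIM('e) = 2 * n + 1" and one: "n = 1 \<longrightarrow> (\<forall>p. \<forall>v\<in>tangent_space A p. F p (\<xi> p) v = 0)"
    and v: "v \<in> tangent_space A p"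
  shows "F p (\<xi> p) v = 0"
proof (cases "n = 1")
  case False
  note rt = vf_tangent[OF reeb_vf, of p]
  let ?z = "\<lambda>u. 1 * v u + (- \<theta> p v) * \<xi> p u"
  note zE = contact_part[OF v]
  have "F p ?z (\<xi> p) = 0"
  proof (cases "?z = (\<lambda>_. 0)")
    case True
    then show ?thesis using curvature_form_lincomb(1)[OF v v rt, of 0 0] by simp
  next
    case z: False
    then have "n \<noteq> 0" using contact_trivial_if_dim_1[OF _ zE] dim by auto
    then have "DIM('e) > 3" using dim False by simp
    from orthogonal_pair[OF zE z this] obtain x y where "x \<in> contact_distribution A \<theta> p" "y \<in> contact_distribution A \<theta> p"
      "d\<theta> p ?z x = 0" "d\<theta> p y ?z = 0" "d\<theta> p x y \<noteq> 0"
      by blast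
    then show ?thesis using reeb_curvature_cyclic[OF _ _ zE, of x y] by simp
  qed
  moreover have "F p (\<xi> p) (\<xi> p) = 0" using curvature_form_lincomb(2)[OF rt rt rt] by simp
  ultimately have "F p v (\<xi> p) = 0"
    using curvature_form_lincomb(1)[OF v rt rt, of 1 "- \<theta> p v"] by simp
  then show ?thesis using curvature_form_lincomb(2)[OF v v rt] by simp
qed (use one v in blast)

abbreviation Q :: "('m \<Rightarrow> real) \<Rightarrow> ('m, 'l) sect \<Rightarrow> ('m, 'l) sect" where
  "Q \<equiv> quantum_operator L D \<Lambda> \<xi>"

lemma Q_section [simp]: "smooth A f \<Longrightarrow> s \<in> S \<Longrightarrow> Q f s \<in> S"
  unfolding quantum_operator_def by simp

lemma coo_Q:
  "smooth A f \<Longrightarrow> s \<in> S \<Longrightarrow> coo p (Q f s p) = coo p (D (ham f) s p) + \<i> * of_real (f p) * coo p (s p)"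
  unfolding quantum_operator_def by simp

lemma Q_add: "smooth A f \<Longrightarrow> s \<in> S \<Longrightarrow> t \<in> S \<Longrightarrow> Q f (sec_add L s t) = sec_add L (Q f s) (Q f t)"
  by (rule section_eqI) (simp_all add: coo_Q algebra_simps)

lemma Q_scale: "smooth A f \<Longrightarrow> s \<in> S \<Longrightarrow> Q f (sec_scale L (\<lambda>_. a) s) = sec_scale L (\<lambda>_. a) (Q f s)"
  by (rule section_eqI) (simp_all add: coo_Q vf_apply_const algebra_simps)

lemma Q_lincomb:
  assumes "smooth A f" "smooth A g" "s \<in> S"
  shows "Q (\<lambda>p. a * f p + b * g p) s
    = sec_add L (sec_scale L (\<lambda>_. of_real a) (Q f s)) (sec_scale L (\<lambda>_. of_real b) (Q g s))"
  using assms by (intro section_eqI) (simp_all add: coo_Q ham_lincomb algebra_simps)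

text \<open>
  In the commutator, curvature contributes \<open>- \<i> {f,g}\<close> and the derivatives of the multiplication
  terms contribute \<open>2 \<i> {f,g}\<close>.
\<close>

lemma Q_commutator:
  assumes reeb0: "\<And>p v. v \<in> tangent_space A p \<Longrightarrow> F p (\<xi> p) v = 0"
    and f: "f \<in> basic_functions A \<xi>" and g: "g \<in> basic_functions A \<xi>" and s: "s \<in> S"
  shows "sec_diff L (Q f (Q g s)) (Q g (Q f s)) = Q (jacobi_bracket \<Lambda> \<xi> f g) s"
proof (rule section_eqI)
  note sf = basicD(1)[OF f] and sg = basicD(1)[OF g]
  note k = jacobi_bracket_closed[OF f g]
  note X = ham_vf[OF sf] ham_vf[OF sg]
  show "sec_diff L (Q f (Q g s)) (Q g (Q f s)) \<in> S" "Q (jacobi_bracket \<Lambda> \<xi> f g) s \<in> S"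
    using sf sg s basicD(1)[OF k] by simp_all
  fix p
  note rt = vf_tangent[OF reeb_vf, of p]
  \<comment> \<open>the Reeb components drop out, and the quantum condition applies to what is left\<close>
  have curv: "F p (ham f p) (ham g p) = - \<i> * of_real (ham f p g)"
  proof -
    have hE: "\<Lambda> (differential u) p \<in> contact_distribution A \<theta> p" if "smooth A u" for u
      using sharp_differential[OF that] by (simp add: contact_distribution_def vf_tangent)
    have right: "F p v (\<xi> p) = 0" if "v \<in> tangent_space A p" for v
      using reeb0[OF that] curvature_form_lincomb(2)[OF that that rt] by simp
    note tf = contactD(1)[OF hE[OF sf]] and tg = contactD(1)[OF hE[OF sg]]
    have "F p (ham f p) (ham g p) = F p (\<Lambda> (differential f) p) (\<Lambda> (differential g) p)"
      using curvature_form_lincomb(1)[OF tf rt vf_tangent[OF X(2)], of 1 "f p", folded ham_at]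
        curvature_form_lincomb_right[OF tg rt tf, of 1 "g p", folded ham_at]
        reeb0[OF vf_tangent[OF X(2)]] right[OF tf] by simp
    also have "\<dots> = \<i> * of_real (- d\<theta> p (\<Lambda> (differential f) p) (\<Lambda> (differential g) p))"
      by (rule quantum[OF hE[OF sf] hE[OF sg]])
    also have "d\<theta> p (\<Lambda> (differential f) p) (\<Lambda> (differential g) p) = d\<theta> p (ham f p) (ham g p)"
      using ext_deriv_lincomb(1)[OF \<theta> tf rt vf_tangent[OF X(2)], of 1 "f p", folded ham_at]
        ext_deriv_lincomb(2)[OF \<theta> tg rt tf, of 1 "g p", folded ham_at]
        d\<theta>_reeb[OF vf_tangent[OF X(2)]] d\<theta>_reeb_right[OF tf] by simp
    also have "\<dots> = ham f p g" using ext_deriv_dform[OF \<theta> X, of p] dform_ham_ham(1)[OF f g, of p] by simp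
    finally show ?thesis by simp
  qed
  have h1: "coo p (D (ham f) (Q g s) p) = coo p (D (ham f) (D (ham g) s) p)
      + \<i> * of_real (g p) * coo p (D (ham f) s p) + \<i> * of_real (ham f p g) * coo p (s p)"
    using X s sg unfolding quantum_operator_def by (simp add: vf_apply_i_of_real algebra_simps)
  have h2: "coo p (D (ham g) (Q f s) p) = coo p (D (ham g) (D (ham f) s) p)
      + \<i> * of_real (f p) * coo p (D (ham g) s p) - \<i> * of_real (ham f p g) * coo p (s p)"
    using X s sf unfolding quantum_operator_def
    by (simp add: vf_apply_i_of_real dform_ham_ham(2)[OF f g] algebra_simps)
  have h3: "K (ham f) (ham g) s p = - \<i> * of_real (ham f p g) * coo p (s p)"
    using K_curvature_form[OF X s, of p] curv by simp
  have left: "coo p (sec_diff L (Q f (Q g s)) (Q g (Q f s)) p)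
    = (coo p (D (ham f) (Q g s) p) + \<i> * of_real (f p) * (coo p (D (ham g) s p) + \<i> * of_real (g p) * coo p (s p)))
    - (coo p (D (ham g) (Q f s) p) + \<i> * of_real (g p) * (coo p (D (ham f) s p) + \<i> * of_real (f p) * coo p (s p)))"
    using sf sg s by (simp add: coo_Q)
  have right: "coo p (Q (jacobi_bracket \<Lambda> \<xi> f g) s p)
    = coo p (D (lie_bracket (ham f) (ham g)) s p) + \<i> * of_real (ham f p g) * coo p (s p)"
    unfolding coo_Q[OF basicD(1)[OF k] s] lie_bracket_ham[OF f g] by (simp add: jacobi_bracket_basic[OF f])
  show "coo p (sec_diff L (Q f (Q g s)) (Q g (Q f s)) p) = coo p (Q (jacobi_bracket \<Lambda> \<xi> f g) s p)"
    unfolding left right h1 h2 using h3 unfolding K_def by algebra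
qed

end

section \<open>The divergence theorem for compactly supported functions\<close>

text \<open>
  The integral of a derivative along \<open>b\<close> is the limit of the integrals of difference quotients, and
  these vanish by translation invariance. A uniform bound on the derivative dominates the quotients.
\<close>

lemma integral_directional_derivative:
  fixes \<phi> :: "'e::euclidean_space \<Rightarrow> real"
  assumes K: "compact K" "\<And>x. x \<notin> K \<Longrightarrow> \<phi> x = 0"
    and der: "\<And>x. (\<phi> has_derivative \<phi>' x) (at x)" and cont: "continuous_on UNIV (\<lambda>x. \<phi>' x b)"
  shows "integrable lborel (\<lambda>x. \<phi>' x b)" "(LINT x|lborel. \<phi>' x b) = 0"
proof -
  define g where "g x = \<phi>' x b" for x
  have intc: "integrable lborel f" if "continuous_on UNIV f" "\<And>x. x \<notin> K \<Longrightarrow> f x = 0" for f :: "'e \<Rightarrow> real"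
  proof -
    have "integrable lborel (\<lambda>x. indicator K x *\<^sub>R f x)"
      using borel_integrable_compact[OF K(1)] continuous_on_subset[OF that(1)] by blast
    moreover have "(\<lambda>x. indicator K x *\<^sub>R f x) = f"
      by (rule ext) (use that(2) in \<open>auto simp: indicator_def\<close>)
    ultimately show ?thesis by simp
  qed
  have g0: "g x = 0" if "x \<notin> K" for x
  proof -
    have "((\<lambda>_. 0) has_derivative \<phi>' x) (at x)"
      by (rule has_derivative_transform_within_open[OF der, of "- K"])
        (use K that compact_imp_closed in auto)
    then have "\<phi>' x = (\<lambda>_. 0)" using has_derivative_unique has_derivative_const by blast
    then show ?thesis by (simp add: g_def)
  qed
  have gc: "continuous_on UNIV g" using cont by (simp add: g_def)
  show "integrable lborel (\<lambda>x. \<phi>' x b)" using intc[OF gc g0] by (simp add: g_def[abs_def])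
  have "bounded (g ` K)"
    using compact_continuous_image[OF continuous_on_subset[OF gc] K(1)] compact_imp_bounded by blast
  then obtain M where M: "\<And>x. x \<in> K \<Longrightarrow> \<bar>g x\<bar> \<le> M"
    unfolding bounded_iff by auto
  have M': "\<bar>g x\<bar> \<le> \<bar>M\<bar>" for x using M[of x] g0[of x] by (cases "x \<in> K") auto
  obtain R where R: "\<And>x. x \<in> K \<Longrightarrow> norm x \<le> R"
    using compact_imp_bounded[OF K(1)] unfolding bounded_iff by blast
  \<comment> \<open>the difference quotient for the step \<open>1 / (k + 1)\<close>\<close>
  define s where "s k x = real (Suc k) * (\<phi> (x + inverse (real (Suc k)) *\<^sub>R b) - \<phi> x)" for k x
  have line: "((\<lambda>t. \<phi> (x + t *\<^sub>R b)) has_real_derivative g (x + t *\<^sub>R b)) (at t)" for x t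
  proof -
    have lin: "linear (\<phi>' (x + t *\<^sub>R b))" using der has_derivative_linear by blast
    have "((\<lambda>t. \<phi> (x + t *\<^sub>R b)) has_derivative (\<lambda>v. \<phi>' (x + t *\<^sub>R b) (v *\<^sub>R b))) (at t)"
      by (rule has_derivative_compose[OF _ der]) (auto intro!: derivative_eq_intros)
    then show ?thesis
      unfolding has_field_derivative_def g_def linear_cmul[OF lin] by (simp add: mult_commute_abs)
  qed
  have pc: "continuous_on UNIV \<phi>"
    using der has_derivative_continuous by (simp add: continuous_on_eq_continuous_within) blast
  have \<phi>i: "integrable lborel \<phi>" using intc[OF pc K(2)] .
  have shift: "integrable lborel (\<lambda>x. \<phi> (x + c))" "(LINT x|lborel. \<phi> (x + c)) = (LINT x|lborel. \<phi> x)" for c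
  proof -
    have m: "(+) c \<in> measurable lborel borel" "\<phi> \<in> borel_measurable borel"
      using borel_measurable_continuous_onI[OF pc] by auto
    have "integrable (distr lborel borel ((+) c)) \<phi>" using \<phi>i by (simp add: lborel_distr_plus)
    then show "integrable lborel (\<lambda>x. \<phi> (x + c))"
      using integrable_distr_eq[OF m] by (simp add: add.commute)
    have "(LINT x|distr lborel borel ((+) c). \<phi> x) = (LINT x|lborel. \<phi> (c + x))"
      by (rule integral_distr[OF m])
    then show "(LINT x|lborel. \<phi> (x + c)) = (LINT x|lborel. \<phi> x)"
      by (simp add: lborel_distr_plus add.commute)
  qed
  have s_int: "(LINT x|lborel. s k x) = 0" for k
    unfolding s_def using shift \<phi>i by simp
  have bound: "norm (s k x) \<le> \<bar>M\<bar> * indicator (cball 0 (R + norm b)) x" for k x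
  proof -
    let ?t = "inverse (real (Suc k))"
    have t: "0 < ?t" "?t \<le> 1" by (simp_all add: inverse_le_1_iff)
    obtain z where z: "0 < z" "z < ?t" "\<phi> (x + ?t *\<^sub>R b) - \<phi> (x + 0 *\<^sub>R b) = (?t - 0) * g (x + z *\<^sub>R b)"
      using MVT2[OF t(1), of "\<lambda>t. \<phi> (x + t *\<^sub>R b)" "\<lambda>t. g (x + t *\<^sub>R b)"] line by blast
    then have s: "s k x = g (x + z *\<^sub>R b)" by (simp add: s_def)
    show ?thesis
    proof (cases "x \<in> cball 0 (R + norm b)")
      case True
      then show ?thesis using M' by (simp add: s)
    next
      case False
      have "norm (z *\<^sub>R b) \<le> norm b" using z t by (simp add: mult_left_le_one_le)
      then have "norm (x + z *\<^sub>R b) > R" using False norm_diff_ineq[of x "z *\<^sub>R b"] by simp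
      then have "x + z *\<^sub>R b \<notin> K" using R by force
      then show ?thesis using g0 by (simp add: s)
    qed
  qed
  have lim: "(\<lambda>k. s k x) \<longlonglongrightarrow> g x" for x
  proof -
    have "((\<lambda>h. (\<phi> (x + h *\<^sub>R b) - \<phi> x) / h) \<longlongrightarrow> g x) (at 0)"
      using line[of x 0] by (simp add: DERIV_def)
    moreover have "filterlim (\<lambda>k. inverse (real (Suc k))) (at 0) sequentially"
      using LIMSEQ_inverse_real_of_nat by (simp add: filterlim_at)
    ultimately have "(\<lambda>k. (\<phi> (x + inverse (real (Suc k)) *\<^sub>R b) - \<phi> x) / inverse (real (Suc k))) \<longlonglongrightarrow> g x"
      by (rule filterlim_compose)
    then show ?thesis by (simp add: s_def divide_inverse mult.commute)
  qed
  have "(\<lambda>k. LINT x|lborel. s k x) \<longlonglongrightarrow> (LINT x|lborel. g x)"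
  proof (rule integral_dominated_convergence)
    show "g \<in> borel_measurable lborel" using borel_measurable_continuous_onI[OF gc] by simp
    show "s k \<in> borel_measurable lborel" for k
      using shift(1) \<phi>i unfolding s_def[abs_def] by (intro borel_measurable_integrable) simp
    show "integrable lborel (\<lambda>x. \<bar>M\<bar> * indicator (cball 0 (R + norm b)) x)"
      using borel_integrable_compact[OF compact_cball, of 0 "R + norm b" "\<lambda>_. \<bar>M\<bar>"]
      by (simp add: mult.commute)
  qed (use bound lim in auto)
  then have "(LINT x|lborel. g x) = 0" unfolding s_int using LIMSEQ_unique tendsto_const by blast
  then show "(LINT x|lborel. \<phi>' x b) = 0" by (simp add: g_def)
qed

section \<open>The contact volume form\<close>

lemma sum_odd_even_split: "(\<Sum>m\<le>2 * n. g m) = g 0 + (\<Sum>k<n. g (2 * k + 1) + g (2 * k + 2 :: nat))"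
  for g :: "nat \<Rightarrow> 'a::comm_monoid_add"
  by (induction n) (simp_all add: ac_simps)

context smooth_manifold
begin

text \<open>
  The summand of the top form before antisymmetrisation. It is multilinear in its arguments, and a
  field preserving \<open>\<eta>\<close> acts on it by the product rule, position by position.
\<close>

definition premonomial :: "nat \<Rightarrow> 'm one_form \<Rightarrow> 'm \<Rightarrow> (nat \<Rightarrow> 'm tangent) \<Rightarrow> real" where
  "premonomial n \<eta> p x = \<eta> p (x 0) * (\<Prod>k<n. ext_deriv A \<eta> p (x (2 * k + 1)) (x (2 * k + 2)))"

lemma contact_top_form_premonomial:
  "contact_top_form A n \<eta> p e =
    (1 / 2 ^ n) * (\<Sum>\<sigma> | \<sigma> permutes {..2 * n}. of_int (sign \<sigma>) * premonomial n \<eta> p (e \<circ> \<sigma>))"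
  by (simp add: contact_top_form_def premonomial_def mult.assoc)

lemma premonomial_cong: "(\<And>m. m \<le> 2 * n \<Longrightarrow> x m = y m) \<Longrightarrow> premonomial n \<eta> p x = premonomial n \<eta> p y"
  unfolding premonomial_def by (auto intro!: arg_cong2[where f="(*)"] prod.cong)

lemma premonomial_upd:
  "premonomial n \<eta> p (x(0 := v)) = \<eta> p v * (\<Prod>k<n. ext_deriv A \<eta> p (x (2 * k + 1)) (x (2 * k + 2)))"
  "j < n \<Longrightarrow> premonomial n \<eta> p (x(2 * j + 1 := v)) = \<eta> p (x 0) * (ext_deriv A \<eta> p v (x (2 * j + 2)) *
     (\<Prod>k\<in>{..<n} - {j}. ext_deriv A \<eta> p (x (2 * k + 1)) (x (2 * k + 2))))"
  "j < n \<Longrightarrow> premonomial n \<eta> p (x(2 * j + 2 := v)) = \<eta> p (x 0) * (ext_deriv A \<eta> p (x (2 * j + 1)) v *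
     (\<Prod>k\<in>{..<n} - {j}. ext_deriv A \<eta> p (x (2 * k + 1)) (x (2 * k + 2))))"
proof -
  show "premonomial n \<eta> p (x(0 := v)) = \<eta> p v * (\<Prod>k<n. ext_deriv A \<eta> p (x (2 * k + 1)) (x (2 * k + 2)))"
    by (simp add: premonomial_def)
  assume j: "j < n"
  have odd: "2 * k + 2 \<noteq> 2 * i + 1" for i k :: nat by presburger
  show "premonomial n \<eta> p (x(2 * j + 1 := v)) = \<eta> p (x 0) * (ext_deriv A \<eta> p v (x (2 * j + 2)) *
     (\<Prod>k\<in>{..<n} - {j}. ext_deriv A \<eta> p (x (2 * k + 1)) (x (2 * k + 2))))"
    unfolding premonomial_def using j odd
    by (subst prod.remove[of _ j]) (auto intro!: prod.cong simp del: add_2_eq_Suc')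
  show "premonomial n \<eta> p (x(2 * j + 2 := v)) = \<eta> p (x 0) * (ext_deriv A \<eta> p (x (2 * j + 1)) v *
     (\<Prod>k\<in>{..<n} - {j}. ext_deriv A \<eta> p (x (2 * k + 1)) (x (2 * k + 2))))"
    unfolding premonomial_def using j odd odd[symmetric]
    by (subst prod.remove[of _ j]) (auto intro!: prod.cong simp del: add_2_eq_Suc')
qed

lemma position_cases:
  fixes m n :: nat
  assumes "m \<le> 2 * n"
  obtains "m = 0" | j where "j < n" "m = 2 * j + 1" | j where "j < n" "m = 2 * j + 2"
proof -
  have "m = 0 \<or> (\<exists>j<n. m = 2 * j + 1) \<or> (\<exists>j<n. m = 2 * j + 2)"
  proof (cases m)
    case (Suc k)
    then show ?thesis using assms
      by (cases "even k") (auto elim!: evenE oddE)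
  qed simp
  then show ?thesis using that by blast
qed

lemma premonomial_linear:
  assumes \<eta>: "\<eta> \<in> one_forms A" and m: "m \<le> 2 * n" and x: "\<And>i. i \<le> 2 * n \<Longrightarrow> x i \<in> tangent_space A p"
    and v: "v \<in> tangent_space A p" "w \<in> tangent_space A p"
  shows "premonomial n \<eta> p (x(m := (\<lambda>u. a * v u + b * w u)))
    = a * premonomial n \<eta> p (x(m := v)) + b * premonomial n \<eta> p (x(m := w))"
  using m
proof (cases rule: position_cases)
  case 1
  then show ?thesis
    by (simp add: premonomial_upd one_form_lincomb[OF \<eta> v] algebra_simps)
next
  case (2 j)
  have "ext_deriv A \<eta> p (\<lambda>u. a * v u + b * w u) (x (2 * j + 2))
      = a * ext_deriv A \<eta> p v (x (2 * j + 2)) + b * ext_deriv A \<eta> p w (x (2 * j + 2))"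
    using 2 by (intro ext_deriv_lincomb(1)[OF \<eta> v] x) auto
  then show ?thesis unfolding 2(2) premonomial_upd(2)[OF 2(1)] by (simp only:) (simp add: algebra_simps)
next
  case (3 j)
  have "ext_deriv A \<eta> p (x (2 * j + 1)) (\<lambda>u. a * v u + b * w u)
      = a * ext_deriv A \<eta> p (x (2 * j + 1)) v + b * ext_deriv A \<eta> p (x (2 * j + 1)) w"
    using 3 by (intro ext_deriv_lincomb(2)[OF \<eta> v] x) auto
  then show ?thesis unfolding 3(2) premonomial_upd(3)[OF 3(1)] by (simp only:) (simp add: algebra_simps)
qed

lemma premonomial_smooth:
  assumes \<eta>: "\<eta> \<in> one_forms A" and Z: "\<And>i. Z i \<in> vector_fields A"
  shows "smooth A (\<lambda>q. premonomial n \<eta> q (\<lambda>i. Z i q))"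
  unfolding premonomial_def ext_deriv_dform[OF \<eta> Z Z] using \<eta> Z by simp

lemma premonomial_derivation:
  assumes \<eta>: "\<eta> \<in> one_forms A" and X: "preserves X \<eta>" and Z: "\<And>i. Z i \<in> vector_fields A"
  shows "X p (\<lambda>q. premonomial n \<eta> q (\<lambda>i. Z i q))
      = (\<Sum>m\<le>2 * n. premonomial n \<eta> p ((\<lambda>i. Z i p)(m := lie_bracket X (Z m) p)))"
proof -
  have Xv: "X \<in> vector_fields A" using X by (simp add: preserves_def)
  let ?d = "\<lambda>k. dform \<eta> (Z (2 * k + 1)) (Z (2 * k + 2))"
  have pm: "premonomial n \<eta> q (\<lambda>i. Z i q) = \<eta> q (Z 0 q) * (\<Prod>k<n. ?d k q)" for q
    unfolding premonomial_def ext_deriv_dform[OF \<eta> Z Z] ..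
  have s: "smooth A (\<lambda>q. \<Prod>k<n. ?d k q)" "smooth A (\<lambda>q. \<eta> q (Z 0 q))"
    using \<eta> Z by simp_all
  have "X p (\<lambda>q. \<Prod>k<n. ?d k q) = (\<Sum>k<n. X p (?d k) * (\<Prod>l\<in>{..<n} - {k}. ?d l p))"
    by (rule tangent_prod[OF vf_tangent[OF Xv]]) (use \<eta> Z in simp_all)
  moreover have "X p (?d k) = dform \<eta> (lie_bracket X (Z (2 * k + 1))) (Z (2 * k + 2)) p
      + dform \<eta> (Z (2 * k + 1)) (lie_bracket X (Z (2 * k + 2))) p" for k
    by (rule preserves_dform[OF \<eta> X Z Z])
  moreover have "X p (\<lambda>q. \<eta> q (Z 0 q)) = \<eta> p (lie_bracket X (Z 0) p)"
    using X Z by (simp add: preserves_def)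
  ultimately have "X p (\<lambda>q. premonomial n \<eta> q (\<lambda>i. Z i q)) = \<eta> p (lie_bracket X (Z 0) p) * (\<Prod>k<n. ?d k p)
      + \<eta> p (Z 0 p) * (\<Sum>k<n. (dform \<eta> (lie_bracket X (Z (2 * k + 1))) (Z (2 * k + 2)) p
      + dform \<eta> (Z (2 * k + 1)) (lie_bracket X (Z (2 * k + 2))) p) * (\<Prod>l\<in>{..<n} - {k}. ?d l p))"
    unfolding pm tangent_mult[OF vf_tangent[OF Xv] s(2,1)] by simp
  also have "\<dots> = (\<Sum>m\<le>2 * n. premonomial n \<eta> p ((\<lambda>i. Z i p)(m := lie_bracket X (Z m) p)))"
  proof -
    have b: "lie_bracket X (Z i) \<in> vector_fields A" for i using Xv Z by simp
    have "premonomial n \<eta> p ((\<lambda>i. Z i p)(2 * k + 1 := lie_bracket X (Z (2 * k + 1)) p))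
        + premonomial n \<eta> p ((\<lambda>i. Z i p)(2 * k + 2 := lie_bracket X (Z (2 * k + 2)) p))
      = \<eta> p (Z 0 p) * ((dform \<eta> (lie_bracket X (Z (2 * k + 1))) (Z (2 * k + 2)) p
      + dform \<eta> (Z (2 * k + 1)) (lie_bracket X (Z (2 * k + 2))) p) * (\<Prod>l\<in>{..<n} - {k}. ?d l p))"
      if "k < n" for k
      unfolding premonomial_upd(2,3)[OF that] ext_deriv_dform[OF \<eta> Z Z] ext_deriv_dform[OF \<eta> b Z]
        ext_deriv_dform[OF \<eta> Z b] by (simp only: algebra_simps)
    then show ?thesis
      unfolding sum_odd_even_split premonomial_upd(1) ext_deriv_dform[OF \<eta> Z Z] sum_distrib_left
      by simp
  qed
  finally show "X p (\<lambda>q. premonomial n \<eta> q (\<lambda>i. Z i q))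
      = (\<Sum>m\<le>2 * n. premonomial n \<eta> p ((\<lambda>i. Z i p)(m := lie_bracket X (Z m) p)))" .
qed

lemma upd_comp_perm:
  assumes "\<sigma> permutes S" shows "(e(i := v)) \<circ> \<sigma> = (e \<circ> \<sigma>)(inv \<sigma> i := v)"
proof
  fix m
  have "\<sigma> m = i \<longleftrightarrow> m = inv \<sigma> i" using permutes_inverses[OF assms] by metis
  then show "(e(i := v) \<circ> \<sigma>) m = ((e \<circ> \<sigma>)(inv \<sigma> i := v)) m" by simp
qed

lemma top_form_linear:
  assumes \<eta>: "\<eta> \<in> one_forms A" and i: "i \<le> 2 * n" and e: "\<And>i. i \<le> 2 * n \<Longrightarrow> e i \<in> tangent_space A p"
    and v: "v \<in> tangent_space A p" "w \<in> tangent_space A p"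
  shows "contact_top_form A n \<eta> p (e(i := (\<lambda>u. a * v u + b * w u)))
    = a * contact_top_form A n \<eta> p (e(i := v)) + b * contact_top_form A n \<eta> p (e(i := w))"
proof -
  have "premonomial n \<eta> p (e(i := (\<lambda>u. a * v u + b * w u)) \<circ> \<sigma>)
    = a * premonomial n \<eta> p (e(i := v) \<circ> \<sigma>) + b * premonomial n \<eta> p (e(i := w) \<circ> \<sigma>)"
    if \<sigma>: "\<sigma> permutes {..2 * n}" for \<sigma>
  proof -
    have "inv \<sigma> i \<le> 2 * n" using permutes_in_image[OF permutes_inv[OF \<sigma>]] i by auto
    moreover have "(e \<circ> \<sigma>) j \<in> tangent_space A p" if "j \<le> 2 * n" for j
      using permutes_in_image[OF \<sigma>] that e by auto
    ultimately show ?thesis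
      unfolding upd_comp_perm[OF \<sigma>] by (intro premonomial_linear[OF \<eta> _ _ v]) auto
  qed
  then show ?thesis
    unfolding contact_top_form_premonomial
    by (simp add: sum_distrib_left sum.distrib[symmetric] algebra_simps)
qed

lemma top_form_sum:
  assumes \<eta>: "\<eta> \<in> one_forms A" and i: "i \<le> 2 * n" and e: "\<And>i. i \<le> 2 * n \<Longrightarrow> e i \<in> tangent_space A p"
    and v: "\<And>b. v b \<in> tangent_space A p"
  shows "contact_top_form A n \<eta> p (e(i := (\<lambda>u. \<Sum>b\<in>B. k b * v b u)))
    = (\<Sum>b\<in>B. k b * contact_top_form A n \<eta> p (e(i := v b)))"
proof (induction B rule: infinite_finite_induct)
  case (insert b B)
  have "contact_top_form A n \<eta> p (e(i := (\<lambda>u. k b * v b u + 1 * (\<lambda>u. \<Sum>b\<in>B. k b * v b u) u)))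
    = k b * contact_top_form A n \<eta> p (e(i := v b)) + 1 * contact_top_form A n \<eta> p (e(i := (\<lambda>u. \<Sum>b\<in>B. k b * v b u)))"
    by (rule top_form_linear[OF \<eta> i e v]) (assumption, intro tangent_space_sum tangent_space_scale v)
  then show ?case by (simp only: sum.insert[OF insert(1,2)] insert.IH mult_1)
qed (use top_form_linear[OF \<eta> i e tangent_zero tangent_zero, where a = 0 and b = 0] in
    \<open>simp_all del: fun_upd_apply\<close>)

text \<open>Composing with the transposition of two equal arguments changes the sign of every summand.\<close>

lemma top_form_alternating:
  assumes ij: "i \<le> 2 * n" "j \<le> 2 * n" "i \<noteq> j" "e i = e j"
  shows "contact_top_form A n \<eta> p e = 0"
proof -
  let ?t = "Transposition.transpose i j"
  let ?P = "{\<sigma>. \<sigma> permutes {..2 * n}}"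
  have t: "?t permutes {..2 * n}" using ij by (intro permutes_swap_id) auto
  have e: "e \<circ> ?t = e" using ij(4) by (auto simp: fun_eq_iff Transposition.transpose_def)
  let ?f = "\<lambda>\<sigma>. real_of_int (sign \<sigma>) * premonomial n \<eta> p (e \<circ> \<sigma>)"
  have bij: "bij_betw (\<lambda>\<sigma>. ?t \<circ> \<sigma>) ?P ?P"
    by (rule bij_betwI[of _ _ _ "\<lambda>\<sigma>. ?t \<circ> \<sigma>"])
      (auto intro: permutes_compose[OF _ t] simp: o_assoc)
  have "(\<Sum>\<sigma>\<in>?P. ?f \<sigma>) = (\<Sum>\<sigma>\<in>?P. ?f (?t \<circ> \<sigma>))"
    using sum.reindex_bij_betw[OF bij, of ?f] by simp
  also have "\<dots> = (\<Sum>\<sigma>\<in>?P. - ?f \<sigma>)"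
  proof (rule sum.cong[OF refl])
    fix \<sigma> assume \<sigma>: "\<sigma> \<in> ?P"
    have "permutation ?t" "permutation \<sigma>"
      using t \<sigma> permutation_permutes[of ?t] permutation_permutes[of \<sigma>] by blast+
    then have "sign (?t \<circ> \<sigma>) = - sign \<sigma>" using ij(3) by (simp add: sign_compose sign_swap_id)
    moreover have "e \<circ> (?t \<circ> \<sigma>) = e \<circ> \<sigma>" using e by (simp add: o_assoc)
    ultimately show "?f (?t \<circ> \<sigma>) = - ?f \<sigma>" by simp
  qed
  also have "\<dots> = - (\<Sum>\<sigma>\<in>?P. ?f \<sigma>)" by (rule sum_negf)
  finally have "(\<Sum>\<sigma>\<in>?P. ?f \<sigma>) = 0" by linarith
  then show ?thesis unfolding contact_top_form_premonomial by simp
qed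

lemma top_form_smooth:
  assumes \<eta>: "\<eta> \<in> one_forms A" and Z: "\<And>i. Z i \<in> vector_fields A"
  shows "smooth A (\<lambda>q. contact_top_form A n \<eta> q (\<lambda>i. Z i q))"
  unfolding contact_top_form_premonomial o_def
  by (intro smooth_on_mult smooth_on_sum smooth_on_const premonomial_smooth \<eta> Z)

lemma top_form_derivation:
  assumes \<eta>: "\<eta> \<in> one_forms A" and X: "preserves X \<eta>" and Z: "\<And>i. Z i \<in> vector_fields A"
  shows "X p (\<lambda>q. contact_top_form A n \<eta> q (\<lambda>i. Z i q))
      = (\<Sum>i\<le>2 * n. contact_top_form A n \<eta> p ((\<lambda>i. Z i p)(i := lie_bracket X (Z i) p)))"
proof -
  have Xv: "X \<in> vector_fields A" using X by (simp add: preserves_def)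
  let ?P = "{\<sigma>. \<sigma> permutes {..2 * n}}"
  have o: "(\<lambda>i. Z i q) \<circ> \<sigma> = (\<lambda>i. Z (\<sigma> i) q)" for q \<sigma> by (simp add: o_def)
  note pd = premonomial_derivation[OF \<eta> X, where n = n]
  have s: "smooth A (\<lambda>q. premonomial n \<eta> q (\<lambda>i. Z (\<sigma> i) q))" for \<sigma> :: "nat \<Rightarrow> nat"
    by (rule premonomial_smooth[OF \<eta> Z])
  have perm: "X p (\<lambda>q. premonomial n \<eta> q (\<lambda>i. Z (\<sigma> i) q))
      = (\<Sum>i\<le>2 * n. premonomial n \<eta> p ((\<lambda>i. Z i p)(i := lie_bracket X (Z i) p) \<circ> \<sigma>))" if \<sigma>: "\<sigma> \<in> ?P" for \<sigma>
  proof -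
    have \<sigma>': "\<sigma> permutes {..2 * n}" using \<sigma> by simp
    have "X p (\<lambda>q. premonomial n \<eta> q (\<lambda>i. Z (\<sigma> i) q))
      = (\<Sum>m\<le>2 * n. premonomial n \<eta> p ((\<lambda>i. Z (\<sigma> i) p)(m := lie_bracket X (Z (\<sigma> m)) p)))"
      by (rule pd[OF Z])
    also have "\<dots> = (\<Sum>m\<le>2 * n. premonomial n \<eta> p ((\<lambda>i. Z i p)(\<sigma> m := lie_bracket X (Z (\<sigma> m)) p) \<circ> \<sigma>))"
      unfolding upd_comp_perm[OF \<sigma>'] o permutes_inverses(2)[OF \<sigma>'] ..
    also have "\<dots> = (\<Sum>i\<le>2 * n. premonomial n \<eta> p ((\<lambda>i. Z i p)(i := lie_bracket X (Z i) p) \<circ> \<sigma>))"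
      by (rule sum.reindex_bij_betw[OF permutes_imp_bij[OF \<sigma>'],
            of "\<lambda>i. premonomial n \<eta> p ((\<lambda>i. Z i p)(i := lie_bracket X (Z i) p) \<circ> \<sigma>)"])
    finally show ?thesis .
  qed
  have sg: "smooth A (\<lambda>q. of_int (sign \<sigma>) * premonomial n \<eta> q (\<lambda>i. Z (\<sigma> i) q))" for \<sigma> :: "nat \<Rightarrow> nat"
    by (intro smooth_on_mult smooth_on_const s)
  have "X p (\<lambda>q. contact_top_form A n \<eta> q (\<lambda>i. Z i q))
      = (1 / 2 ^ n) * X p (\<lambda>q. \<Sum>\<sigma>\<in>?P. of_int (sign \<sigma>) * premonomial n \<eta> q (\<lambda>i. Z (\<sigma> i) q))"
    unfolding contact_top_form_premonomial o
    by (rule tangent_cmult[OF vf_tangent[OF Xv]]) (intro smooth_on_sum sg)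
  also have "\<dots> = (1 / 2 ^ n) * (\<Sum>\<sigma>\<in>?P. of_int (sign \<sigma>) * X p (\<lambda>q. premonomial n \<eta> q (\<lambda>i. Z (\<sigma> i) q)))"
    by (simp only: tangent_sum[OF vf_tangent[OF Xv] sg] tangent_cmult[OF vf_tangent[OF Xv] s])
  also have "\<dots> = (1 / 2 ^ n) * (\<Sum>\<sigma>\<in>?P. \<Sum>i\<le>2 * n. of_int (sign \<sigma>) *
      premonomial n \<eta> p ((\<lambda>i. Z i p)(i := lie_bracket X (Z i) p) \<circ> \<sigma>))"
    using perm by (simp add: sum_distrib_left)
  also have "\<dots> = (\<Sum>i\<le>2 * n. contact_top_form A n \<eta> p ((\<lambda>i. Z i p)(i := lie_bracket X (Z i) p)))"
    unfolding contact_top_form_premonomial sum_distrib_left by (rule sum.swap)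
  finally show "X p (\<lambda>q. contact_top_form A n \<eta> q (\<lambda>i. Z i q))
      = (\<Sum>i\<le>2 * n. contact_top_form A n \<eta> p ((\<lambda>i. Z i p)(i := lie_bracket X (Z i) p)))" .
qed

text \<open>
  The density of an invariant volume form satisfies the continuity equation: in a coordinate frame
  the Lie derivative of the volume form is the divergence of \<open>\<tau> X\<close>, because only the diagonal
  coefficients of the brackets \<open>[X, Y b]\<close> survive the alternation.
\<close>

lemma divergence_zero:
  assumes \<eta>: "\<eta> \<in> one_forms A" and X: "preserves X \<eta>" and F: "local_frame V y Y" and q: "q \<in> V"
    and \<beta>: "bij_betw \<beta> {..2 * n} (Basis :: 'e set)"
  defines "\<tau> \<equiv> \<lambda>q. contact_top_form A n \<eta> q (\<lambda>i. Y (\<beta> i) q)"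
  shows "(\<Sum>b\<in>Basis. Y b q (\<lambda>z. \<tau> z * X z (y b))) = 0"
proof -
  note F' = local_frameD[OF F]
  have Xv: "X \<in> vector_fields A" using X by (simp add: preserves_def)
  have s\<tau>: "smooth A \<tau>" unfolding \<tau>_def by (rule top_form_smooth[OF \<eta> F'(3)])
  have Y: "Y b q \<in> tangent_space A q" for b using F'(3) vf_tangent by blast
  have diag: "lie_bracket X (Y b) q (y b) = - Y b q (\<lambda>z. X z (y b))" if b: "b \<in> Basis" for b
  proof -
    have "X q (\<lambda>z. Y b z (y b)) = X q (\<lambda>_. 1)"
      by (rule tangent_local[OF vf_tangent[OF Xv] _ _ F'(1) q]) (use F'(2,3,5) b in auto)
    then show ?thesis using tangent_const[OF vf_tangent[OF Xv]] by (simp add: lie_bracket_def)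
  qed
  have "X q \<tau> = (\<Sum>i\<le>2 * n. contact_top_form A n \<eta> q ((\<lambda>i. Y (\<beta> i) q)(i := lie_bracket X (Y (\<beta> i)) q)))"
    unfolding \<tau>_def by (rule top_form_derivation[OF \<eta> X F'(3)])
  also have "\<dots> = (\<Sum>i\<le>2 * n. - Y (\<beta> i) q (\<lambda>z. X z (y (\<beta> i))) * \<tau> q)"
  proof (rule sum.cong[OF refl])
    fix i assume i: "i \<in> {..2 * n}"
    have \<beta>i: "\<beta> i \<in> Basis" using \<beta> i bij_betwE by blast
    let ?e = "\<lambda>i. Y (\<beta> i) q"
    have br: "lie_bracket X (Y (\<beta> i)) q \<in> tangent_space A q" using Xv F'(3) vf_tangent by simp
    have eq: "lie_bracket X (Y (\<beta> i)) q = (\<lambda>u. \<Sum>b\<in>Basis. lie_bracket X (Y (\<beta> i)) q (y b) * Y b q u)"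
      by (rule ext) (rule F'(4)[OF q br])
    have "contact_top_form A n \<eta> q (?e(i := lie_bracket X (Y (\<beta> i)) q))
      = contact_top_form A n \<eta> q (?e(i := (\<lambda>u. \<Sum>b\<in>Basis. lie_bracket X (Y (\<beta> i)) q (y b) * Y b q u)))"
      by (rule arg_cong[OF eq])
    also have "\<dots> = (\<Sum>b\<in>Basis. lie_bracket X (Y (\<beta> i)) q (y b) * contact_top_form A n \<eta> q (?e(i := Y b q)))"
      by (rule top_form_sum[OF \<eta>]) (use i Y in auto)
    also have "\<dots> = (\<Sum>b\<in>Basis. if b = \<beta> i then lie_bracket X (Y (\<beta> i)) q (y b) * \<tau> q else 0)"
    proof (rule sum.cong[OF refl])
      fix b :: 'e assume b: "b \<in> Basis"
      show "lie_bracket X (Y (\<beta> i)) q (y b) * contact_top_form A n \<eta> q (?e(i := Y b q))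
        = (if b = \<beta> i then lie_bracket X (Y (\<beta> i)) q (y b) * \<tau> q else 0)"
      proof (cases "b = \<beta> i")
        case True
        then have "?e(i := Y b q) = ?e" by auto
        then show ?thesis using True by (simp add: \<tau>_def)
      next
        case False
        obtain j where j: "j \<le> 2 * n" "b = \<beta> j" using \<beta> b unfolding bij_betw_def by auto
        then have "contact_top_form A n \<eta> q (?e(i := Y b q)) = 0"
          using i False by (intro top_form_alternating[of i n j]) auto
        then show ?thesis using False by simp
      qed
    qed
    also have "\<dots> = lie_bracket X (Y (\<beta> i)) q (y (\<beta> i)) * \<tau> q" using \<beta>i by simp
    finally show "contact_top_form A n \<eta> q (?e(i := lie_bracket X (Y (\<beta> i)) q))
      = - Y (\<beta> i) q (\<lambda>z. X z (y (\<beta> i))) * \<tau> q" using diag[OF \<beta>i] by simp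
  qed
  also have "\<dots> = (\<Sum>b\<in>Basis. - Y b q (\<lambda>z. X z (y b)) * \<tau> q)"
    by (rule sum.reindex_bij_betw[OF \<beta>])
  finally have X\<tau>: "X q \<tau> = (\<Sum>b\<in>Basis. - Y b q (\<lambda>z. X z (y b)) * \<tau> q)" .
  have "(\<Sum>b\<in>Basis. Y b q (\<lambda>z. \<tau> z * X z (y b)))
      = (\<Sum>b\<in>Basis. X q (y b) * Y b q \<tau>) + (\<Sum>b\<in>Basis. \<tau> q * Y b q (\<lambda>z. X z (y b)))"
    using s\<tau> Xv F'(2) by (simp add: tangent_mult[OF Y] sum.distrib mult.commute)
  also have "(\<Sum>b\<in>Basis. X q (y b) * Y b q \<tau>) = X q \<tau>"
    using F'(4)[OF q vf_tangent[OF Xv], of \<tau>] by simp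
  finally show ?thesis using X\<tau> by (simp add: sum_negf mult.commute)
qed

text \<open>
  Multilinear expansion of one argument after the other leads to a nonzero value on frame vectors. These
  are distinct by alternation, hence an ordering of the frame.
\<close>

lemma top_form_on_frame:
  assumes \<eta>: "\<eta> \<in> one_forms A" and F: "local_frame V y Y" "p \<in> V" and dim: "DIM('e) = 2 * n + 1"
    and e: "\<And>i. i \<le> 2 * n \<Longrightarrow> e i \<in> tangent_space A p" "contact_top_form A n \<eta> p e \<noteq> 0"
  obtains \<beta> where "bij_betw \<beta> {..2 * n} (Basis :: 'e set)" "contact_top_form A n \<eta> p (\<lambda>i. Y (\<beta> i) p) \<noteq> 0"
proof -
  note F' = local_frameD[OF F(1)]
  have Y: "Y b p \<in> tangent_space A p" for b using F'(3) vf_tangent by blast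
  \<comment> \<open>the first \<open>k\<close> arguments can be replaced by frame vectors\<close>
  have "\<exists>e. (\<forall>i\<le>2 * n. e i \<in> tangent_space A p) \<and> (\<forall>i<k. \<exists>b\<in>Basis. e i = Y b p) \<and> contact_top_form A n \<eta> p e \<noteq> 0"
    if "k \<le> 2 * n + 1" for k
    using that
  proof (induction k)
    case 0
    then show ?case using e by auto
  next
    case (Suc k)
    then obtain e where e: "\<forall>i\<le>2 * n. e i \<in> tangent_space A p" "\<forall>i<k. \<exists>b\<in>Basis. e i = Y b p"
      "contact_top_form A n \<eta> p e \<noteq> 0" by auto
    have k: "k \<le> 2 * n" using Suc.prems by simp
    have ek: "e k = (\<lambda>u. \<Sum>b\<in>Basis. e k (y b) * Y b p u)" using F'(4)[OF F(2)] e(1) k by blast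
    have "contact_top_form A n \<eta> p e = contact_top_form A n \<eta> p (e(k := (\<lambda>u. \<Sum>b\<in>Basis. e k (y b) * Y b p u)))"
      using ek by (metis fun_upd_triv)
    also have "\<dots> = (\<Sum>b\<in>Basis. e k (y b) * contact_top_form A n \<eta> p (e(k := Y b p)))"
      by (rule top_form_sum[OF \<eta> k]) (use e(1) Y in auto)
    finally obtain b where b: "b \<in> Basis" "contact_top_form A n \<eta> p (e(k := Y b p)) \<noteq> 0"
      using e(3) by (metis (no_types, lifting) mult_zero_right sum.neutral)
    show ?case
    proof (rule exI[of _ "e(k := Y b p)"], intro conjI)
      show "\<forall>i\<le>2 * n. (e(k := Y b p)) i \<in> tangent_space A p" using e(1) Y by simp
      show "\<forall>i<Suc k. \<exists>d\<in>Basis. (e(k := Y b p)) i = Y d p" using e(2) b(1) by (auto simp: less_Suc_eq)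
      show "contact_top_form A n \<eta> p (e(k := Y b p)) \<noteq> 0" by (rule b(2))
    qed
  qed
  from this[of "2 * n + 1"] obtain e' where e': "\<forall>i<2 * n + 1. \<exists>b\<in>Basis. e' i = Y b p"
    "contact_top_form A n \<eta> p e' \<noteq> 0" by blast
  then obtain \<beta> where \<beta>: "\<And>i. i \<le> 2 * n \<Longrightarrow> \<beta> i \<in> (Basis :: 'e set)" "\<And>i. i \<le> 2 * n \<Longrightarrow> e' i = Y (\<beta> i) p"
    by (metis Suc_eq_plus1 less_Suc_eq_le)
  have inj: "inj_on \<beta> {..2 * n}"
  proof (rule inj_onI, rule ccontr)
    fix i j assume "i \<in> {..2 * n}" "j \<in> {..2 * n}" "\<beta> i = \<beta> j" "i \<noteq> j"
    then have "contact_top_form A n \<eta> p e' = 0" using \<beta>(2) by (intro top_form_alternating[of i n j]) auto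
    then show False using e'(2) by blast
  qed
  have "\<beta> ` {..2 * n} = Basis"
    by (rule card_subset_eq) (use \<beta>(1) dim card_image[OF inj] in auto)
  then have "bij_betw \<beta> {..2 * n} (Basis :: 'e set)" using inj by (simp add: bij_betw_def)
  moreover have "contact_top_form A n \<eta> p (\<lambda>i. Y (\<beta> i) p) = contact_top_form A n \<eta> p e'"
  proof -
    have "premonomial n \<eta> p ((\<lambda>i. Y (\<beta> i) p) \<circ> \<sigma>) = premonomial n \<eta> p (e' \<circ> \<sigma>)" if \<sigma>: "\<sigma> permutes {..2 * n}" for \<sigma>
      by (rule premonomial_cong) (use permutes_in_image[OF \<sigma>] \<beta>(2) in auto)
    then show ?thesis unfolding contact_top_form_premonomial by simp
  qed
  ultimately show ?thesis using that e'(2) by simp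
qed

end

section \<open>Integration against the contact volume\<close>

lemma continuous_on_zero_extension:
  fixes f :: "'a::t2_space \<Rightarrow> 'b::real_normed_vector"
  assumes "open B" "compact K" "K \<subseteq> B" "continuous_on B f" "\<And>x. x \<notin> K \<Longrightarrow> f x = 0"
  shows "continuous_on UNIV f"
proof -
  have "continuous_on (- K) f" using assms(5) by (auto intro: continuous_on_eq[OF continuous_on_const])
  moreover have "open (- K)" using assms(2) compact_imp_closed by blast
  ultimately have "continuous_on (B \<union> - K) f" using assms by (intro continuous_on_open_Un) auto
  moreover have "B \<union> - K = UNIV" using assms(3) by blast
  ultimately show ?thesis by simp
qed

locale contact_measure = smooth_manifold A
  for A :: "('m::t2_space, 'e::euclidean_space) chart set" +
  fixes n :: nat and \<theta> :: "'m one_form" and \<mu> :: "'m measure"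
  assumes ccm: "compact_contact_manifold A n \<theta>" and vol: "contact_volume A n \<theta> \<mu>"
begin

lemma \<theta>: "\<theta> \<in> one_forms A"
  using ccm unfolding compact_contact_manifold_def contact_form_def by blast

lemma sets_\<mu> [measurable_cong, simp]: "sets \<mu> = sets borel"
  using vol unfolding contact_volume_def by blast

lemma space_\<mu> [simp]: "space \<mu> = UNIV"
  using sets_eq_imp_space_eq[OF sets_\<mu>] by simp

text \<open>
  A chart domain in which the coefficient \<open>\<tau>\<close> of the volume form has constant sign \<open>s\<close>, so that the
  density of the volume is the smooth function \<open>s \<tau> / n!\<close>.
\<close>

definition volume_chart :: "('m, 'e) chart \<Rightarrow> 'm \<Rightarrow> real \<Rightarrow> 'm set \<Rightarrow> ('e \<Rightarrow> 'm \<Rightarrow> real) \<Rightarrow>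
    ('e \<Rightarrow> 'm vector_field) \<Rightarrow> (nat \<Rightarrow> 'e) \<Rightarrow> real \<Rightarrow> bool" where
  "volume_chart c p r V y Y \<beta> s \<longleftrightarrow> c \<in> A \<and> p \<in> V \<and> V \<subseteq> fst c \<and> V = chart_inv c ` ball (snd c p) r \<and>
     snd c ` V = ball (snd c p) r \<and> local_frame V y Y \<and>
     (\<forall>q\<in>V. \<forall>b. Y b q = coord_vector A c q b) \<and> bij_betw \<beta> {..2 * n} (Basis :: 'e set) \<and> \<bar>s\<bar> = 1 \<and>
     (\<forall>q\<in>V. s * contact_top_form A n \<theta> q (\<lambda>i. Y (\<beta> i) q) > 0)"

lemma volume_chart_at: obtains c r V y Y \<beta> s where "volume_chart c p r V y Y \<beta> s"
proof -
  obtain c where c: "c \<in> A" "p \<in> fst c" using chart_at .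
  obtain V0 y0 Y0 where F0: "p \<in> V0" "local_frame V0 y0 Y0" "\<And>b q. q \<in> V0 \<Longrightarrow> Y0 b q = coord_vector A c q b"
    by (rule chart_frame[OF c open_UNIV UNIV_I]) (rule that)
  obtain e where e: "\<And>i. i \<le> 2 * n \<Longrightarrow> e i \<in> tangent_space A p" "contact_top_form A n \<theta> p e \<noteq> 0"
    using ccm unfolding compact_contact_manifold_def contact_form_def by blast
  have dim: "DIM('e) = 2 * n + 1" using ccm unfolding compact_contact_manifold_def by blast
  obtain \<beta> where \<beta>: "bij_betw \<beta> {..2 * n} (Basis :: 'e set)" "contact_top_form A n \<theta> p (\<lambda>i. Y0 (\<beta> i) p) \<noteq> 0"
    using top_form_on_frame[OF \<theta> F0(2,1) dim e] by blast
  let ?\<tau> = "\<lambda>q. contact_top_form A n \<theta> q (\<lambda>i. Y0 (\<beta> i) q)"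
  have "smooth A ?\<tau>" by (rule top_form_smooth[OF \<theta> local_frameD(3)[OF F0(2)]])
  then have "continuous_on UNIV ?\<tau>" using smooth_on_continuous by blast
  then have "continuous_on UNIV (\<lambda>q. ?\<tau> q * ?\<tau> p)" by (intro continuous_on_mult continuous_on_const)
  then have "open {q. 0 < ?\<tau> q * ?\<tau> p}" using open_Collect_less[OF continuous_on_const] by blast
  \<comment> \<open>a smaller chart domain, where the coefficient keeps the sign that it has at \<open>p\<close>\<close>
  then have W: "open (V0 \<inter> {q. 0 < ?\<tau> q * ?\<tau> p})" using local_frameD(1)[OF F0(2)] by blast
  have pW: "p \<in> V0 \<inter> {q. 0 < ?\<tau> q * ?\<tau> p}"
    using F0(1) \<beta>(2) by (simp add: zero_less_mult_iff linorder_neq_iff) blast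
  obtain r K V y Y where V: "V = chart_inv c ` ball (snd c p) r" "p \<in> V" "snd c ` V = ball (snd c p) r"
    "V \<subseteq> K" "K \<subseteq> V0 \<inter> {q. 0 < ?\<tau> q * ?\<tau> p}" "K \<subseteq> fst c" "local_frame V y Y"
    "\<And>b q. q \<in> V \<Longrightarrow> Y b q = coord_vector A c q b"
    by (rule chart_frame[OF c W pW]) (rule that)
  have "sgn (?\<tau> p) * contact_top_form A n \<theta> q (\<lambda>i. Y (\<beta> i) q) > 0" if "q \<in> V" for q
  proof -
    have q: "q \<in> V0" "0 < ?\<tau> q * ?\<tau> p" using V(4,5) that by auto
    then have "contact_top_form A n \<theta> q (\<lambda>i. Y (\<beta> i) q) = ?\<tau> q" using V(8)[OF that] F0(3) by simp
    then show ?thesis using q(2) by (auto simp: sgn_if zero_less_mult_iff split: if_splits)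
  qed
  moreover have "\<bar>sgn (?\<tau> p)\<bar> = 1" using \<beta>(2) by (simp add: sgn_if)
  moreover have "V \<subseteq> fst c" using V(4,6) by blast
  ultimately show ?thesis
    using that[of c r V y Y \<beta> "sgn (?\<tau> p)"] c(1) V(1,2,3,7,8) \<beta>(1) unfolding volume_chart_def by blast
qed

context
  fixes c p r V y Y \<beta> s B \<tau>
  assumes vc: "volume_chart c p r V y Y \<beta> s"
  defines "B \<equiv> ball (snd c p) r" and "\<tau> \<equiv> \<lambda>q. contact_top_form A n \<theta> q (\<lambda>i. Y (\<beta> i) q)"
begin

lemma vc_props: "c \<in> A" "p \<in> V" "V \<subseteq> fst c" "V = chart_inv c ` B" "snd c ` V = B" "local_frame V y Y"
  "q \<in> V \<Longrightarrow> Y b q = coord_vector A c q b" "bij_betw \<beta> {..2 * n} (Basis :: 'e set)" "\<bar>s\<bar> = 1"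
  "q \<in> V \<Longrightarrow> s * \<tau> q > 0"
  using vc unfolding volume_chart_def B_def \<tau>_def by blast+

lemma vc_inv: "x \<in> B \<Longrightarrow> chart_inv c x \<in> V" "x \<in> B \<Longrightarrow> snd c (chart_inv c x) = x"
  "q \<in> V \<Longrightarrow> chart_inv c (snd c q) = q" "q \<in> V \<Longrightarrow> snd c q \<in> B" "open B" "open V"
proof -
  note vp = vc_props
  show "x \<in> B \<Longrightarrow> chart_inv c x \<in> V" using vp(4) by blast
  show "x \<in> B \<Longrightarrow> snd c (chart_inv c x) = x" using chart_inv_right[OF vp(1)] vp(3,5) by blast
  show "q \<in> V \<Longrightarrow> chart_inv c (snd c q) = q" using chart_inv_left[OF vp(1)] vp(3) by blast
  show "q \<in> V \<Longrightarrow> snd c q \<in> B" using vp(5) by blast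
  show "open B" unfolding B_def by simp
  show "open V" using local_frameD(1)[OF vp(6)] .
qed

lemma vc_mem:
  assumes "x \<in> B" "W \<subseteq> V"
  shows "x \<in> snd c ` W \<longleftrightarrow> chart_inv c x \<in> W"
proof
  assume "x \<in> snd c ` W"
  then obtain q where "q \<in> W" "x = snd c q" by blast
  then show "chart_inv c x \<in> W" using vc_inv(3)[of q] assms(2) by auto
next
  assume "chart_inv c x \<in> W"
  then have "snd c (chart_inv c x) \<in> snd c ` W" by blast
  then show "x \<in> snd c ` W" using vc_inv(2)[OF assms(1)] by simp
qed

lemma vc_inv_continuous: "continuous_on B (chart_inv c)"
  using continuous_on_subset[OF chart_inv_continuous[OF vc_props(1)]] vc_props(3,5) by blast

lemma vc_continuous:
  assumes "continuous_on UNIV (g :: 'm \<Rightarrow> real)"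
  shows "continuous_on B (\<lambda>x. g (chart_inv c x))"
  using continuous_on_compose2[OF assms vc_inv_continuous] by simp

lemma \<tau>_smooth: "smooth A \<tau>"
  unfolding \<tau>_def by (rule top_form_smooth[OF \<theta> local_frameD(3)[OF vc_props(6)]])

lemma \<tau>_continuous: "continuous_on UNIV \<tau>"
  using smooth_on_continuous[OF \<tau>_smooth] by simp

definition dens :: "'e \<Rightarrow> real" where
  "dens x = indicator B x *\<^sub>R (s * \<tau> (chart_inv c x) / fact n)"

lemma dens_measurable [measurable]: "dens \<in> borel_measurable borel"
  unfolding dens_def
  by (rule borel_measurable_continuous_on_indicator)
    (use vc_inv(5) vc_continuous[OF \<tau>_continuous] in \<open>auto intro!: continuous_intros\<close>)

lemma dens_pos: "x \<in> B \<Longrightarrow> dens x > 0" and dens_nonneg: "dens x \<ge> 0"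
  using vc_props(10)[OF vc_inv(1)] by (auto simp: dens_def indicator_def less_imp_le)

lemma dens_eq:
  assumes "x \<in> B"
  shows "\<bar>contact_top_form A n \<theta> (chart_inv c x) (\<lambda>i. coord_vector A c (chart_inv c x) (\<beta> i)) / fact n\<bar> = dens x"
proof -
  have "\<bar>\<tau> (chart_inv c x)\<bar> = \<bar>s * \<tau> (chart_inv c x)\<bar>" using vc_props(9) by (simp add: abs_mult)
  also have "\<dots> = s * \<tau> (chart_inv c x)" using vc_props(10)[OF vc_inv(1)[OF assms]] by simp
  finally have "\<bar>\<tau> (chart_inv c x)\<bar> = s * \<tau> (chart_inv c x)" .
  then show ?thesis
    using assms vc_props(7)[OF vc_inv(1)[OF assms]] by (simp add: dens_def \<tau>_def)
qed

lemma emeasure_chart: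
  assumes "U \<in> sets borel"
  shows "emeasure \<mu> (V \<inter> U) = (\<integral>\<^sup>+ x. ennreal (dens x) * indicator (snd c ` (V \<inter> U)) x \<partial>lborel)"
proof -
  have "V \<inter> U \<in> sets borel" using assms vc_inv(6) by auto
  then have "emeasure \<mu> (V \<inter> U) = (\<integral>\<^sup>+ x\<in>snd c ` (V \<inter> U). ennreal \<bar>contact_top_form A n \<theta> (chart_inv c x)
      (\<lambda>i. coord_vector A c (chart_inv c x) (\<beta> i)) / fact n\<bar> \<partial>lborel)"
    using vol vc_props(1,3,8) unfolding contact_volume_def by blast
  also have "\<dots> = (\<integral>\<^sup>+ x. ennreal (dens x) * indicator (snd c ` (V \<inter> U)) x \<partial>lborel)"
    by (rule nn_integral_cong) (use dens_eq vc_inv(4) in \<open>auto simp: indicator_def simp del: abs_divide\<close>)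
  finally show ?thesis .
qed

text \<open>The value \<open>p\<close> outside \<open>B\<close> is arbitrary; it makes the inverse chart a total measurable map.\<close>

definition inv0 :: "'e \<Rightarrow> 'm" where "inv0 x = (if x \<in> B then chart_inv c x else p)"

lemma inv0_measurable [measurable]: "inv0 \<in> borel_measurable borel"
proof -
  have "chart_inv c \<in> borel_measurable (restrict_space borel {x. x \<in> B})"
    using borel_measurable_continuous_on_restrict[OF vc_inv_continuous] by simp
  moreover have "{x \<in> space borel. x \<in> B} \<in> sets borel" using vc_inv(5) by simp
  ultimately show ?thesis
    unfolding inv0_def[abs_def] by (subst measurable_If_restrict_space_iff) auto
qed

text \<open>
  The chart formula for the volume, as an identity of measures: in this form it transports integrals
  and not only the measure of sets.
\<close>

lemma volume_distr: "density \<mu> (indicator V) = distr (density lborel (\<lambda>x. ennreal (dens x))) borel inv0"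
proof (rule measure_eqI)
  fix U assume "U \<in> sets (density \<mu> (indicator V))"
  then have U: "U \<in> sets borel" by simp
  have V: "V \<in> sets \<mu>" using vc_inv(6) by simp
  have pre: "inv0 -` U \<in> sets borel" using measurable_sets[OF inv0_measurable U] by simp
  have "emeasure (density \<mu> (indicator V)) U = emeasure \<mu> (V \<inter> U)"
    using emeasure_restricted[OF V] U by simp
  also have "\<dots> = (\<integral>\<^sup>+ x. ennreal (dens x) * indicator (snd c ` (V \<inter> U)) x \<partial>lborel)"
    by (rule emeasure_chart[OF U])
  also have "\<dots> = (\<integral>\<^sup>+ x. ennreal (dens x) * indicator (inv0 -` U) x \<partial>lborel)"
  proof (rule nn_integral_cong)
    fix x
    show "ennreal (dens x) * indicator (snd c ` (V \<inter> U)) x = ennreal (dens x) * indicator (inv0 -` U) x"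
    proof (cases "x \<in> B")
      case True
      have "x \<in> snd c ` (V \<inter> U) \<longleftrightarrow> inv0 x \<in> U"
        using True vc_inv(1)[OF True] vc_mem[OF True Int_lower1] by (simp add: inv0_def)
      then show ?thesis by (simp add: indicator_def)
    qed (simp add: dens_def)
  qed
  also have "\<dots> = emeasure (density lborel (\<lambda>x. ennreal (dens x))) (inv0 -` U)"
    using pre by (simp add: emeasure_density)
  also have "\<dots> = emeasure (distr (density lborel (\<lambda>x. ennreal (dens x))) borel inv0) U"
    using U by (simp add: emeasure_distr)
  finally show "emeasure (density \<mu> (indicator V)) U
    = emeasure (distr (density lborel (\<lambda>x. ennreal (dens x))) borel inv0) U" .
qed simp

lemma chart_integral:
  fixes g :: "'m \<Rightarrow> real"
  assumes g: "continuous_on UNIV g" and K: "compact K" "K \<subseteq> V" "\<And>q. q \<notin> K \<Longrightarrow> g q = 0"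
  shows "integrable \<mu> g" "(LINT q|\<mu>. g q) = (LINT x|lborel. dens x * g (inv0 x))"
proof -
  have gm: "g \<in> borel_measurable borel" using g by (rule borel_measurable_continuous_onI)
  have gm': "g \<in> borel_measurable \<mu>" using gm by simp
  have ind: "indicator V = (\<lambda>q. ennreal (indicator V q))" by (auto simp: indicator_def)
  have ig: "(\<lambda>q. indicator V q *\<^sub>R g q) = g" using K by (auto simp: indicator_def fun_eq_iff)
  have iV: "(indicator V :: 'm \<Rightarrow> real) \<in> borel_measurable \<mu>"
    by (intro borel_measurable_indicator) (simp add: vc_inv(6))
  have comp: "(\<lambda>x. g (inv0 x)) \<in> borel_measurable borel" using gm inv0_measurable by measurable
  have cK: "compact (snd c ` K)"
    by (rule compact_continuous_image[OF continuous_on_subset[OF chart_continuous[OF vc_props(1)]] K(1)])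
      (use K(2) vc_props(3) in blast)
  have KB: "snd c ` K \<subseteq> B" using K(2) vc_inv(4) by blast
  have "integrable lborel (\<lambda>x. indicator (snd c ` K) x *\<^sub>R (s * \<tau> (chart_inv c x) / fact n * g (chart_inv c x)))"
    by (rule borel_integrable_compact[OF cK]) (rule continuous_on_subset[OF _ KB],
      intro continuous_on_mult continuous_on_divide continuous_on_const vc_continuous \<tau>_continuous g, simp)
  moreover have "indicator (snd c ` K) x *\<^sub>R (s * \<tau> (chart_inv c x) / fact n * g (chart_inv c x)) = dens x * g (inv0 x)" for x
  proof (cases "x \<in> B")
    case True
    have "x \<in> snd c ` K \<longleftrightarrow> chart_inv c x \<in> K"
      by (rule vc_mem[OF True K(2)])
    then show ?thesis using True K(3) by (auto simp: dens_def inv0_def indicator_def)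
  next
    case False
    then show ?thesis using KB by (auto simp: dens_def indicator_def)
  qed
  ultimately have int: "integrable lborel (\<lambda>x. dens x * g (inv0 x))" by simp
  have "integrable (density lborel (\<lambda>x. ennreal (dens x))) (\<lambda>x. g (inv0 x))"
    using int comp dens_nonneg by (subst integrable_density) auto
  then have "integrable (density \<mu> (indicator V)) g"
    unfolding volume_distr using gm by (subst integrable_distr_eq) auto
  then have "integrable \<mu> (\<lambda>q. indicator V q *\<^sub>R g q)"
    unfolding ind using gm' iV by (subst (asm) integrable_density) auto
  then show "integrable \<mu> g" unfolding ig .
  have "(LINT q|\<mu>. g q) = (LINT q|\<mu>. indicator V q *\<^sub>R g q)" unfolding ig ..
  also have "\<dots> = (LINT q|density \<mu> (indicator V). g q)"
    unfolding ind using gm' iV by (subst integral_density) auto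
  also have "\<dots> = (LINT x|density lborel (\<lambda>x. ennreal (dens x)). g (inv0 x))"
    unfolding volume_distr using gm by (subst integral_distr) auto
  also have "\<dots> = (LINT x|lborel. dens x * g (inv0 x))"
    using comp dens_nonneg by (subst integral_density) auto
  finally show "(LINT q|\<mu>. g q) = (LINT x|lborel. dens x * g (inv0 x))" .
qed

text \<open>
  By the continuity equation \<open>\<tau> X u\<close> is, in the chart, the divergence of \<open>u \<tau> X\<close>, whose components \<open>w b\<close> have compact
  support and so extend by zero to the whole model space.
\<close>

lemma chart_derivative_integral:
  assumes X: "preserves X \<theta>" and u: "smooth A u" and K: "compact K" "K \<subseteq> V" "\<And>q. q \<notin> K \<Longrightarrow> u q = 0"
  shows "integrable \<mu> (\<lambda>q. X q u)" "(LINT q|\<mu>. X q u) = 0"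
proof -
  note F = vc_props(6) and F' = local_frameD[OF vc_props(6)]
  have Xv: "X \<in> vector_fields A" using X by (simp add: preserves_def)
  have oK: "open (- K)" using K(1) compact_imp_closed by blast
  have local: "v w = 0" if "v \<in> tangent_space A q" "q \<notin> K" "smooth A w" "\<And>q. q \<notin> K \<Longrightarrow> w q = 0" for v w q
    using tangent_local[OF that(1,3) smooth_on_const[of _ 0] oK] that(2,4) tangent_const[OF that(1)] by simp
  have contX: "continuous_on UNIV (\<lambda>q. X q u)"
    using smooth_on_continuous[of UNIV "\<lambda>q. X q u"] Xv u by simp
  have X0: "X q u = 0" if "q \<notin> K" for q using local[OF vf_tangent[OF Xv] that u K(3)] .
  show "integrable \<mu> (\<lambda>q. X q u)" using chart_integral(1)[OF contX K(1,2) X0] .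
  define w where "w b = (\<lambda>z. u z * (\<tau> z * X z (y b)))" for b
  have w: "smooth A (w b)" "\<And>q. q \<notin> K \<Longrightarrow> w b q = 0" for b
    unfolding w_def using u \<tau>_smooth Xv F'(2) K(3) by simp_all
  \<comment> \<open>product rule, with the term in which \<open>\<tau> X\<close> is differentiated removed by the continuity equation\<close>
  have div: "X q u * \<tau> q = (\<Sum>b\<in>Basis. Y b q (w b))" if q: "q \<in> V" for q
  proof -
    have Yt: "Y b q \<in> tangent_space A q" for b using F'(3) vf_tangent by blast
    have "(\<Sum>b\<in>Basis. Y b q (w b)) = (\<Sum>b\<in>Basis. X q (y b) * Y b q u) * \<tau> q
        + u q * (\<Sum>b\<in>Basis. Y b q (\<lambda>z. \<tau> z * X z (y b)))"
    proof -
      have "Y b q (w b) = Y b q u * (\<tau> q * X q (y b)) + u q * Y b q (\<lambda>z. \<tau> z * X z (y b))" for b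
        unfolding w_def by (rule tangent_mult[OF Yt u]) (use \<tau>_smooth Xv F'(2) in simp)
      then show ?thesis
        by (simp only: sum.distrib sum_distrib_left sum_distrib_right) (simp only: mult_ac)
    qed
    moreover have "(\<Sum>b\<in>Basis. Y b q (\<lambda>z. \<tau> z * X z (y b))) = 0"
      unfolding \<tau>_def by (rule divergence_zero[OF \<theta> X F q vc_props(8)])
    moreover have "(\<Sum>b\<in>Basis. X q (y b) * Y b q u) = X q u"
      using F'(4)[OF q vf_tangent[OF Xv], of u] by simp
    ultimately show ?thesis by simp
  qed
  define \<phi> where "\<phi> b x = (if x \<in> B then w b (chart_inv c x) else 0)" for b x
  define \<phi>' where "\<phi>' b x v = (if x \<in> B then coord_vector A c (chart_inv c x) v (w b) else 0)" for b x v
  have cK: "compact (snd c ` K)"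
    by (rule compact_continuous_image[OF continuous_on_subset[OF chart_continuous[OF vc_props(1)]] K(1)])
      (use K(2) vc_props(3) in blast)
  have KB: "snd c ` K \<subseteq> B" using K(2) vc_inv(4) by blast
  have inK: "chart_inv c x \<notin> K" if "x \<in> B" "x \<notin> snd c ` K" for x
    using vc_inv(2)[OF that(1)] that(2) by (metis imageI)
  have \<phi>0: "\<phi> b x = 0" if "x \<notin> snd c ` K" for b x
    using inK[OF _ that] w(2) by (simp add: \<phi>_def)
  have \<phi>der: "(\<phi> b has_derivative \<phi>' b x) (at x)" for b x
  proof (cases "x \<in> B")
    case True
    have "chart_inv c x \<in> fst c" using vc_inv(1)[OF True] vc_props(3) by blast
    moreover have "\<phi>' b x = (\<lambda>v. coord_vector A c (chart_inv c x) v (w b))"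
      using True by (simp add: \<phi>'_def fun_eq_iff)
    ultimately have "((w b \<circ> chart_inv c) has_derivative \<phi>' b x) (at x)"
      using coord_vector_has_derivative[OF vc_props(1) _ w(1), of "chart_inv c x" b] vc_inv(2)[OF True] by simp
    then show ?thesis
      by (rule has_derivative_transform_within_open[OF _ vc_inv(5) True]) (simp add: \<phi>_def)
  next
    case False
    then have "\<phi>' b x = (\<lambda>_. 0)" by (simp add: \<phi>'_def fun_eq_iff)
    moreover have "((\<lambda>_. 0) has_derivative (\<lambda>_. 0)) (at x)" by simp
    then have "(\<phi> b has_derivative (\<lambda>_. 0)) (at x)"
      by (rule has_derivative_transform_within_open[of _ _ _ _ "- (snd c ` K)"])
        (use False KB cK compact_imp_closed \<phi>0 in auto)
    ultimately show ?thesis by simp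
  qed
  have \<phi>Y: "\<phi>' b x b = Y b (chart_inv c x) (w b)" if "x \<in> B" for b x
    using that vc_props(7)[OF vc_inv(1)[OF that]] by (simp add: \<phi>'_def)
  have \<phi>cont: "continuous_on UNIV (\<lambda>x. \<phi>' b x b)" for b
  proof (rule continuous_on_zero_extension[OF vc_inv(5) cK KB])
    have "continuous_on UNIV (\<lambda>q. Y b q (w b))"
      using smooth_on_continuous[of UNIV "\<lambda>q. Y b q (w b)"] F'(3) w(1) by simp
    then show "continuous_on B (\<lambda>x. \<phi>' b x b)"
      by (rule continuous_on_eq[OF vc_continuous]) (simp add: \<phi>Y)
    fix x assume x: "x \<notin> snd c ` K"
    show "\<phi>' b x b = 0"
    proof (cases "x \<in> B")
      case True
      then show ?thesis
        using local[OF vf_tangent[OF F'(3)] inK[OF True x] w] by (simp add: \<phi>Y)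
    qed (simp add: \<phi>'_def)
  qed
  note ibp = integral_directional_derivative[OF cK \<phi>0 \<phi>der \<phi>cont]
  have "dens x * X (inv0 x) u = (\<Sum>b\<in>Basis. (s / fact n) * \<phi>' b x b)" for x
  proof (cases "x \<in> B")
    case True
    have "dens x * X (inv0 x) u = (s / fact n) * (X (chart_inv c x) u * \<tau> (chart_inv c x))"
      using True by (simp add: dens_def inv0_def)
    also have "\<dots> = (s / fact n) * (\<Sum>b\<in>Basis. \<phi>' b x b)"
      unfolding div[OF vc_inv(1)[OF True]] \<phi>Y[OF True] ..
    finally show ?thesis by (simp add: sum_distrib_left)
  qed (simp add: dens_def \<phi>'_def)
  then have "(LINT q|\<mu>. X q u) = (LINT x|lborel. (\<Sum>b\<in>Basis. (s / fact n) * \<phi>' b x b))"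
    using chart_integral(2)[OF contX K(1,2) X0] by simp
  also have "\<dots> = (\<Sum>b\<in>Basis. (s / fact n) * (LINT x|lborel. \<phi>' b x b))"
    using ibp(1) by (subst Bochner_Integration.integral_sum) auto
  also have "\<dots> = 0" using ibp(2) by simp
  finally show "(LINT q|\<mu>. X q u) = 0" .
qed

lemma chart_emeasure_pos:
  assumes U: "open U" "p \<in> U"
  shows "emeasure \<mu> U \<noteq> 0"
proof
  assume z: "emeasure \<mu> U = 0"
  let ?G = "snd c ` (V \<inter> U)"
  have oG: "open ?G"
    using chart_image_open[OF vc_props(1)] U(1) vc_inv(6) vc_props(3) by blast
  have "emeasure \<mu> (V \<inter> U) \<le> emeasure \<mu> U" using U(1) by (intro emeasure_mono) auto
  then have "(\<integral>\<^sup>+ x. ennreal (dens x) * indicator ?G x \<partial>lborel) = 0"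
    using z emeasure_chart[of U] U(1) by simp
  then have "AE x in lborel. ennreal (dens x) * indicator ?G x = 0"
    using oG by (subst (asm) nn_integral_0_iff_AE) auto
  then have "AE x in lborel. x \<in> - ?G"
  proof (rule AE_mp, intro AE_I2 impI)
    fix x assume "ennreal (dens x) * indicator ?G x = 0"
    then show "x \<in> - ?G" using dens_pos[of x] vc_inv(4) by (auto simp: indicator_def split: if_splits)
  qed
  then have "AE x in lebesgue. x \<in> - ?G" by (rule AE_completion)
  then have "snd c p \<in> - ?G" using mem_closed_if_AE_lebesgue[of "- ?G" "snd c p"] oG by auto
  then show False using U(2) vc_props(2) by blast
qed

end

text \<open>A smooth partition of unity reduces the global statements to the charts.\<close>

lemma partition:
  obtains I :: "'m set" and \<psi> :: "'m \<Rightarrow> 'm \<Rightarrow> real" where "finite I" "\<And>p. smooth A (\<psi> p)"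
    "\<And>q. (\<Sum>p\<in>I. \<psi> p q) = 1" "\<And>p u. smooth A u \<Longrightarrow> integrable \<mu> (\<lambda>q. \<psi> p q * u q)"
    "\<And>p X u. preserves X \<theta> \<Longrightarrow> smooth A u \<Longrightarrow> integrable \<mu> (\<lambda>q. X q (\<lambda>z. \<psi> p z * u z))
        \<and> (LINT q|\<mu>. X q (\<lambda>z. \<psi> p z * u z)) = 0"
proof -
  define good where "good \<psi> \<longleftrightarrow> smooth A \<psi> \<and> (\<forall>q. 0 \<le> \<psi> q) \<and> (\<forall>u. smooth A u \<longrightarrow> integrable \<mu> (\<lambda>q. \<psi> q * u q)) \<and>
      (\<forall>X u. preserves X \<theta> \<longrightarrow> smooth A u \<longrightarrow> integrable \<mu> (\<lambda>q. X q (\<lambda>z. \<psi> z * u z)) \<and>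
        (LINT q|\<mu>. X q (\<lambda>z. \<psi> z * u z)) = 0)" for \<psi> :: "'m \<Rightarrow> real"
  have "\<exists>\<psi> N. open N \<and> p \<in> N \<and> good \<psi> \<and> (\<forall>q\<in>N. \<psi> q = 1)" for p
  proof -
    obtain c r V y Y \<beta> s where vc: "volume_chart c p r V y Y \<beta> s" using volume_chart_at .
    obtain \<psi> K N where \<psi>: "open N" "p \<in> N" "compact K" "K \<subseteq> V" "smooth A \<psi>" "\<And>x. 0 \<le> \<psi> x"
      "\<And>x. x \<in> N \<Longrightarrow> \<psi> x = (1::real)" "\<And>x. x \<notin> K \<Longrightarrow> \<psi> x = 0"
      by (rule chart_cutoff[OF vc_props(1)[OF vc] _ vc_inv(6)[OF vc] vc_props(2)[OF vc]])
        (use vc_props(2,3)[OF vc] in blast, rule that)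
    have i: "integrable \<mu> (\<lambda>q. \<psi> q * u q)" if u: "smooth A u" for u
    proof (rule chart_integral(1)[OF vc _ \<psi>(3,4)])
      show "continuous_on UNIV (\<lambda>q. \<psi> q * u q)"
        using smooth_on_continuous[of UNIV "\<lambda>q. \<psi> q * u q"] \<psi>(5) u by simp
    qed (use \<psi>(8) in simp)
    have d: "integrable \<mu> (\<lambda>q. X q (\<lambda>z. \<psi> z * u z)) \<and> (LINT q|\<mu>. X q (\<lambda>z. \<psi> z * u z)) = 0"
      if X: "preserves X \<theta>" and u: "smooth A u" for X u
      using chart_derivative_integral[OF vc X _ \<psi>(3,4), of "\<lambda>z. \<psi> z * u z"] \<psi>(5,8) u by simp
    have "good \<psi>" unfolding good_def using \<psi>(5,6) i d by simp
    then show ?thesis using \<psi>(1,2,7) by blast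
  qed
  then obtain \<psi> N where N: "\<And>p. open (N p)" "\<And>p. p \<in> N p" "\<And>p. good (\<psi> p)"
    "\<And>p q. q \<in> N p \<Longrightarrow> \<psi> p q = 1"
    by metis
  note \<psi> = N(3)[unfolded good_def]
  have \<psi>d: "integrable \<mu> (\<lambda>q. X q (\<lambda>z. \<psi> p z * u z)) \<and> (LINT q|\<mu>. X q (\<lambda>z. \<psi> p z * u z)) = 0"
    if "preserves X \<theta>" "smooth A u" for p X u
    using \<psi>[of p] that by simp
  have cpt: "compact (UNIV :: 'm set)" using ccm unfolding compact_contact_manifold_def by blast
  obtain I where I: "finite I" "UNIV \<subseteq> (\<Union>p\<in>I. N p)"
    by (rule compactE_image[OF cpt, of UNIV N]) (use N(1) in blast, use N(2) in blast, rule that)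
  define T where "T q = (\<Sum>p\<in>I. \<psi> p q)" for q
  have T: "T q > 0" for q
  proof -
    obtain p where "p \<in> I" "q \<in> N p" using I(2) by blast
    then have "1 \<le> T q"
      unfolding T_def using \<psi> N(4) I(1) member_le_sum[of p I "\<lambda>p. \<psi> p q"] by simp
    then show ?thesis by simp
  qed
  have Ts: "smooth A (\<lambda>q. inverse (T q))"
    by (rule smooth_on_inverse) (use \<psi> T in \<open>auto simp: T_def[abs_def] less_le\<close>)
  show ?thesis
  proof (rule that[of I "\<lambda>p q. \<psi> p q * inverse (T q)"])
    show "smooth A (\<lambda>q. \<psi> p q * inverse (T q))" for p using \<psi> Ts by simp
    show "(\<Sum>p\<in>I. \<psi> p q * inverse (T q)) = 1" for q
      using T[of q] by (simp add: sum_distrib_right[symmetric] T_def[symmetric])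
    show "integrable \<mu> (\<lambda>q. \<psi> p q * inverse (T q) * u q)" if "smooth A u" for p u
      using \<psi>[of p] Ts that by (simp add: mult.assoc)
    show "integrable \<mu> (\<lambda>q. X q (\<lambda>z. \<psi> p z * inverse (T z) * u z))
        \<and> (LINT q|\<mu>. X q (\<lambda>z. \<psi> p z * inverse (T z) * u z)) = 0"
      if "preserves X \<theta>" "smooth A u" for p X u
      using \<psi>d[OF that(1), of "\<lambda>z. inverse (T z) * u z" p] Ts that(2) by (simp add: mult.assoc)
  qed (rule I(1))
qed

lemma smooth_integrable:
  assumes u: "smooth A (u :: 'm \<Rightarrow> real)"
  shows "integrable \<mu> u"
proof -
  obtain I :: "'m set" and \<psi> :: "'m \<Rightarrow> 'm \<Rightarrow> real" where P: "finite I" "\<And>q. (\<Sum>p\<in>I. \<psi> p q) = 1"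
    "\<And>p u. smooth A u \<Longrightarrow> integrable \<mu> (\<lambda>q. \<psi> p q * u q)"
    by (rule partition) (rule that)
  have "integrable \<mu> (\<lambda>q. \<Sum>p\<in>I. \<psi> p q * u q)" using P(3)[OF u] by simp
  then show ?thesis by (simp add: sum_distrib_right[symmetric] P(2))
qed

lemma integral_preserving_field:
  assumes X: "preserves X \<theta>" and u: "smooth A u"
  shows "(LINT q|\<mu>. X q u) = 0"
proof -
  have Xv: "X \<in> vector_fields A" using X by (simp add: preserves_def)
  obtain I :: "'m set" and \<psi> :: "'m \<Rightarrow> 'm \<Rightarrow> real" where P: "finite I" "\<And>p. smooth A (\<psi> p)"
    "\<And>q. (\<Sum>p\<in>I. \<psi> p q) = 1"
    "\<And>p X u. preserves X \<theta> \<Longrightarrow> smooth A u \<Longrightarrow> integrable \<mu> (\<lambda>q. X q (\<lambda>z. \<psi> p z * u z))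
        \<and> (LINT q|\<mu>. X q (\<lambda>z. \<psi> p z * u z)) = 0"
    by (rule partition) (rule that)
  have "X q u = (\<Sum>p\<in>I. X q (\<lambda>z. \<psi> p z * u z))" for q
  proof -
    have "X q (\<lambda>z. \<Sum>p\<in>I. \<psi> p z * u z) = (\<Sum>p\<in>I. X q (\<lambda>z. \<psi> p z * u z))"
      by (rule tangent_sum[OF vf_tangent[OF Xv]]) (use P(2) u in simp)
    then show ?thesis by (simp add: sum_distrib_right[symmetric] P(3))
  qed
  then have "(LINT q|\<mu>. X q u) = (LINT q|\<mu>. (\<Sum>p\<in>I. X q (\<lambda>z. \<psi> p z * u z)))" by simp
  also have "\<dots> = (\<Sum>p\<in>I. (LINT q|\<mu>. X q (\<lambda>z. \<psi> p z * u z)))"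
    by (rule Bochner_Integration.integral_sum) (use P(4)[OF X u] in blast)
  also have "\<dots> = 0" using P(4)[OF X u] by simp
  finally show ?thesis .
qed

lemma integral_zero_imp_zero:
  assumes u: "smooth A u" "\<And>q. 0 \<le> u q" and z: "(LINT q|\<mu>. u q) = (0::real)"
  shows "u p = 0"
proof (rule ccontr)
  assume p: "u p \<noteq> 0"
  have cont: "continuous_on UNIV u" using smooth_on_continuous[OF u(1)] by simp
  have o: "open {q. u q \<noteq> 0}"
    using open_Collect_neq[OF cont continuous_on_const] .
  have "AE q in \<mu>. u q = 0"
    using integral_nonneg_eq_0_iff_AE[OF smooth_integrable[OF u(1)]] u(2) z by simp
  then have "emeasure \<mu> {q. u q \<noteq> 0} = 0"
    using o by (subst (asm) AE_iff_measurable[of "{q. u q \<noteq> 0}"]) auto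
  moreover obtain c r V y Y \<beta> s where "volume_chart c p r V y Y \<beta> s" using volume_chart_at .
  ultimately show False using chart_emeasure_pos[OF _ o] p by blast
qed

end

section \<open>The operators on the Hilbert space\<close>

locale quantum_hilbert = quantum_contact A \<theta> \<xi> \<Lambda> L D + contact_measure A n \<theta> \<mu>
  for A :: "('m::t2_space, 'e::euclidean_space) chart set" and \<theta> \<xi> \<Lambda>
    and L :: "('m, 'l) line_bundle" and D and n :: nat and \<mu> :: "'m measure" +
  fixes h :: "'l \<Rightarrow> 'l \<Rightarrow> complex" and sc :: "complex \<Rightarrow> 'h \<Rightarrow> 'h::banach" and ip :: "'h \<Rightarrow> 'h \<Rightarrow> complex"
    and \<iota> :: "('m, 'l) sect \<Rightarrow> 'h"
  assumes herm: "hermitian_metric A L h" and metric: "metric_connection A L h D"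
    and L2: "L2_completion A L h \<mu> sc ip \<iota>"
begin

lemma h_left:
  assumes "l \<in> fibre L p" "l' \<in> fibre L p" "l'' \<in> fibre L p"
  shows "h (fadd L l l') l'' = h l l'' + h l' l''" "h (fscale L k l) l' = k * h l l'" "h l' l = cnj (h l l')"
    "l \<noteq> fscale L 0 l \<Longrightarrow> 0 < Re (h l l)"
  using herm assms unfolding hermitian_metric_def by blast+

lemma h_right:
  assumes l: "l \<in> fibre L p" "l' \<in> fibre L p" "l'' \<in> fibre L p"
  shows "h l'' (fadd L l l') = h l'' l + h l'' l'" "h l' (fscale L k l) = cnj k * h l' l"
proof -
  have "h l'' (fadd L l l') = cnj (h (fadd L l l') l'')"
    using h_left(3)[OF fibre_add[OF l(1,2)] l(3,3)] .
  also have "\<dots> = cnj (h l l'') + cnj (h l' l'')" using h_left(1)[OF l] by simp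
  also have "\<dots> = h l'' l + h l'' l'"
    using h_left(3)[OF l(1,3,3)] h_left(3)[OF l(2,3,3)] by simp
  finally show "h l'' (fadd L l l') = h l'' l + h l'' l'" .
  have "h l' (fscale L k l) = cnj (h (fscale L k l) l')"
    using h_left(3)[OF fibre_scale[OF l(1)] l(2,2)] .
  also have "\<dots> = cnj k * h l' l" using h_left(2)[OF l(1,2,2)] h_left(3)[OF l(1,2,2)] by simp
  finally show "h l' (fscale L k l) = cnj k * h l' l" .
qed

lemma h_smooth [simp]: "s \<in> S \<Longrightarrow> t \<in> S \<Longrightarrow> smooth A (\<lambda>p. h (s p) (t p))"
  using herm unfolding hermitian_metric_def by blast

text \<open>The multiplication term \<open>\<i> f\<close> is pointwise skew, so only the derivative of the metric remains.\<close>

lemma h_Q: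
  assumes f: "smooth A f" and s: "s \<in> S" and t: "t \<in> S"
  shows "h (Q f s p) (t p) + h (s p) (Q f t p) = vf_apply (ham f) (\<lambda>q. h (s q) (t q)) p"
proof -
  have X: "ham f \<in> vector_fields A" using f by simp
  note m = sections_fibre[OF s, of p] sections_fibre[OF t, of p]
    sections_fibre[OF D_section[OF X s], of p] sections_fibre[OF D_section[OF X t], of p]
  have "h (Q f s p) (t p) = h (D (ham f) s p) (t p) + \<i> * of_real (f p) * h (s p) (t p)"
    unfolding quantum_operator_def sec_add_def sec_scale_def
    using h_left(1)[OF m(3) fibre_scale[OF m(1)] m(2)] h_left(2)[OF m(1,2,2)] by simp
  moreover have "h (s p) (Q f t p) = h (s p) (D (ham f) t p) - \<i> * of_real (f p) * h (s p) (t p)"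
    unfolding quantum_operator_def sec_add_def sec_scale_def
    using h_right(1)[OF m(4) fibre_scale[OF m(2)] m(1)] h_right(2)[OF m(2,1,1)] by simp
  moreover have "vf_apply (ham f) (\<lambda>q. h (s q) (t q)) p = h (D (ham f) s p) (t p) + h (s p) (D (ham f) t p)"
    using metric X s t unfolding metric_connection_def by blast
  ultimately show ?thesis by simp
qed

lemma complex_smooth_integrable:
  assumes "smooth A (w :: 'm \<Rightarrow> complex)"
  shows "integrable \<mu> w"
proof -
  have "integrable \<mu> (\<lambda>q. complex_of_real (Re (w q)) + \<i> * complex_of_real (Im (w q)))"
    using assms by (intro Bochner_Integration.integrable_add integrable_mult_right integrable_of_real
        smooth_integrable smooth_on_Re smooth_on_Im)
  then show ?thesis by (simp add: complex_eq[symmetric])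
qed

lemma integral_vf_apply:
  assumes X: "preserves X \<theta>" and w: "smooth A (w :: 'm \<Rightarrow> complex)"
  shows "(LINT q|\<mu>. vf_apply X w q) = 0"
proof -
  have Xv: "X \<in> vector_fields A" using X by (simp add: preserves_def)
  have r: "smooth A (\<lambda>q. Re (w q))" "smooth A (\<lambda>q. Im (w q))" using w by simp_all
  have i: "integrable \<mu> (\<lambda>q. X q (\<lambda>q. Re (w q)))" "integrable \<mu> (\<lambda>q. X q (\<lambda>q. Im (w q)))"
    using vf_smooth[OF Xv r(1)] vf_smooth[OF Xv r(2)] smooth_integrable by blast+
  have "(LINT q|\<mu>. vf_apply X w q)
    = (LINT q|\<mu>. complex_of_real (X q (\<lambda>q. Re (w q))) + \<i> * complex_of_real (X q (\<lambda>q. Im (w q))))"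
    by (simp add: vf_apply_def Complex_eq)
  also have "\<dots> = complex_of_real (LINT q|\<mu>. X q (\<lambda>q. Re (w q))) + \<i> * complex_of_real (LINT q|\<mu>. X q (\<lambda>q. Im (w q)))"
    using i by (subst Bochner_Integration.integral_add) simp_all
  also have "\<dots> = 0" using integral_preserving_field[OF X r(1)] integral_preserving_field[OF X r(2)] by simp
  finally show ?thesis .
qed

lemma \<iota>_props: "complex_hilbert_space sc ip"
  "s \<in> S \<Longrightarrow> t \<in> S \<Longrightarrow> \<iota> (sec_add L s t) = \<iota> s + \<iota> t"
  "s \<in> S \<Longrightarrow> \<iota> (sec_scale L (\<lambda>_. a) s) = sc a (\<iota> s)"
  "s \<in> S \<Longrightarrow> t \<in> S \<Longrightarrow> ip (\<iota> s) (\<iota> t) = (LINT p|\<mu>. h (s p) (t p))"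
  "closure (\<iota> ` S) = UNIV"
  using L2 unfolding L2_completion_def by blast+

lemma sc_real: "sc (of_real r) x = r *\<^sub>R x"
  using \<iota>_props(1) unfolding complex_hilbert_space_def by blast

lemma \<iota>_diff: "s \<in> S \<Longrightarrow> t \<in> S \<Longrightarrow> \<iota> (sec_diff L s t) = \<iota> s - \<iota> t"
  using sc_real[of "-1" "\<iota> t"] by (simp add: sec_diff_def \<iota>_props(2,3))

text \<open>
  Since \<open>\<mu>\<close> charges every nonempty open set, a smooth section of norm zero vanishes. Injectivity is what makes the
  induced operators determined by their action on sections.
\<close>

lemma \<iota>_inj: "inj_on \<iota> S"
proof (rule inj_onI)
  fix s t assume s: "s \<in> S" and t: "t \<in> S" and eq: "\<iota> s = \<iota> t"
  let ?d = "sec_diff L s t"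
  have d: "?d \<in> S" using s t by simp
  have "ip (\<iota> ?d) (\<iota> ?d) = of_real ((norm (\<iota> ?d))\<^sup>2)"
    using \<iota>_props(1) unfolding complex_hilbert_space_def by blast
  then have "(LINT p|\<mu>. h (?d p) (?d p)) = 0"
    using \<iota>_props(4)[OF d d] \<iota>_diff[OF s t] eq by simp
  moreover have real: "h (?d p) (?d p) = of_real (Re (h (?d p) (?d p)))" for p
    using h_left(3)[of "?d p" p "?d p" "?d p"] d by (simp add: complex_eq_iff)
  ultimately have "complex_of_real (LINT p|\<mu>. Re (h (?d p) (?d p))) = 0"
    by (metis (no_types, lifting) Bochner_Integration.integral_cong integral_complex_of_real)
  then have z: "(LINT p|\<mu>. Re (h (?d p) (?d p))) = 0" by simp
  have dich: "?d p = fscale L 0 (?d p) \<or> 0 < Re (h (?d p) (?d p))" for p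
    using h_left(4)[of "?d p" p "?d p" "?d p"] d by auto
  have nonneg: "0 \<le> Re (h (?d p) (?d p))" for p
  proof (cases "?d p = fscale L 0 (?d p)")
    case True
    then have "h (?d p) (?d p) = 0"
      using h_left(2)[of "?d p" p "?d p" "?d p" 0] d by (metis mult_zero_left sections_fibre)
    then show ?thesis by simp
  qed (use dich less_imp_le in blast)
  have "Re (h (?d p) (?d p)) = 0" for p
    by (rule integral_zero_imp_zero[OF _ nonneg z]) (use d in simp)
  then have "?d p = fscale L 0 (?d p)" for p using dich[of p] by simp
  then have "coo p (?d p) = 0" for p using coo_scale[OF sections_fibre[OF d], of p 0] by simp
  then show "s = t" using s t by (intro section_eqI) simp_all
qed

abbreviation Op :: "('m \<Rightarrow> real) \<Rightarrow> 'h \<Rightarrow> 'h" where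
  "Op f \<equiv> completion_operator A L \<iota> (Q f)"

lemma Op_\<iota> [simp]: "s \<in> S \<Longrightarrow> Op f (\<iota> s) = \<iota> (Q f s)"
  unfolding completion_operator_def by (simp add: the_inv_into_f_f[OF \<iota>_inj])

lemma Op_skew_hermitian:
  assumes f: "f \<in> basic_functions A \<xi>"
  shows "skew_hermitian_operator sc ip (\<iota> ` S) (Op f)"
proof -
  note sf = basicD(1)[OF f]
  have "\<iota> s + \<iota> t \<in> \<iota> ` S \<and> Op f (\<iota> s + \<iota> t) = Op f (\<iota> s) + Op f (\<iota> t)" if "s \<in> S" "t \<in> S" for s t
    using that sf by (simp add: \<iota>_props(2)[symmetric] Q_add)
  moreover have "sc a (\<iota> s) \<in> \<iota> ` S \<and> Op f (sc a (\<iota> s)) = sc a (Op f (\<iota> s))" if "s \<in> S" for s a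
    using that sf by (simp add: \<iota>_props(3)[symmetric] Q_scale)
  moreover have "ip (Op f (\<iota> s)) (\<iota> t) = - ip (\<iota> s) (Op f (\<iota> t))" if s: "s \<in> S" and t: "t \<in> S" for s t
  proof -
    have "(LINT p|\<mu>. h (Q f s p) (t p)) + (LINT p|\<mu>. h (s p) (Q f t p))
      = (LINT p|\<mu>. h (Q f s p) (t p) + h (s p) (Q f t p))"
      by (rule Bochner_Integration.integral_add[symmetric]; rule complex_smooth_integrable)
        (use s t sf in simp_all)
    also have "\<dots> = 0"
      unfolding h_Q[OF sf s t] by (rule integral_vf_apply[OF ham_preserves[OF f] h_smooth[OF s t]])
    finally show ?thesis using s t sf by (simp add: \<iota>_props(4) eq_neg_iff_add_eq_0)
  qed
  ultimately show ?thesis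
    unfolding skew_hermitian_operator_def using \<iota>_props(5) by blast
qed

lemma Op_lincomb:
  assumes "smooth A f" "smooth A g" "s \<in> S"
  shows "Op (\<lambda>p. a * f p + b * g p) (\<iota> s) = a *\<^sub>R Op f (\<iota> s) + b *\<^sub>R Op g (\<iota> s)"
  using assms by (simp add: Q_lincomb \<iota>_props(2,3) sc_real)

lemma Op_commutator:
  assumes "\<And>p v. v \<in> tangent_space A p \<Longrightarrow> F p (\<xi> p) v = 0"
    and f: "f \<in> basic_functions A \<xi>" and g: "g \<in> basic_functions A \<xi>" and s: "s \<in> S"
  shows "Op f (Op g (\<iota> s)) - Op g (Op f (\<iota> s)) = Op (jacobi_bracket \<Lambda> \<xi> f g) (\<iota> s)"
  using s basicD(1)[OF f] basicD(1)[OF g] \<iota>_diff[of "Q f (Q g s)" "Q g (Q f s)"]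
    Q_commutator[OF assms] by simp

end

theorem proposition3p18:
  fixes A :: "('m::t2_space, 'e::euclidean_space) chart set"
    and n :: nat
    and \<theta> :: "'m one_form"
    and \<xi> :: "'m vector_field"
    and \<Lambda> :: "'m one_form \<Rightarrow> 'm vector_field"
    and \<mu> :: "'m measure"
    and L :: "('m, 'l) line_bundle"
    and h :: "'l \<Rightarrow> 'l \<Rightarrow> complex"
    and D :: "('m, 'l) covariant_derivative"
    and sc :: "complex \<Rightarrow> 'h \<Rightarrow> 'h::banach"
    and ip :: "'h \<Rightarrow> 'h \<Rightarrow> complex"
    and \<iota> :: "('m, 'l) sect \<Rightarrow> 'h"
  assumes "compact_contact_manifold A n \<theta>"
    and "reeb_field A \<theta> \<xi>"
    and "sharp_map A \<theta> \<xi> \<Lambda>"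
    and "contact_volume A n \<theta> \<mu>"
    and "quantum_bundle A \<theta> L h D"
    and "L2_completion A L h \<mu> sc ip \<iota>"
    and "n = 1 \<longrightarrow> (\<forall>p. \<forall>v\<in>tangent_space A p. curvature_form A L D p (\<xi> p) v = 0)"
  shows "let \<D> = \<iota> ` smooth_sections A L;
             Op = (\<lambda>f. completion_operator A L \<iota> (quantum_operator L D \<Lambda> \<xi> f))
         in (\<forall>f\<in>basic_functions A \<xi>. Op f ` \<D> \<subseteq> \<D> \<and> skew_hermitian_operator sc ip \<D> (Op f)) \<and>
            (\<forall>f\<in>basic_functions A \<xi>. \<forall>g\<in>basic_functions A \<xi>. \<forall>a b. \<forall>x\<in>\<D>.
               (\<lambda>p. a * f p + b * g p) \<in> basic_functions A \<xi> \<and>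
               Op (\<lambda>p. a * f p + b * g p) x = a *\<^sub>R Op f x + b *\<^sub>R Op g x) \<and>
            (\<forall>f\<in>basic_functions A \<xi>. \<forall>g\<in>basic_functions A \<xi>.
               jacobi_bracket \<Lambda> \<xi> f g \<in> basic_functions A \<xi> \<and>
               (\<forall>x\<in>\<D>. Op f (Op g x) - Op g (Op f x) = Op (jacobi_bracket \<Lambda> \<xi> f g) x))"
proof -
  interpret quantum_hilbert A \<theta> \<xi> \<Lambda> L D n \<mu> h sc ip \<iota>
  proof unfold_locales
    show "smooth_atlas A" "\<theta> \<in> one_forms A"
      using assms(1) unfolding compact_contact_manifold_def contact_form_def by blast+
    show "connection A L D" "complex_line_bundle A L" "hermitian_metric A L h" "metric_connection A L h D"
      using assms(5) unfolding quantum_bundle_def metric_connection_def by blast+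
    show "curvature_form A L D p v w = \<i> * of_real (- ext_deriv A \<theta> p v w)"
      if "v \<in> contact_distribution A \<theta> p" "w \<in> contact_distribution A \<theta> p" for p v w
      using assms(5) that unfolding quantum_bundle_def by blast
  qed (use assms in blast)+
  have dim: "DIM('e) = 2 * n + 1" using assms(1) unfolding compact_contact_manifold_def by blast
  note reeb0 = reeb_curvature_zero[OF dim assms(7)]
  show ?thesis
    unfolding Let_def
  proof (intro conjI ballI allI)
    fix f assume f: "f \<in> basic_functions A \<xi>"
    show "Op f ` \<iota> ` S \<subseteq> \<iota> ` S" using basicD(1)[OF f] by auto
    show "skew_hermitian_operator sc ip (\<iota> ` S) (Op f)" by (rule Op_skew_hermitian[OF f])
    fix g assume g: "g \<in> basic_functions A \<xi>"
    show "jacobi_bracket \<Lambda> \<xi> f g \<in> basic_functions A \<xi>" by (rule jacobi_bracket_closed[OF f g])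
    fix x assume "x \<in> \<iota> ` S"
    then obtain s where s: "s \<in> S" "x = \<iota> s" by blast
    show "Op f (Op g x) - Op g (Op f x) = Op (jacobi_bracket \<Lambda> \<xi> f g) x"
      unfolding s(2) by (rule Op_commutator[OF reeb0 f g s(1)])
    show "(\<lambda>p. a * f p + b * g p) \<in> basic_functions A \<xi>" for a b by (rule basic_lincomb[OF f g])
    show "Op (\<lambda>p. a * f p + b * g p) x = a *\<^sub>R Op f x + b *\<^sub>R Op g x" for a b
      unfolding s(2) by (rule Op_lincomb[OF basicD(1)[OF f] basicD(1)[OF g] s(1)])
  qed
qed

end
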